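(* Let $\delta>0$ and let $\xi$ be a real-valued discrete random variable with finite support and $|\xi|_\infty<1$. There exists a fixed constant $C_\xi<1$ such that \[\mathbb{P}\left[\mathrm{growth}(M_n(\xi))>n^{\frac52+\delta}\right]\le C_\xi+o_n(1),\] where $o_n(1)$ denotes a quantity tending to $0$ as $n\to\infty$ (with $\xi$ and $\delta$ fixed).
   Context: For a discrete random variable $\xi$, $|\xi|_\infty:=\max_{a\in\mathbb{R}}\mathbb{P}[\xi=a]$. $M_n(\xi)$ denotes an $n\times n$ random matrix whose entries are independent and each distributed as $\xi$. For a matrix $A$, $\|A\|_{\max}=\max_{i,j}|A_{ij}|$. A square matrix is strongly non-singular if all of its leading principal submatrices (including itself) are non-singular. If the leading $(n-1)\times(n-1)$ principal submatrix of $A\in\mathbb{R}^{n\times n}$ is strongly non-singular, then $A=LU$ for a unique lower unitriangular $L$ and upper triangular $U$, and \[\mathrm{growth}(A)=\max\left\{\|L\|_{\max},\frac{\|U\|_{\max}}{\|A\|_{\max}}\right\}.\] If the leading $(n-1)\times(n-1)$ principal submatrix of $A$ is not strongly non-singular, then $\mathrm{growth}(A)=+\infty$. *)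

theory Defs
  imports "HOL-Probability.Probability" "Jordan_Normal_Form.Determinant"
begin

text \<open>The law of a discrete real random variable is a value of type \<^typ>\<open>real pmf\<close>. The supremum
  below is attained, because only finitely many atoms have mass above any given positive bound.\<close>

definition max_atom :: "real pmf \<Rightarrow> real" where
  "max_atom \<xi> = (SUP a. pmf \<xi> a)"

definition random_matrix :: "nat \<Rightarrow> real pmf \<Rightarrow> real mat pmf" where
  "random_matrix n \<xi> = map_pmf (Matrix.mat n n) (Pi_pmf ({..<n} \<times> {..<n}) 0 (\<lambda>_. \<xi>))"

definition max_norm :: "real mat \<Rightarrow> real" where
  "max_norm A = Max {\<bar>A $$ (i, j)\<bar> | i j. i < dim_row A \<and> j < dim_col A}"

definition leading_principal_submatrix :: "nat \<Rightarrow> 'a mat \<Rightarrow> 'a mat" where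
  "leading_principal_submatrix k A = Matrix.mat k k (\<lambda>(i, j). A $$ (i, j))"

definition strongly_nonsingular :: "real mat \<Rightarrow> bool" where
  "strongly_nonsingular A \<longleftrightarrow> square_mat A \<and>
     (\<forall>k\<in>{1..dim_row A}. Determinant.det (leading_principal_submatrix k A) \<noteq> 0)"

definition lower_unitriangular :: "real mat \<Rightarrow> bool" where
  "lower_unitriangular L \<longleftrightarrow>
     (\<forall>i<dim_row L. L $$ (i, i) = 1 \<and> (\<forall>j<dim_col L. i < j \<longrightarrow> L $$ (i, j) = 0))"

definition is_LU :: "real mat \<Rightarrow> real mat \<Rightarrow> real mat \<Rightarrow> bool" where
  "is_LU A L U \<longleftrightarrow>
     L \<in> carrier_mat (dim_row A) (dim_row A) \<and> U \<in> carrier_mat (dim_row A) (dim_row A) \<and>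
     lower_unitriangular L \<and> upper_triangular U \<and> A = L * U"

lemma nonsing_inverse:
  fixes A :: "real mat"
  assumes "A \<in> carrier_mat n n" "Determinant.det A \<noteq> 0"
  obtains B where "B \<in> carrier_mat n n" "A * B = 1\<^sub>m n" "B * A = 1\<^sub>m n"
proof -
  from det_non_zero_imp_unit[OF assms, of "()"] 
  show thesis unfolding Units_def ring_mat_def using that by auto
qed

lemma lps_dim [simp]: "dim_row (leading_principal_submatrix k A) = k"
    "dim_col (leading_principal_submatrix k A) = k"
  by (simp_all add: leading_principal_submatrix_def)

lemma lps_lps: "k \<le> m \<Longrightarrow>
  leading_principal_submatrix k (leading_principal_submatrix m A) = leading_principal_submatrix k A"
  by (rule eq_matI) (auto simp: leading_principal_submatrix_def)

lemma lps_self: "A \<in> carrier_mat n n \<Longrightarrow> leading_principal_submatrix n A = A"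
  by (rule eq_matI) (auto simp: leading_principal_submatrix_def)

lemma ex1_LU:
  assumes "A \<in> carrier_mat n n"
    and "strongly_nonsingular (leading_principal_submatrix (n - 1) A)"
  shows "\<exists>!LU. case LU of (L, U) \<Rightarrow> is_LU A L U"
  using assms
proof (induction n arbitrary: A)
  case 0
  show ?case
  proof (rule ex1I[of _ "(A, A)"])
    show "case (A, A) of (L, U) \<Rightarrow> is_LU A L U" using 0
      by (auto simp: is_LU_def lower_unitriangular_def upper_triangular_def intro!: eq_matI)
  next
    fix LU :: "real mat \<times> real mat" assume "case LU of (L, U) \<Rightarrow> is_LU A L U"
    then show "LU = (A, A)" using 0 by (cases LU) (auto simp: is_LU_def intro!: eq_matI)
  qed
next
  case (Suc n)
  define A1 where "A1 = leading_principal_submatrix n A"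
  obtain A1' b c d where sp: "split_block A n n = (A1', b, c, d)" by (cases "split_block A n n") auto
  have dims: "dim_row A = n + 1" "dim_col A = n + 1" using Suc.prems by auto
  have A1eq: "A1' = A1" using sp unfolding split_block_def Let_def A1_def leading_principal_submatrix_def
    by (auto intro!: cong_mat)
  note spb = split_block[OF sp dims, unfolded A1eq]
  have A1c: "A1 \<in> carrier_mat n n" by (rule spb(1))
  have sn: "strongly_nonsingular A1" using Suc.prems(2) by (simp add: A1_def)
  have detA1: "Determinant.det A1 \<noteq> 0"
  proof (cases "n = 0")
    case True then show ?thesis using A1c by (auto simp: det_dim_zero)
  next
    case False then show ?thesis using sn lps_self[OF A1c] A1c
      by (auto simp: strongly_nonsingular_def dest!: bspec[of _ _ n])
  qed
  have "strongly_nonsingular (leading_principal_submatrix (n - 1) A1)"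
    using sn A1c lps_lps[of _ "n - 1" A1]
    by (auto simp: strongly_nonsingular_def)
  from Suc.IH[OF A1c this] obtain L1 U1 where LU1: "is_LU A1 L1 U1"
    and uniq: "\<And>L U. is_LU A1 L U \<Longrightarrow> L = L1 \<and> U = U1" by (auto elim!: ex1E)
  have L1: "L1 \<in> carrier_mat n n" and U1: "U1 \<in> carrier_mat n n" and ut: "lower_unitriangular L1"
    "upper_triangular U1" and prod: "A1 = L1 * U1"
    using LU1 A1c by (auto simp: is_LU_def)
  have "Determinant.det L1 * Determinant.det U1 \<noteq> 0" using detA1 prod det_mult[OF L1 U1] by simp
  then have "Determinant.det L1 \<noteq> 0" "Determinant.det U1 \<noteq> 0" by auto
  then obtain L1i U1i where Li: "L1i \<in> carrier_mat n n" "L1 * L1i = 1\<^sub>m n" "L1i * L1 = 1\<^sub>m n"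
    and Ui: "U1i \<in> carrier_mat n n" "U1 * U1i = 1\<^sub>m n" "U1i * U1 = 1\<^sub>m n"
    using nonsing_inverse[OF L1] nonsing_inverse[OF U1] by metis
  note b = spb(2) and c = spb(3) and d = spb(4)
  define x where "x = c * U1i"
  define y where "y = L1i * b"
  define z where "z = d - x * y"
  have x: "x \<in> carrier_mat 1 n" and y: "y \<in> carrier_mat n 1" and z: "z \<in> carrier_mat 1 1"
    using b c d Li Ui by (auto simp: x_def y_def z_def)
  define L where "L = four_block_mat L1 (0\<^sub>m n 1) x (1\<^sub>m 1)"
  define U where "U = four_block_mat U1 y (0\<^sub>m 1 n) z"
  have Lc: "L \<in> carrier_mat (n+1) (n+1)" and Uc: "U \<in> carrier_mat (n+1) (n+1)"
    using L1 U1 z by (auto simp: L_def U_def)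
  have Ly: "L1 * y = b" 
    using Li b L1 unfolding y_def by (simp add: assoc_mult_mat[symmetric, of _ n n _ n _ 1])
  have xU: "x * U1 = c"
    using Ui c U1 unfolding x_def by (simp add: assoc_mult_mat[of _ 1 n _ n _ n])
  have dz: "x * y + z = d" unfolding z_def using x y d by (intro eq_matI) auto
  have "L * U = four_block_mat (L1 * U1 + 0\<^sub>m n 1 * 0\<^sub>m 1 n) (L1 * y + 0\<^sub>m n 1 * z)
     (x * U1 + 1\<^sub>m 1 * 0\<^sub>m 1 n) (x * y + 1\<^sub>m 1 * z)"
    unfolding L_def U_def by (rule mult_four_block_mat) (use L1 U1 x y z in auto)
  also have "\<dots> = four_block_mat A1 b c d"
    using L1 U1 x y z b c Ly xU dz A1c unfolding prod[symmetric] by simp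
  finally have LUA: "A = L * U" using spb(5) by simp
  have ex: "is_LU A L U" unfolding is_LU_def
    using Lc Uc dims LUA ut L1 U1 x y z
    by (auto simp: lower_unitriangular_def upper_triangular_def L_def U_def)
  have un: "M = L \<and> V = U" if "is_LU A M V" for M V
  proof -
    from that have M: "M \<in> carrier_mat (n+1) (n+1)" and V: "V \<in> carrier_mat (n+1) (n+1)"
      and mt: "lower_unitriangular M" and vt: "upper_triangular V" and A: "A = M * V"
      using dims by (auto simp: is_LU_def)
    obtain M1 M2 M3 M4 where sM: "split_block M n n = (M1, M2, M3, M4)" by (cases "split_block M n n") auto
    obtain V1 V2 V3 V4 where sV: "split_block V n n = (V1, V2, V3, V4)" by (cases "split_block V n n") auto
    note bM = split_block[OF sM, of 1 1] and bV = split_block[OF sV, of 1 1]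
    have dM: "dim_row M = n + 1" "dim_col M = n + 1" "dim_row V = n + 1" "dim_col V = n + 1"
      using M V by auto
    note bM = bM[OF dM(1,2)] and bV = bV[OF dM(3,4)]
    have M2: "M2 = 0\<^sub>m n 1" and M4: "M4 = 1\<^sub>m 1" and M1: "lower_unitriangular M1"
      using sM mt dM unfolding split_block_def Let_def
      by (auto simp: lower_unitriangular_def intro!: eq_matI)
    have V3: "V3 = 0\<^sub>m 1 n" and V1: "upper_triangular V1"
      using sV vt dM unfolding split_block_def Let_def
      by (auto simp: upper_triangular_def intro!: eq_matI)
    have "A = four_block_mat (M1 * V1 + M2 * V3) (M1 * V2 + M2 * V4) (M3 * V1 + M4 * V3) (M3 * V2 + M4 * V4)"
      unfolding A by (subst bM(5), subst bV(5), rule mult_four_block_mat) (use bM bV in auto)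
    also have "\<dots> = four_block_mat (M1 * V1) (M1 * V2) (M3 * V1) (M3 * V2 + V4)"
      using bM(1-4) bV(1-4) unfolding M2 M4 V3 by simp
    finally have eq: "four_block_mat A1 b c d = \<dots>" using spb(5) by simp
    have sb: "split_block (four_block_mat P Q R S) n n = (P, Q, R, S)"
      if "P \<in> carrier_mat n n" "Q \<in> carrier_mat n 1" "R \<in> carrier_mat 1 n" "S \<in> carrier_mat 1 1"
      for P Q R S :: "real mat"
      using that unfolding split_block_def Let_def by (auto intro!: eq_matI)
    have "(A1, b, c, d) = (M1 * V1, M1 * V2, M3 * V1, M3 * V2 + V4)"
      using arg_cong[OF eq, of "\<lambda>X. split_block X n n"] A1c b c d bM(1-4) bV(1-4)
      by (subst (asm) (1 2) sb) auto
    then have e: "A1 = M1 * V1" "b = M1 * V2" "c = M3 * V1" "d = M3 * V2 + V4" by auto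
    have "is_LU A1 M1 V1" using M1 V1 e(1) bM bV A1c by (auto simp: is_LU_def)
    from uniq[OF this] have MV1: "M1 = L1" "V1 = U1" by auto
    have V2: "V2 = y" unfolding y_def e(2) MV1 using Li L1 bV(2)
      by (simp add: assoc_mult_mat[symmetric, of _ n n _ n _ 1])
    have M3: "M3 = x" unfolding x_def e(3) MV1 using Ui U1 bM(3)
      by (simp add: assoc_mult_mat[of _ 1 n _ n _ n])
    have V4: "V4 = z" unfolding z_def e(4) V2 M3 using x y bV(4) by (intro eq_matI) auto
    show ?thesis using bM(5) bV(5) unfolding L_def U_def M2 M4 V3 V2 M3 V4 MV1 by simp
  qed
  show ?case
  proof (rule ex1I[of _ "(L, U)"])
    show "case (L, U) of (L, U) \<Rightarrow> is_LU A L U" using ex by simp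
  next
    fix LU :: "real mat \<times> real mat" assume *: "case LU of (L, U) \<Rightarrow> is_LU A L U"
    obtain M V where LU: "LU = (M, V)" by (cases LU)
    with * have "is_LU A M V" by simp
    from un[OF this] show "LU = (L, U)" unfolding LU by (elim conjE) (rule arg_cong2[of _ _ _ _ Pair])
  qed
qed

text \<open>Under the condition of the first branch the factorization exists and is unique (lemma
  \<open>ex1_LU\<close>). The quotient has denominator 0 only for the \<open>1 \<times> 1\<close> zero matrix: any larger
  zero matrix has a singular leading principal submatrix.\<close>

definition growth :: "real mat \<Rightarrow> ereal" where
  "growth A =
     (if strongly_nonsingular (leading_principal_submatrix (dim_row A - 1) A)
      then let (L, U) = (THE (L, U). is_LU A L U)
           in ereal (max (max_norm L) (max_norm U / max_norm A))
      else \<infinity>)"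

end

theory Submission
  imports Defs "HOL-Real_Asymp.Real_Asymp"
begin

text \<open>
  If every leading submatrix \<open>A\<^sub>k\<close> with \<open>k < n\<close> satisfies \<open>|A\<^sub>k x| \<ge> s |x|\<close>, then the formulas
  \<open>L\<^sub>i\<^sub>j = row\<^sub>i \<bullet> A\<^sub>j^(-1) e\<^sub>j\<close> and \<open>U\<^sub>i\<^sub>j = A\<^sub>i\<^sub>j - row\<^sub>i \<bullet> A\<^sub>i^(-1) col\<^sub>j\<close> bound the growth factor by
  \<open>1 + n K / s\<close>, where \<open>K\<close> bounds the entries. So \<open>s = n^(-3/2 - \<delta>/2)\<close> has to work for all \<open>k\<close> at once.

  For \<open>k > m\<close> this follows from a union bound over the estimate of Rudelson and Vershynin,
  \<open>P(\<exists>x. |x| = 1 \<and> |A\<^sub>k x| \<le> s) \<le> C k^(1/2) s + exp(-k^(7/10))\<close>. The smoothed small ball probability of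
  \<open>X \<bullet> x\<close> is at most a Gaussian average over \<open>\<theta>\<close> of \<open>exp(-c dist(\<theta> x, Z^n)^2)\<close>. A vector for which some
  \<open>\<theta> x\<close> with \<open>\<theta> \<approx> D\<close> is within \<open>\<alpha> = n^(2/5)\<close> of the lattice is close to a normalized integer vector. There
  are about \<open>(C D / n^(1/2))^n\<close> of these, and each is almost in the kernel with probability
  \<open>(C \<alpha> / D)^(n-1)\<close>, so that \<open>\<alpha> = n^(2/5)\<close> against \<open>n^(1/2)\<close> gives a factor \<open>n^(-n/10)\<close>.

  For \<open>k \<le> m\<close> with \<open>m\<close> fixed there are only finitely many matrices, so non-singularity is enough.
  Given that \<open>A\<^sub>m\<close> is non-singular, the bounds of Odlyzko and Littlewood-Offord show that the next
  leading submatrix is singular with probability \<open>O(m^(-1/2))\<close>. Hence \<open>A\<^sub>1, \<dots>, A\<^sub>m\<close> are all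
  non-singular with probability at least \<open>a exp(-C m^(1/2))\<close>, which for large \<open>m\<close> exceeds the sum of
  \<open>exp(-k^(7/10))\<close> over \<open>k > m\<close>. This comparison is why the failure probabilities have to be smaller
  than any polynomial.
\<close>


text \<open>The exponent 5/2 has two sources. Summing C k^(1/2) s over k < n costs n^(3/2) s, so s
  must lie slightly below n^(-3/2), and the bound on the factors costs another n / s. No bound
  tending to 0 is possible: the entries of the 2 x 2 corner all coincide with a fixed positive
  probability, and then the growth is infinite for n \<ge> 3. Singularity of a small block and bad
  conditioning of a larger one are not independent, so they are combined by a union bound, in which
  the failures beyond m may use up only half of the probability that the first m blocks are
  non-singular.

  The entries need not have mean 0. In that case the matrix has norm of order n instead of n^(1/2),
  caused by the all-ones direction, and replacing a vector by a net point would lose too much. Only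
  the centered matrix is controlled in operator norm. The mean contributes a multiple of the
  all-ones vector, which is discretized separately at a polynomial price; the Gaussian average does
  not notice this shift, because taking absolute values of the characteristic function removes
  it.\<close>

abbreviation (input) Pr :: "'a pmf \<Rightarrow> 'a set \<Rightarrow> real" where
  "Pr p \<equiv> measure_pmf.prob p"

abbreviation (input) Mean :: "'a pmf \<Rightarrow> ('a \<Rightarrow> 'b) \<Rightarrow> 'b :: {banach, second_countable_topology}" where
  "Mean p \<equiv> measure_pmf.expectation p"

abbreviation (input) gauss :: "real measure" where
  "gauss \<equiv> std_normal_distribution"

section \<open>Fourier decay of a non-degenerate discrete law\<close>

definition rdist :: "real \<Rightarrow> real" where
  "rdist u = \<bar>u - of_int (round u)\<bar>"

lemma rdist_nonneg [simp]: "0 \<le> rdist u"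
  by (simp add: rdist_def)

lemma rdist_le_int: "rdist u \<le> \<bar>u - of_int z\<bar>"
  unfolding rdist_def using round_diff_minimal[of u z] by simp

lemma rdist_le_abs: "rdist u \<le> \<bar>u\<bar>"
  using rdist_le_int[of u 0] by simp

lemma rdist_le_half: "rdist u \<le> 1/2"
  unfolding rdist_def using of_int_round_abs_le[of u] by (simp add: abs_minus_commute)

lemma rdist_minus [simp]: "rdist (- u) = rdist u"
proof -
  have "rdist (- v) \<le> rdist v" for v
    using rdist_le_int[of "- v" "- round v"] by (simp add: rdist_def abs_minus_commute)
  from this[of u] this[of "-u"] show ?thesis by simp
qed

lemma rdist_small: "\<bar>u\<bar> \<le> 1/2 \<Longrightarrow> rdist u = \<bar>u\<bar>"
proof (rule antisym)
  assume u: "\<bar>u\<bar> \<le> 1/2"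
  show "rdist u \<le> \<bar>u\<bar>" by (rule rdist_le_abs)
  show "\<bar>u\<bar> \<le> rdist u"
  proof (cases "round u = 0")
    case False
    then have "1 \<le> \<bar>of_int (round u) :: real\<bar>" by linarith
    with u show ?thesis by (simp add: rdist_def)
  qed (simp add: rdist_def)
qed

lemma borel_measurable_rdist [measurable]: "rdist \<in> borel_measurable borel"
  unfolding rdist_def round_def by measurable

text \<open>Taylor expansion to order 4: the remainder is at most x^4 / 24, hence below x^4 / 16,
  and x^4 \<le> 4 x^2 on this range, so that half of the quadratic term survives.\<close>

lemma cos_le_quadratic:
  fixes x :: real
  assumes "\<bar>x\<bar> \<le> 2"
  shows "cos x \<le> 1 - x\<^sup>2 / 4"
proof -
  obtain t where t: "cos x = (\<Sum>m<4. cos_coeff m * x ^ m) + cos (t + 1 / 2 * real 4 * pi) / fact 4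
      * x ^ 4"
    using Maclaurin_cos_expansion[of x 4] by blast
  have "(\<Sum>m<4. cos_coeff m * x ^ m) = 1 - x\<^sup>2 / 2"
  proof -
    have "{..<4::nat} = {0, 1, 2, 3}" by auto
    then show ?thesis by (simp add: cos_coeff_def)
  qed
  moreover have "cos (t + 1 / 2 * real 4 * pi) / fact 4 * x ^ 4 \<le> x ^ 4 / 16"
  proof -
    have "cos (t + 1 / 2 * real 4 * pi) / fact 4 * x ^ 4 \<le> 1 / 16 * x ^ 4"
    proof (rule mult_right_mono)
      have "c \<le> 1 \<Longrightarrow> c / fact 4 \<le> 1 / 16" for c :: real by (simp add: fact_numeral)
      then show "cos (t + 1 / 2 * real 4 * pi) / fact 4 \<le> 1 / 16"
        by (metis cos_le_one)
    qed simp
    then show ?thesis by simp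
  qed
  moreover have "x ^ 4 \<le> 4 * x\<^sup>2"
  proof -
    have "x\<^sup>2 \<le> 4" using assms abs_le_square_iff[of x 2] by simp
    then have "x\<^sup>2 * x\<^sup>2 \<le> 4 * x\<^sup>2" by (intro mult_right_mono) auto
    then show ?thesis by (simp add: power4_eq_xxxx power2_eq_square)
  qed
  ultimately show ?thesis unfolding t by linarith
qed

text \<open>Both sides are unchanged when u moves by an integer, so u may be taken in [-1/2, 1/2],
  where the cosine is nonnegative and the quadratic bound applies with pi^2 / 4 \<ge> 1.\<close>

lemma abs_cos_pi_le: "\<bar>cos (pi * u)\<bar> \<le> 1 - (rdist u)\<^sup>2"
proof -
  define r where "r = u - of_int (round u)"
  have r: "\<bar>r\<bar> \<le> 1/2" using rdist_le_half[of u] by (simp add: rdist_def r_def)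
  have "\<bar>cos (pi * u)\<bar> = \<bar>cos (pi * r + pi * of_int (round u))\<bar>"
    by (simp add: r_def algebra_simps)
  also have "\<dots> = \<bar>cos (pi * r)\<bar>"
    by (simp add: cos_add)
  also have "\<dots> = cos (pi * r)"
  proof -
    have "\<bar>pi * r\<bar> \<le> pi / 2" using mult_left_mono[OF r, of pi] by (simp add: abs_mult)
    then have "- (pi / 2) \<le> pi * r" "pi * r \<le> pi / 2" by linarith+
    then show ?thesis using cos_ge_zero[of "pi * r"] by simp
  qed
  also have "\<dots> \<le> 1 - (pi * r)\<^sup>2 / 4"
  proof (rule cos_le_quadratic)
    have "\<bar>pi * r\<bar> \<le> 4 * (1/2)" unfolding abs_mult using r pi_less_4 by (intro mult_mono) auto
    then show "\<bar>pi * r\<bar> \<le> 2" by simp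
  qed
  also have "\<dots> \<le> 1 - r\<^sup>2"
  proof -
    have "2\<^sup>2 * r\<^sup>2 \<le> pi\<^sup>2 * r\<^sup>2" using pi_gt3 by (intro mult_right_mono power_mono) auto
    then show ?thesis by (simp add: power_mult_distrib)
  qed
  finally show ?thesis by (simp add: rdist_def r_def)
qed

section \<open>Characteristic function of a law with two atoms\<close>

lemma norm_cis_add: "cmod (cis a + cis b) = 2 * \<bar>cos ((a - b) / 2)\<bar>"
proof -
  have "cis a + cis b = cis ((a + b) / 2) * (cis ((a - b) / 2) + cis (- ((a - b) / 2)))"
    unfolding distrib_left cis_mult by (simp add: field_simps)
  also have "cis ((a - b) / 2) + cis (- ((a - b) / 2)) = complex_of_real (2 * cos ((a - b) / 2))"
    by (simp add: complex_eq_iff)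
  finally show ?thesis by (simp add: norm_mult del: of_real_mult)
qed

lemma two_atoms:
  assumes "max_atom \<xi> < 1"
  obtains a b where "a \<in> set_pmf \<xi>" "b \<in> set_pmf \<xi>" "a \<noteq> b"
proof -
  obtain a where a: "a \<in> set_pmf \<xi>" using set_pmf_not_empty[of \<xi>] by blast
  have "\<exists>b\<in>set_pmf \<xi>. b \<noteq> a"
  proof (rule ccontr)
    assume "\<not> ?thesis"
    then have "set_pmf \<xi> = {a}" using a by blast
    then have "\<xi> = return_pmf a" by (metis set_pmf_subset_singleton order_refl)
    then have "pmf \<xi> a = 1" by (metis pmf_return indicator_simps(1) singletonI)
    moreover have "pmf \<xi> a \<le> max_atom \<xi>"
      unfolding max_atom_def by (rule cSUP_upper) (auto intro!: bdd_aboveI[of _ 1] simp: pmf_le_1)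
    ultimately show False using assms by linarith
  qed
  then show thesis using that[OF a] by blast
qed

text \<open>Mass q is taken from each of the two atoms. This pair contributes 2 q |cos (t (a - b) /
  2)|, at most 2 q (1 - dist^2), and the remaining mass 1 - 2 q is estimated trivially. The factor
  |a - b| / (2 pi) is the inverse of the period of |cos (t (a - b) / 2)| in t.\<close>

lemma char_bound_atoms:
  assumes fin: "finite (set_pmf \<xi>)" and ab: "a \<in> set_pmf \<xi>" "b \<in> set_pmf \<xi>" "a \<noteq> b"
  shows "cmod (Mean \<xi> (\<lambda>x. cis (t * x)))
     \<le> exp (- (2 * min (pmf \<xi> a) (pmf \<xi> b)) * (rdist (\<bar>a - b\<bar> / (2 * pi) * t))\<^sup>2)"
proof -
  define q where "q = min (pmf \<xi> a) (pmf \<xi> b)"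
  define S where "S = set_pmf \<xi> - {a, b}"
  have q0: "q > 0" using ab by (simp add: q_def pmf_positive)
  have Seq: "set_pmf \<xi> = insert a (insert b S)" and Sfin: "finite S" and nS: "a \<notin> insert b S" "b \<notin>
      S"
    using ab fin by (auto simp: S_def)
  have one: "pmf \<xi> a + pmf \<xi> b + (\<Sum>x\<in>S. pmf \<xi> x) = 1"
    using sum_pmf_eq_1[OF fin order_refl] nS Sfin unfolding Seq by simp
  have "Mean \<xi> (\<lambda>x. cis (t * x)) = (\<Sum>x\<in>set_pmf \<xi>. pmf \<xi> x *\<^sub>R cis (t * x))"
    by (rule integral_measure_pmf) (use fin in auto)
  also have "\<dots> = q *\<^sub>R (cis (t * a) + cis (t * b)) + ((pmf \<xi> a - q) *\<^sub>R cis (t * a) + 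
      ((pmf \<xi> b - q) *\<^sub>R cis (t * b) + (\<Sum>x\<in>S. pmf \<xi> x *\<^sub>R cis (t * x))))"
    unfolding Seq using nS Sfin by (simp add: scaleR_add_right scaleR_diff_left)
  also have "cmod \<dots> \<le> cmod (q *\<^sub>R (cis (t * a) + cis (t * b))) + (cmod ((pmf \<xi> a - q) *\<^sub>R cis (t
      * a)) + 
      (cmod ((pmf \<xi> b - q) *\<^sub>R cis (t * b)) + cmod (\<Sum>x\<in>S. pmf \<xi> x *\<^sub>R cis (t * x))))"
    by (intro order_trans[OF norm_triangle_ineq] add_mono order_refl)
  finally have main: "cmod (Mean \<xi> (\<lambda>x. cis (t * x))) \<le>
      cmod (q *\<^sub>R (cis (t * a) + cis (t * b))) + (cmod ((pmf \<xi> a - q) *\<^sub>R cis (t * a)) +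
      (cmod ((pmf \<xi> b - q) *\<^sub>R cis (t * b)) + cmod (\<Sum>x\<in>S. pmf \<xi> x *\<^sub>R cis (t * x))))" .
  have rest: "cmod (\<Sum>x\<in>S. pmf \<xi> x *\<^sub>R cis (t * x)) \<le> (\<Sum>x\<in>S. pmf \<xi> x)"
    by (rule order_trans[OF norm_sum]) (auto intro!: sum_mono)
  have ab': "cmod ((pmf \<xi> a - q) *\<^sub>R cis (t * a)) = pmf \<xi> a - q"
    "cmod ((pmf \<xi> b - q) *\<^sub>R cis (t * b)) = pmf \<xi> b - q" by (simp_all add: q_def)
  define R where "R = (rdist (\<bar>a - b\<bar> / (2 * pi) * t))\<^sup>2"
  have arg: "pi * ((a - b) / (2 * pi) * t) = (t * a - t * b) / 2" by (simp add: field_simps)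
  have "rdist ((a - b) / (2 * pi) * t) = rdist (\<bar>a - b\<bar> / (2 * pi) * t)"
  proof (cases "a \<ge> b")
    case False
    then have "\<bar>a - b\<bar> / (2 * pi) * t = - ((a - b) / (2 * pi) * t)" by (simp add: field_simps)
    then show ?thesis by (simp only: rdist_minus)
  qed simp
  then have "\<bar>cos ((t * a - t * b) / 2)\<bar> \<le> 1 - R"
    using abs_cos_pi_le[of "(a - b) / (2 * pi) * t"] unfolding arg R_def by simp
  then have "q * (2 * \<bar>cos ((t * a - t * b) / 2)\<bar>) \<le> q * (2 * (1 - R))"
    using q0 by (intro mult_left_mono) auto
  then have "cmod (q *\<^sub>R (cis (t * a) + cis (t * b))) \<le> 2 * q - 2 * q * R"
    using q0 by (simp add: norm_cis_add algebra_simps del: scaleR_add_right)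
  with main rest ab' one have "cmod (Mean \<xi> (\<lambda>x. cis (t * x))) \<le> 1 - 2 * q * R"
    by linarith
  also have "\<dots> \<le> exp (- (2 * q) * R)"
    using exp_ge_add_one_self[of "- (2 * q) * R"] by simp
  finally show ?thesis unfolding q_def R_def .
qed

section \<open>Fubini and independence, free of integrability conditions because the supports are
  finite\<close>

lemma expectation_pair_pmf_finite:
  fixes f :: "'a \<times> 'b \<Rightarrow> 'c :: {banach, second_countable_topology}"
  assumes "finite (set_pmf p)" "finite (set_pmf q)"
  shows "Mean (pair_pmf p q) f =
    Mean p (\<lambda>x. Mean q (\<lambda>y. f (x, y)))"
proof -
  have "Mean (pair_pmf p q) f = 
      (\<Sum>z\<in>set_pmf p \<times> set_pmf q. pmf (pair_pmf p q) z *\<^sub>R f z)"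
    by (rule integral_measure_pmf) (use assms in auto)
  also have "\<dots> = (\<Sum>x\<in>set_pmf p. \<Sum>y\<in>set_pmf q. pmf p x *\<^sub>R pmf q y *\<^sub>R f (x, y))"
    by (subst sum.cartesian_product, intro sum.cong) (auto simp: pmf_pair)
  also have "\<dots> = (\<Sum>x\<in>set_pmf p. pmf p x *\<^sub>R Mean q (\<lambda>y. f (x, y)))"
    by (intro sum.cong refl)
       (subst integral_measure_pmf[of "set_pmf q"], auto simp: assms scaleR_sum_right)
  also have "\<dots> = Mean p (\<lambda>x. Mean q (\<lambda>y. f (x, y)))"
    by (rule integral_measure_pmf[symmetric]) (use assms in auto)
  finally show ?thesis .
qed

lemma finite_set_Pi_pmf [simp]:
  "finite A \<Longrightarrow> (\<And>a. a \<in> A \<Longrightarrow> finite (set_pmf (p a))) \<Longrightarrow> finite (set_pmf (Pi_pmf A d p))"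
  by (subst set_Pi_pmf) auto

lemma expectation_prod_Pi_pmf_finite:
  fixes f :: "'a \<Rightarrow> 'b \<Rightarrow> 'c :: {real_normed_field, banach, second_countable_topology}"
  assumes "finite A" "\<And>a. a \<in> A \<Longrightarrow> finite (set_pmf (p a))"
  shows "Mean (Pi_pmf A d p) (\<lambda>y. \<Prod>a\<in>A. f a (y a)) =
     (\<Prod>a\<in>A. Mean (p a) (f a))"
  using assms
proof (induction rule: finite_induct)
  case (insert x A)
  have *: "(\<Prod>z\<in>A. f z (if z = x then a else b z)) = (\<Prod>z\<in>A. f z (b z))" for a b
    by (intro prod.cong) (use insert.hyps in auto)
  show ?case using insert
    by (simp add: Pi_pmf_insert case_prod_unfold expectation_pair_pmf_finite * cong: if_cong)
qed simp

section \<open>Gaussian smoothing\<close>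

lemma prob_space_std_normal: "prob_space gauss"
  using real_dist_normal_dist by (simp add: real_distribution_def)

lemma integrable_std_normal_bounded:
  fixes f :: "real \<Rightarrow> 'a :: {banach, second_countable_topology}"
  assumes "f \<in> borel_measurable borel" "\<And>g. norm (f g) \<le> B"
  shows "integrable gauss f"
proof -
  interpret prob_space gauss by (rule prob_space_std_normal)
  show ?thesis by (rule integrable_const_bound[of _ B]) (use assms in auto)
qed

lemma has_bochner_integral_std_normal_exp:
  assumes "1 + 2 * a > 0"
  shows "has_bochner_integral gauss (\<lambda>g. exp (s * g - a * g\<^sup>2))
     (exp (s\<^sup>2 / (2 * (1 + 2 * a))) / sqrt (1 + 2 * a))"
proof -
  define b where "b = 1 + 2 * a"
  define \<sigma> where "\<sigma> = 1 / sqrt b"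
  have b: "b > 0" using assms by (simp add: b_def)
  have \<sigma>: "\<sigma> > 0" "\<sigma>\<^sup>2 = 1 / b" using b by (simp_all add: \<sigma>_def power_divide)
  have eq: "std_normal_density g * exp (s * g - a * g\<^sup>2) =
     exp (s\<^sup>2 / (2 * b)) / sqrt b * normal_density (s / b) \<sigma> g" for g
  proof -
    have "- g\<^sup>2 / 2 + (s * g - a * g\<^sup>2) = s\<^sup>2 / (2 * b) + - (g - s / b)\<^sup>2 / (2 * (1 / b))"
    proof -
      have "(g - s / b)\<^sup>2 / (2 * (1 / b)) = b * g\<^sup>2 / 2 - s * g + s\<^sup>2 / (2 * b)"
        using b by (simp add: power2_eq_square field_simps)
      moreover have "b * g\<^sup>2 / 2 = g\<^sup>2 / 2 + a * g\<^sup>2" by (simp add: b_def field_simps)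
      ultimately show ?thesis by linarith
    qed
    moreover have "sqrt (2 * pi * (1 / b)) = sqrt (2 * pi) / sqrt b" using b
      by (simp add: real_sqrt_divide)
    ultimately show ?thesis
      unfolding normal_density_def \<sigma>(2) using b by (simp add: exp_add[symmetric] mult.commute)
  qed
  have "has_bochner_integral lborel (\<lambda>g. exp (s\<^sup>2 / (2 * b)) / sqrt b * normal_density (s / b) \<sigma> g)
    (exp (s\<^sup>2 / (2 * b)) / sqrt b * 1)"
    using \<sigma> by (intro has_bochner_integral_mult_right) (simp add: has_bochner_integral_iff)
  then have "has_bochner_integral lborel (\<lambda>g. std_normal_density g *\<^sub>R exp (s * g - a * g\<^sup>2))
    (exp (s\<^sup>2 / (2 * b)) / sqrt b)" by (simp add: eq)
  then show ?thesis unfolding b_def[symmetric]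
    by (intro has_bochner_integral_density) auto
qed

lemma has_bochner_integral_std_normal_exp_sq:
  "1 + 2 * a > 0 \<Longrightarrow>
    has_bochner_integral gauss (\<lambda>g. exp (- a * g\<^sup>2)) (1 / sqrt (1 + 2 * a))"
  using has_bochner_integral_std_normal_exp[of a 0] by simp

lemma borel_measurable_cis [measurable]: "cis \<in> borel_measurable borel"
  by (intro borel_measurable_continuous_onI continuous_intros)

lemma cis_sum: "cis (\<Sum>i\<in>A. f i) = (\<Prod>i\<in>A. cis (f i))"
  by (induction A rule: infinite_finite_induct) (auto simp: cis_mult[symmetric])

text \<open>The squared Euclidean distance of \<theta> x to the lattice Z^n, since each coordinate
  can be rounded separately.\<close>

definition int_dist_sq :: "nat \<Rightarrow> real \<Rightarrow> (nat \<Rightarrow> real) \<Rightarrow> real" where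
  "int_dist_sq n \<theta> x = (\<Sum>j<n. (rdist (\<theta> * x j))\<^sup>2)"

lemma int_dist_sq_nonneg [simp]: "0 \<le> int_dist_sq n \<theta> x"
  by (simp add: int_dist_sq_def sum_nonneg)

lemma int_dist_sq_abs [simp]: "int_dist_sq n \<bar>\<theta>\<bar> x = int_dist_sq n \<theta> x"
proof -
  have "rdist (\<bar>\<theta>\<bar> * x j) = rdist (\<theta> * x j)" for j
    using rdist_minus[of "\<theta> * x j"] by (cases "\<theta> \<ge> 0") auto
  then show ?thesis by (simp add: int_dist_sq_def)
qed

lemma borel_measurable_int_dist_sq [measurable]: "(\<lambda>g. int_dist_sq n (f g) x) \<in> borel_measurable M"
  if [measurable]: "f \<in> borel_measurable M"
  unfolding int_dist_sq_def by measurable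

text \<open>\<open>h\<close> is the frequency scale and \<open>c0\<close> the rate of the Fourier
  decay; two atoms a and b supply h = |a - b| / (2 pi) and twice the smaller of their masses. The
  normalization \<open>1 \<le> K\<close> keeps the constants built from \<open>K\<close> bounded
  below.\<close>

locale discrete_law =
  fixes \<xi> :: "real pmf" and K c0 h :: real
  assumes fin: "finite (set_pmf \<xi>)"
    and bound: "\<And>x. x \<in> set_pmf \<xi> \<Longrightarrow> \<bar>x\<bar> \<le> K"
    and K: "1 \<le> K" and c0: "0 < c0" and h: "0 < h"
    and char_bound: "\<And>t. cmod (Mean \<xi> (\<lambda>x. cis (t * x))) \<le> exp (- c0 * (rdist (h * t))\<^sup>2)"
begin

abbreviation rvec :: "nat \<Rightarrow> (nat \<Rightarrow> real) pmf" where
  "rvec n \<equiv> Pi_pmf {..<n} 0 (\<lambda>_. \<xi>)"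

text \<open>A majorant for the smoothed concentration of X \<bullet> x at radius h / \<sigma>, in
  which the characteristic function has been replaced by its bound. It depends on x only through
  lattice distances.\<close>

definition Q :: "nat \<Rightarrow> (nat \<Rightarrow> real) \<Rightarrow> real \<Rightarrow> real" where
  "Q n x \<sigma> = (\<integral>g. exp (- c0 * int_dist_sq n (\<sigma> * g) x) \<partial>gauss)"

lemma finite_rvec [simp]: "finite (set_pmf (rvec n))"
  using fin by simp

lemma exp_int_dist_sq_le_1: "exp (- c0 * int_dist_sq n \<theta> x) \<le> 1"
  using c0 by (simp add: mult_nonneg_nonneg)

lemma integrable_exp_int_dist_sq: "integrable gauss (\<lambda>g. exp (- c0 * int_dist_sq n (\<sigma> * g) x))"
  using exp_int_dist_sq_le_1 by (intro integrable_std_normal_bounded[of _ 1]) auto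

lemma norm_char_rvec_le:
  "cmod (Mean (rvec n) (\<lambda>X. cis (t * (\<Sum>j<n. X j * x j)))) \<le> exp (- c0 * int_dist_sq n (h * t) x)"
proof -
  have "Mean (rvec n) (\<lambda>X. cis (t * (\<Sum>j<n. X j * x j))) =
     Mean (rvec n) (\<lambda>X. \<Prod>j<n. cis (t * x j * X j))"
    by (simp add: sum_distrib_left cis_sum mult_ac)
  also have "\<dots> = (\<Prod>j<n. Mean \<xi> (\<lambda>y. cis (t * x j * y)))"
    by (rule expectation_prod_Pi_pmf_finite) (use fin in auto)
  also have "cmod \<dots> \<le> (\<Prod>j<n. exp (- c0 * (rdist (h * (t * x j)))\<^sup>2))"
    unfolding prod_norm[symmetric] by (intro prod_mono conjI char_bound) auto
  also have "\<dots> = exp (- c0 * int_dist_sq n (h * t) x)"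
    by (simp add: int_dist_sq_def sum_distrib_left mult_ac flip: exp_sum sum_negf)
  finally show ?thesis .
qed

text \<open>The Gaussian kernel is the characteristic function of a standard normal g, so the left
  side is a double mean of cis (g (S - r) / \<tau>). Averaging over X first and taking absolute
  values makes the centre r disappear and leaves the Fourier bound.\<close>

lemma gauss_smoothing:
  assumes "\<tau> > 0"
  shows "Mean (rvec n) (\<lambda>X. exp (- ((\<Sum>j<n. X j * x j) - r)\<^sup>2 / (2 * \<tau>\<^sup>2))) \<le> Q n x (h / \<tau>)"
proof -
  interpret G: prob_space gauss by (rule prob_space_std_normal)
  define S where "S X = (\<Sum>j<n. X j * x j)" for X :: "nat \<Rightarrow> real"
  define E where "E g = Mean (rvec n) (\<lambda>X. cis (g / \<tau> * (S X - r)))" for g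
  have Esum: "E g = (\<Sum>X\<in>set_pmf (rvec n). pmf (rvec n) X *\<^sub>R cis (g / \<tau> * (S X - r)))" for g
    unfolding E_def by (rule integral_measure_pmf) auto
  have char: "complex_of_real (exp (- (S X - r)\<^sup>2 / (2 * \<tau>\<^sup>2))) =
     (\<integral>g. cis (g / \<tau> * (S X - r)) \<partial>gauss)" for X
  proof -
    have "complex_of_real (exp (- (S X - r)\<^sup>2 / (2 * \<tau>\<^sup>2))) = char gauss ((S X - r) / \<tau>)"
      by (simp add: char_std_normal_distribution power_divide)
    then show ?thesis by (simp add: char_def cis_conv_exp mult_ac)
  qed
  have "complex_of_real (Mean (rvec n) (\<lambda>X. exp (- (S X - r)\<^sup>2 / (2 * \<tau>\<^sup>2)))) =
     (\<Sum>X\<in>set_pmf (rvec n). pmf (rvec n) X *\<^sub>R complex_of_real (exp (- (S X - r)\<^sup>2 / (2 * \<tau>\<^sup>2))))"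
    by (subst integral_measure_pmf[of "set_pmf (rvec n)"]) (auto simp: scaleR_conv_of_real)
  also have "\<dots> = (\<integral>g. E g \<partial>gauss)"
    unfolding char Esum
    by (subst Bochner_Integration.integral_sum)
       (auto intro!: integrable_std_normal_bounded[of _ 1] simp: pmf_le_1)
  finally have eq: "complex_of_real (Mean (rvec n) (\<lambda>X. exp (- (S X - r)\<^sup>2 / (2 * \<tau>\<^sup>2)))) =
     (\<integral>g. E g \<partial>gauss)" .
  have Ebd: "cmod (E g) \<le> exp (- c0 * int_dist_sq n (h / \<tau> * g) x)" for g
  proof -
    have "cis (g / \<tau> * (S X - r)) = cis (- (g / \<tau> * r)) * cis (g / \<tau> * S X)" for X
      by (simp add: cis_mult algebra_simps)
    then have "cmod (E g) = cmod (Mean (rvec n) (\<lambda>X. cis (g / \<tau> * S X)))"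
      by (simp add: E_def norm_mult)
    also have "\<dots> \<le> exp (- c0 * int_dist_sq n (h * (g / \<tau>)) x)"
      unfolding S_def by (rule norm_char_rvec_le)
    finally show ?thesis by simp
  qed
  have "Mean (rvec n) (\<lambda>X. exp (- (S X - r)\<^sup>2 / (2 * \<tau>\<^sup>2))) \<le>
     cmod (complex_of_real (Mean (rvec n) (\<lambda>X. exp (- (S X - r)\<^sup>2 / (2 * \<tau>\<^sup>2)))))"
    by (simp only: norm_of_real abs_ge_self)
  also have "\<dots> \<le> (\<integral>g. cmod (E g) \<partial>gauss)"
    unfolding eq by (rule integral_norm_bound)
  also have "\<dots> \<le> Q n x (h / \<tau>)" unfolding Q_def
  proof (rule integral_mono[OF _ integrable_exp_int_dist_sq])
    have "cmod (E g) \<le> 1" for g using Ebd[of g] exp_int_dist_sq_le_1 by (rule order_trans)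
    then show "integrable gauss (\<lambda>g. cmod (E g))"
      by (intro integrable_std_normal_bounded[of _ 1]) (auto simp: Esum)
  qed (rule Ebd)
  finally show ?thesis by (simp add: S_def)
qed

text \<open>Three ranges of \<sigma> g. Up to T1 the lattice distance grows linearly, which leaves a
  Gaussian integral of order 1 / (\<sigma> \<gamma>); from there to T2 the distance is at least
  \<beta>; beyond T2 the weight exp(g^2 / 4 - (T2 / \<sigma>)^2 / 4) is at least 1, and its mean is
  the last term. \<open>F\<close> is the sum of the three majorants.\<close>

lemma Q_le_main:
  assumes \<sigma>: "\<sigma> > 0" and \<gamma>: "\<gamma> > 0"
    and low: "\<And>\<theta>. \<bar>\<theta>\<bar> \<le> T1 \<Longrightarrow> (\<gamma> * \<theta>)\<^sup>2 \<le> int_dist_sq n \<theta> x"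
    and high: "\<And>\<theta>. T1 \<le> \<bar>\<theta>\<bar> \<Longrightarrow> \<bar>\<theta>\<bar> \<le> T2 \<Longrightarrow> \<beta>\<^sup>2 \<le> int_dist_sq n \<theta> x"
    and T2: "T2 \<ge> 0"
  shows "Q n x \<sigma> \<le> 1 / (\<sigma> * \<gamma> * sqrt (2 * c0)) + exp (- c0 * \<beta>\<^sup>2) + sqrt 2 * exp (- (T2 / \<sigma>)\<^sup>2 / 4)"
proof -
  interpret G: prob_space gauss by (rule prob_space_std_normal)
  define a where "a = c0 * (\<gamma> * \<sigma>)\<^sup>2"
  define F where "F g = exp (- a * g\<^sup>2) + exp (- c0 * \<beta>\<^sup>2) + exp (- (T2 / \<sigma>)\<^sup>2 / 4) * exp (- (- 1/4)
      * g\<^sup>2)" for g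
  have a: "a > 0" using c0 \<gamma> \<sigma> by (simp add: a_def)
  have pw: "exp (- c0 * int_dist_sq n (\<sigma> * g) x) \<le> F g" for g
  proof -
    consider "\<bar>\<sigma> * g\<bar> \<le> T1" | "T1 \<le> \<bar>\<sigma> * g\<bar>" "\<bar>\<sigma> * g\<bar> \<le> T2" | "\<bar>\<sigma> * g\<bar> \<ge> T2" by linarith
    then show ?thesis
    proof cases
      case 1
      have "c0 * (\<gamma> * (\<sigma> * g))\<^sup>2 \<le> c0 * int_dist_sq n (\<sigma> * g) x" using low[OF 1] c0
        by (intro mult_left_mono) auto
      then have "exp (- c0 * int_dist_sq n (\<sigma> * g) x) \<le> exp (- a * g\<^sup>2)"
        by (simp add: a_def power_mult_distrib mult_ac)
      then show ?thesis unfolding F_def by (smt (verit) exp_ge_zero mult_nonneg_nonneg)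
    next
      case 2
      have "c0 * \<beta>\<^sup>2 \<le> c0 * int_dist_sq n (\<sigma> * g) x" using high[OF 2] c0
        by (intro mult_left_mono) auto
      then have "exp (- c0 * int_dist_sq n (\<sigma> * g) x) \<le> exp (- c0 * \<beta>\<^sup>2)" by simp
      then show ?thesis unfolding F_def by (smt (verit) exp_ge_zero mult_nonneg_nonneg)
    next
      case 3
      then have "T2 / \<sigma> \<le> \<bar>g\<bar>" using \<sigma> by (simp add: field_simps abs_mult)
      then have "(T2 / \<sigma>)\<^sup>2 \<le> \<bar>g\<bar>\<^sup>2" using T2 \<sigma> by (intro power_mono) auto
      then have "1 \<le> exp (- (T2 / \<sigma>)\<^sup>2 / 4) * exp (- (- 1/4) * g\<^sup>2)"
        by (simp add: exp_add[symmetric])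
      then show ?thesis using exp_int_dist_sq_le_1[of n "\<sigma> * g" x] unfolding F_def
        by (smt (verit) exp_ge_zero)
    qed
  qed
  have "has_bochner_integral gauss F
     (1 / sqrt (1 + 2 * a) + exp (- c0 * \<beta>\<^sup>2) + exp (- (T2 / \<sigma>)\<^sup>2 / 4) * (1 / sqrt (1 + 2
         * (- 1/4))))"
    unfolding F_def using a
    by (intro has_bochner_integral_add has_bochner_integral_mult_right
        has_bochner_integral_std_normal_exp_sq)
       (auto simp: has_bochner_integral_iff G.prob_space[simplified])
  then have int: "integrable gauss F" and
    val: "(\<integral>g. F g \<partial>gauss) = 1 / sqrt (1 + 2 * a) + exp (- c0 * \<beta>\<^sup>2) + exp (- (T2 / \<sigma>)\<^sup>2 / 4)
        * (1 / sqrt (1 + 2 * (- 1/4)))"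
    by (auto simp: has_bochner_integral_iff)
  have "Q n x \<sigma> \<le> (\<integral>g. F g \<partial>gauss)"
    unfolding Q_def by (rule integral_mono[OF integrable_exp_int_dist_sq int pw])
  also note val
  finally have "Q n x \<sigma> \<le> 1 / sqrt (1 + 2 * a) + exp (- c0 * \<beta>\<^sup>2) +
      exp (- (T2 / \<sigma>)\<^sup>2 / 4) * (1 / sqrt (1 + 2 * (- 1/4)))" .
  moreover have "1 / sqrt (1 + 2 * (- 1/4)) = sqrt 2"
    by (simp add: real_sqrt_divide)
  moreover have "1 / sqrt (1 + 2 * a) \<le> 1 / sqrt (2 * a)" using a by (intro divide_left_mono) auto
  moreover have "sqrt (2 * a) = \<sigma> * \<gamma> * sqrt (2 * c0)"
    using \<sigma> \<gamma> by (simp add: a_def real_sqrt_mult)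
  ultimately show ?thesis by (smt (verit) mult.commute)
qed

end

section \<open>Tensorization and integer nets\<close>

abbreviation vnorm :: "nat \<Rightarrow> (nat \<Rightarrow> real) \<Rightarrow> real" where
  "vnorm n x \<equiv> L2_set x {..<n}"

lemma prob_le_expectation:
  fixes F :: "'a \<Rightarrow> real"
  assumes "finite (set_pmf p)" "\<And>x. x \<in> set_pmf p \<Longrightarrow> 0 \<le> F x"
    "\<And>x. x \<in> set_pmf p \<Longrightarrow> x \<in> S \<Longrightarrow> 1 \<le> F x"
  shows "Pr p S \<le> Mean p F"
proof -
  have "Pr p S = Mean p (indicat_real S)" by simp
  also have "\<dots> \<le> Mean p F"
    by (intro integral_mono_AE integrable_measure_pmf_finite assms(1))
       (use assms in \<open>auto simp: AE_measure_pmf_iff indicator_def\<close>)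
  finally show ?thesis .
qed

lemma prob_mono_pmf:
  assumes "\<And>x. x \<in> set_pmf p \<Longrightarrow> x \<in> A \<Longrightarrow> x \<in> B"
  shows "Pr p A \<le> Pr p B"
  using assms by (intro measure_pmf.finite_measure_mono_AE) (auto simp: AE_measure_pmf_iff)

lemma expectation_cong_pmf:
  fixes F G :: "'a \<Rightarrow> 'b :: {banach, second_countable_topology}"
  assumes "\<And>x. x \<in> set_pmf p \<Longrightarrow> F x = G x"
  shows "Mean p F = Mean p G"
  using assms by (intro integral_cong_AE) (auto simp: AE_measure_pmf_iff)

lemma expectation_Pi_pmf_union:
  fixes F :: "('a \<Rightarrow> 'b) \<Rightarrow> 'c :: {banach, second_countable_topology}"
  assumes "finite A" "finite B" "A \<inter> B = {}" "\<And>a. a \<in> A \<union> B \<Longrightarrow> finite (set_pmf (p a))"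
  shows "Mean (Pi_pmf (A \<union> B) d p) F =
    Mean (Pi_pmf A d p) (\<lambda>f. Mean (Pi_pmf B d p)
      (\<lambda>g. F (\<lambda>x. if x \<in> A then f x else g x)))"
  using assms by (simp add: Pi_pmf_union expectation_pair_pmf_finite case_prod_unfold cong: if_cong)

lemma Pi_pmf_outside: "finite A \<Longrightarrow> f \<in> set_pmf (Pi_pmf A d p) \<Longrightarrow> x \<notin> A \<Longrightarrow> f x = d"
  using set_Pi_pmf_subset[of A d p] by auto

lemma Pi_pmf_inside: "finite A \<Longrightarrow> f \<in> set_pmf (Pi_pmf A d p) \<Longrightarrow> x \<in> A \<Longrightarrow> f x \<in> set_pmf (p x)"
  using set_Pi_pmf_subset'[of A d p] by (auto simp: PiE_dflt_def)

lemma expectation_prod_rows: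
  fixes F :: "'i \<Rightarrow> ('j \<Rightarrow> 'b) \<Rightarrow> real"
  assumes "finite I" "finite J" "finite (set_pmf \<xi>)"
  shows "Mean (Pi_pmf (I \<times> J) d (\<lambda>_. \<xi>)) (\<lambda>f. \<Prod>i\<in>I. F i (\<lambda>j. f (i, j))) =
    (\<Prod>i\<in>I. Mean (Pi_pmf J d (\<lambda>_. \<xi>)) (F i))"
  using assms(1)
proof (induction rule: finite_induct)
  case (insert i I)
  have row: "Pi_pmf J d (\<lambda>_. \<xi>) = map_pmf (\<lambda>g. g \<circ> Pair i) (Pi_pmf ({i} \<times> J) d (\<lambda>_. \<xi>))"
    by (rule Pi_pmf_bij_betw) (use assms in \<open>auto simp: bij_betw_def inj_on_def\<close>)
  have eq: "insert i I \<times> J = {i} \<times> J \<union> I \<times> J" by auto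
  have "Mean (Pi_pmf (insert i I \<times> J) d (\<lambda>_. \<xi>)) (\<lambda>f. \<Prod>i\<in>insert i I. F i (\<lambda>j. f (i, j))) =
    Mean (Pi_pmf ({i} \<times> J) d (\<lambda>_. \<xi>)) (\<lambda>f. Mean (Pi_pmf (I \<times> J) d (\<lambda>_. \<xi>))
      (\<lambda>g. F i (\<lambda>j. f (i, j)) * (\<Prod>k\<in>I. F k (\<lambda>j. g (k, j)))))"
    unfolding eq using insert assms
  proof (subst expectation_Pi_pmf_union, goal_cases)
    case 5
    show ?case
    proof (intro expectation_cong_pmf, goal_cases)
      case (1 f g)
      have "(\<lambda>j. if (i, j) \<in> {i} \<times> J then f (i, j) else g (i, j)) = (\<lambda>j. f (i, j))"
        using 1 insert assms Pi_pmf_outside[of "{i} \<times> J" f d "\<lambda>_. \<xi>"] Pi_pmf_outside[of "I \<times> J" g d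
            "\<lambda>_. \<xi>"]
        by (intro ext) auto
      moreover have "(\<Prod>k\<in>I. F k (\<lambda>j. if (k, j) \<in> {i} \<times> J then f (k, j) else g (k, j)))
          = (\<Prod>k\<in>I. F k (\<lambda>j. g (k, j)))"
        using insert by (intro prod.cong refl arg_cong[of _ _ "F _"] ext) auto
      ultimately show ?case using insert by simp
    qed
  qed auto
  also have "\<dots> = Mean (Pi_pmf ({i} \<times> J) d (\<lambda>_. \<xi>)) (\<lambda>f. F i (\<lambda>j. f (i, j))) *
     (\<Prod>k\<in>I. Mean (Pi_pmf J d (\<lambda>_. \<xi>)) (F k))"
    by (simp add: insert.IH)
  also have "Mean (Pi_pmf ({i} \<times> J) d (\<lambda>_. \<xi>)) (\<lambda>f. F i (\<lambda>j. f (i, j))) =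
     Mean (Pi_pmf J d (\<lambda>_. \<xi>)) (F i)"
    by (subst row) (simp add: o_def)
  finally show ?case using insert by simp
qed simp

lemma sum_geometric_abs:
  fixes q :: real
  assumes "0 < q" "q < 1"
  shows "(\<Sum>k\<in>{-int m..int m}. q ^ nat \<bar>k\<bar>) \<le> (1 + q) / (1 - q)"
proof -
  have "(\<Sum>k\<in>{-int m..int m}. q ^ nat \<bar>k\<bar>) = (1 + q - 2 * q ^ Suc m) / (1 - q)"
  proof (induction m)
    case 0 then show ?case using assms by (simp add: field_simps)
  next
    case (Suc m)
    have "{-int (Suc m)..int (Suc m)} = insert (int (Suc m)) (insert (- int (Suc m)) {-int m..int
        m})" by auto
    then have "(\<Sum>k\<in>{-int (Suc m)..int (Suc m)}. q ^ nat \<bar>k\<bar>)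
        = 2 * q ^ Suc m + (\<Sum>k\<in>{-int m..int m}. q ^ nat \<bar>k\<bar>)"
      by (simp add: nat_add_distrib)
    then show ?case unfolding Suc.IH using assms by (simp add: field_simps)
  qed
  also have "\<dots> \<le> (1 + q) / (1 - q)" using assms by (intro divide_right_mono) auto
  finally show ?thesis .
qed

text \<open>Functions are extensional outside \<open>{..<n}\<close>, so that the set is finite and
  can be counted.\<close>

definition int_l1_ball :: "nat \<Rightarrow> real \<Rightarrow> (nat \<Rightarrow> int) set" where
  "int_l1_ball n M = {p \<in> {..<n} \<rightarrow>\<^sub>E UNIV. (\<Sum>j<n. \<bar>real_of_int (p j)\<bar>) \<le> M}"

text \<open>Generating function: each point of the ball has weight exp(l (M - |p|)) \<ge> 1, and
  over a box these weights factor into n geometric series. The parameter l stays free: it is taken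
  large when the radius is a small multiple of n, and small when the radius is much larger than
  n.\<close>

lemma
  assumes l: "l > 0"
  shows finite_int_l1_ball: "finite (int_l1_ball n M)"
    and card_int_l1_ball: "card (int_l1_ball n M)
        \<le> exp (l * M) * ((1 + exp (-l)) / (1 - exp (-l))) ^ n"
proof -
  define m where "m = nat \<lceil>M\<rceil>"
  define q where "q = exp (-l)"
  define B where "B = {..<n} \<rightarrow>\<^sub>E {-int m..int m}"
  have q: "0 < q" "q < 1" using l by (auto simp: q_def)
  have sub: "int_l1_ball n M \<subseteq> B"
  proof
    fix p assume p: "p \<in> int_l1_ball n M"
    have "p j \<in> {-int m..int m}" if "j < n" for j
    proof -
      have "\<bar>real_of_int (p j)\<bar> \<le> (\<Sum>j<n. \<bar>real_of_int (p j)\<bar>)"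
        using that by (intro member_le_sum) auto
      also have "\<dots> \<le> M" using p by (simp add: int_l1_ball_def)
      finally have "\<bar>real_of_int (p j)\<bar> \<le> real_of_int \<lceil>M\<rceil>" by linarith
      then show ?thesis unfolding m_def by (auto simp: abs_le_iff) linarith+
    qed
    then show "p \<in> B" using p by (auto simp: B_def int_l1_ball_def PiE_iff)
  qed
  have finB: "finite B" by (auto simp: B_def intro: finite_PiE)
  show fin: "finite (int_l1_ball n M)" using sub finB by (rule finite_subset)
  have pw: "q ^ nat \<bar>k\<bar> = exp (- l * \<bar>real_of_int k\<bar>)" for k
    by (simp add: q_def exp_of_nat_mult[symmetric] mult.commute)
  have "real (card (int_l1_ball n M)) = (\<Sum>p\<in>int_l1_ball n M. 1)" by simp
  also have "\<dots> \<le> (\<Sum>p\<in>int_l1_ball n M. exp (l * M) * (\<Prod>j<n. q ^ nat \<bar>p j\<bar>))"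
  proof (rule sum_mono)
    fix p assume "p \<in> int_l1_ball n M"
    then have "l * (\<Sum>j<n. \<bar>real_of_int (p j)\<bar>) \<le> l * M"
      using l by (intro mult_left_mono) (auto simp: int_l1_ball_def)
    then have "1 \<le> exp (l * M) * exp (\<Sum>j<n. - l * \<bar>real_of_int (p j)\<bar>)"
      by (simp add: exp_add[symmetric] sum_distrib_left sum_negf)
    then show "1 \<le> exp (l * M) * (\<Prod>j<n. q ^ nat \<bar>p j\<bar>)" by (simp add: pw exp_sum)
  qed
  also have "\<dots> \<le> (\<Sum>p\<in>B. exp (l * M) * (\<Prod>j<n. q ^ nat \<bar>p j\<bar>))"
    using q by (intro sum_mono2 finB sub mult_nonneg_nonneg prod_nonneg) auto
  also have "\<dots> = exp (l * M) * (\<Sum>k\<in>{-int m..int m}. q ^ nat \<bar>k\<bar>) ^ n"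
    unfolding B_def sum_distrib_left[symmetric] by (subst prod_sum_PiE[symmetric]) auto
  also have "\<dots> \<le> exp (l * M) * ((1 + q) / (1 - q)) ^ n"
    using q by (intro mult_left_mono power_mono sum_geometric_abs sum_nonneg) auto
  finally show "card (int_l1_ball n M) \<le> exp (l * M) * ((1 + exp (-l)) / (1 - exp (-l))) ^ n"
    by (simp add: q_def)
qed

lemma sum_abs_le_sqrt_L2: "(\<Sum>j<n. \<bar>x j\<bar>) \<le> sqrt (real n) * vnorm n x"
  using L2_set_mult_ineq[of "\<lambda>_. 1" x "{..<n}"] by (simp add: L2_set_constant)

definition mv :: "nat \<Rightarrow> (nat \<times> nat \<Rightarrow> real) \<Rightarrow> (nat \<Rightarrow> real) \<Rightarrow> nat \<Rightarrow> real" where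
  "mv n f x i = (\<Sum>j<n. f (i, j) * x j)"

lemma mv_diff: "mv n f (\<lambda>j. x j - y j) i = mv n f x i - mv n f y i"
  by (simp add: mv_def algebra_simps sum_subtractf)

lemma mv_scale: "mv n f (\<lambda>j. c * x j) i = c * mv n f x i"
  by (simp add: mv_def algebra_simps sum_distrib_left)

lemma L2_set_scale: "L2_set (\<lambda>i. c * f i) A = \<bar>c\<bar> * L2_set f A"
  by (simp add: L2_set_def power_mult_distrib sum_distrib_left[symmetric] real_sqrt_mult)

lemma L2_set_triangle_diff: "L2_set f A \<le> L2_set g A + L2_set (\<lambda>i. f i - g i) A"
  using L2_set_triangle_ineq[of g "\<lambda>i. f i - g i" A] by simp

context discrete_law
begin

abbreviation rmat :: "nat set \<Rightarrow> nat \<Rightarrow> (nat \<times> nat \<Rightarrow> real) pmf" where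
  "rmat I n \<equiv> Pi_pmf (I \<times> {..<n}) 0 (\<lambda>_. \<xi>)"

abbreviation sqmat :: "nat \<Rightarrow> (nat \<times> nat \<Rightarrow> real) pmf" where
  "sqmat n \<equiv> rmat {..<n} n"

lemma Q_nonneg: "0 \<le> Q n x \<sigma>"
  unfolding Q_def by (intro integral_nonneg_AE) auto

section \<open>Small ball probabilities for one row and for several rows\<close>

lemma prob_dot_small:
  assumes "t > 0"
  shows "Pr (rvec n) {X. \<bar>(\<Sum>j<n. X j * x j) - r\<bar> \<le> t} \<le> exp (1/2) * Q n x (h / t)"
proof -
  have "Pr (rvec n) {X. \<bar>(\<Sum>j<n. X j * x j) - r\<bar> \<le> t} \<le>
     Mean (rvec n) (\<lambda>X. exp (1/2) * exp (- ((\<Sum>j<n. X j * x j) - r)\<^sup>2 / (2 * t\<^sup>2)))"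
  proof (rule prob_le_expectation, goal_cases)
    case (3 X)
    then have "((\<Sum>j<n. X j * x j) - r)\<^sup>2 \<le> t\<^sup>2"
      using assms by (simp add: abs_le_square_iff[symmetric])
    then show ?case using assms by (simp add: exp_add[symmetric] field_simps)
  qed auto
  also have "\<dots> \<le> exp (1/2) * Q n x (h / t)"
    using gauss_smoothing[OF assms, of n x r] by simp
  finally show ?thesis .
qed

text \<open>Exponential Markov inequality: on the event the product of the Gaussian weights of the
  rows is at least exp(-M / 2), and the rows are independent. The common centre r leaves room for
  the shift caused by the mean of the entries.\<close>

lemma prob_rows_small:
  assumes "finite I" "t > 0"
  shows "Pr (rmat I n) {f. (\<Sum>i\<in>I. (mv n f x i - r)\<^sup>2) \<le> M * t\<^sup>2}
      \<le> exp (M / 2) * Q n x (h / t) ^ card I"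
proof -
  define F where "F X = exp (- ((\<Sum>j<n. X j * x j) - r)\<^sup>2 / (2 * t\<^sup>2))" for X
  have "Pr (rmat I n) {f. (\<Sum>i\<in>I. (mv n f x i - r)\<^sup>2) \<le> M * t\<^sup>2} \<le>
     Mean (rmat I n) (\<lambda>f. exp (M / 2) * (\<Prod>i\<in>I. F (\<lambda>j. f (i, j))))"
  proof (rule prob_le_expectation, goal_cases)
    case (3 f)
    have "(\<Prod>i\<in>I. F (\<lambda>j. f (i, j))) = exp (- (\<Sum>i\<in>I. (mv n f x i - r)\<^sup>2) / (2 * t\<^sup>2))"
      using assms by (simp add: F_def mv_def sum_divide_distrib sum_negf flip: exp_sum)
    with 3 assms show ?case by (simp add: exp_add[symmetric] field_simps)
  qed (use assms fin in \<open>auto simp: F_def prod_nonneg\<close>)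
  also have "\<dots> = exp (M / 2) * (\<Prod>i\<in>I. Mean (rvec n) F)"
    using expectation_prod_rows[OF assms(1) _ fin, of "{..<n}" 0 "\<lambda>_. F"] by simp
  also have "\<dots> = exp (M / 2) * Mean (rvec n) F ^ card I" by simp
  also have "\<dots> \<le> exp (M / 2) * Q n x (h / t) ^ card I"
  proof (intro mult_left_mono power_mono)
    show "Mean (rvec n) F \<le> Q n x (h / t)"
      unfolding F_def by (rule gauss_smoothing[OF assms(2)])
  qed (auto simp: F_def intro!: integral_nonneg_AE)
  finally show ?thesis .
qed

text \<open>Bounds \<open>Q n x 1\<close> for unit vectors x of every dimension: when |g| \<le> 1/2,
  no coordinate of g x exceeds 1/2, so the squared lattice distance is exactly g^2.\<close>

definition unit_decay :: real where
  "unit_decay = (\<integral>g. (if \<bar>g\<bar> \<le> 1/2 then exp (- c0 * g\<^sup>2) else 1) \<partial>gauss)"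

text \<open>Equality would force the integrand to be 1 almost everywhere, but it is strictly smaller
  on the interval (1/4, 1/2).\<close>

lemma unit_decay_less_1: "unit_decay < 1"
proof -
  interpret G: prob_space gauss by (rule prob_space_std_normal)
  define F where "F g = 1 - (if \<bar>g\<bar> \<le> 1/2 then exp (- c0 * g\<^sup>2) else 1)" for g :: real
  have e: "exp (- c0 * g\<^sup>2) \<le> 1" for g using c0 by (simp add: mult_nonneg_nonneg)
  have F0: "0 \<le> F g" for g using e[of g] by (simp add: F_def)
  have [measurable]: "F \<in> borel_measurable borel" unfolding F_def by measurable
  have intF: "integrable gauss F"
    using e by (intro integrable_std_normal_bounded[of _ 1]) (auto simp: F_def)
  have i1: "integrable gauss (\<lambda>g. if \<bar>g\<bar> \<le> 1/2 then exp (- c0 * g\<^sup>2) else 1 :: real)"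
    using e by (intro integrable_std_normal_bounded[of _ 1]) auto
  have val: "(\<integral>g. F g \<partial>gauss) = 1 - unit_decay"
    unfolding F_def unit_decay_def using i1 G.prob_space
      by (subst Bochner_Integration.integral_diff) auto
  moreover have "0 \<le> (\<integral>g. F g \<partial>gauss)" using F0 by (intro integral_nonneg_AE) auto
  moreover have "(\<integral>g. F g \<partial>gauss) \<noteq> 0"
  proof
    assume "(\<integral>g. F g \<partial>gauss) = 0"
    then have "AE g in gauss. F g = 0"
      using integral_nonneg_eq_0_iff_AE[OF intF] F0 by auto
    then have "AE g in lborel. F g = 0"
      by (subst (asm) AE_density) (auto simp: normal_density_pos)
    then have "AE g in lborel. \<not> (1/4 < g \<and> g < (1/2::real))"
    proof (rule AE_mp, intro AE_I2 impI notI)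
      fix g :: real assume g: "F g = 0" "1/4 < g \<and> g < 1/2"
      then have "exp (- c0 * g\<^sup>2) = 1" by (simp add: F_def)
      then show False using c0 g by simp
    qed
    then have "emeasure lborel {1/4<..<1/2 :: real} = 0"
      by (subst (asm) AE_iff_measurable[of "{1/4<..<1/2}"]) (auto simp: greaterThanLessThan_def)
    then show False by simp
  qed
  ultimately show ?thesis by linarith
qed

lemma Q_unit_le_decay:
  assumes "vnorm n x = 1"
  shows "Q n x 1 \<le> unit_decay"
  unfolding Q_def unit_decay_def
proof (rule integral_mono[OF integrable_exp_int_dist_sq])
  have e: "exp (- c0 * g\<^sup>2) \<le> 1" for g using c0 by (simp add: mult_nonneg_nonneg)
  show "integrable gauss (\<lambda>g. if \<bar>g\<bar> \<le> 1/2 then exp (- c0 * g\<^sup>2) else 1 :: real)"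
    using e by (intro integrable_std_normal_bounded[of _ 1]) auto
  fix g :: real
  show "exp (- c0 * int_dist_sq n (1 * g) x) \<le> (if \<bar>g\<bar> \<le> 1/2 then exp (- c0 * g\<^sup>2) else 1)"
  proof (cases "\<bar>g\<bar> \<le> 1/2")
    case True
    have "rdist (g * x j) = \<bar>g * x j\<bar>" if "j < n" for j
    proof (rule rdist_small)
      have "\<bar>x j\<bar> \<le> 1" using member_le_L2_set[of "{..<n}" j "\<lambda>j. \<bar>x j\<bar>"] that assms
        by (simp add: L2_set_def)
      then have "\<bar>g\<bar> * \<bar>x j\<bar> \<le> 1/2 * 1" using True by (intro mult_mono) auto
      then show "\<bar>g * x j\<bar> \<le> 1/2" by (simp add: abs_mult)
    qed
    then have "int_dist_sq n g x = g\<^sup>2 * (\<Sum>j<n. (x j)\<^sup>2)"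
      by (simp add: int_dist_sq_def power_mult_distrib sum_distrib_left)
    also have "(\<Sum>j<n. (x j)\<^sup>2) = 1" using assms by (simp add: L2_set_def)
    finally show ?thesis using True by simp
  next
    case False
    then show ?thesis using exp_int_dist_sq_le_1[of n "1 * g" x] by simp
  qed
qed

end

section \<open>Operator norm of the centered matrix\<close>

context discrete_law
begin

section \<open>Subgaussian moments of the centered entries\<close>

definition \<mu> :: real where "\<mu> = Mean \<xi> (\<lambda>y. y)"

lemma abs_mean_le: "\<bar>\<mu>\<bar> \<le> K"
proof -
  have "\<bar>\<mu>\<bar> \<le> Mean \<xi> (\<lambda>y. \<bar>y\<bar>)" unfolding \<mu>_def by (rule integral_abs_bound)
  also have "\<dots> \<le> Mean \<xi> (\<lambda>y. K)"
    by (intro integral_mono_AE integrable_measure_pmf_finite fin) (use bound in \<open>auto simp: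
        AE_measure_pmf_iff\<close>)
  finally show ?thesis by simp
qed

text \<open>Hoeffding's lemma for a positive parameter; the sign \<open>e\<close> later carries
  negative s over to this case.\<close>

lemma mgf_centered_pos:
  assumes "s > 0" and sg: "e = 1 \<or> e = (-1 :: real)"
  shows "Mean \<xi> (\<lambda>y. exp (s * (e * (y - \<mu>)))) \<le> exp (s\<^sup>2 * K\<^sup>2 / 2)"
proof -
  interpret I: interval_bounded_random_variable "measure_pmf \<xi>" "\<lambda>y. e * y" "-K" K
    by unfold_locales (use bound sg in \<open>auto simp: AE_measure_pmf_iff abs_le_iff\<close>, (meson bound
        abs_le_iff order.trans neg_le_iff_le minus_le_iff)+)
  have E: "Mean \<xi> (\<lambda>y. e * y) = e * \<mu>" unfolding \<mu>_def by simp
  have "ennreal (Mean \<xi> (\<lambda>y. exp (s * (e * y - e * \<mu>)))) =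
     (\<integral>\<^sup>+y. ennreal (exp (s * (e * y - e * \<mu>))) \<partial>measure_pmf \<xi>)"
    by (intro nn_integral_eq_integral[symmetric] integrable_measure_pmf_finite fin) auto
  also have "\<dots> \<le> ennreal (exp (s\<^sup>2 * (K - - K)\<^sup>2 / 8))"
    using I.Hoeffdings_lemma_nn_integral[OF assms(1)] unfolding E .
  finally have "Mean \<xi> (\<lambda>y. exp (s * (e * y - e * \<mu>))) \<le> exp (s\<^sup>2 * (K - - K)\<^sup>2 / 8)"
    by simp
  moreover have "(K - - K)\<^sup>2 / 8 = K\<^sup>2 / 2" by (simp add: power2_eq_square)
  ultimately show ?thesis by (simp add: algebra_simps)
qed

lemma mgf_centered: "Mean \<xi> (\<lambda>y. exp (s * (y - \<mu>))) \<le> exp (s\<^sup>2 * K\<^sup>2 / 2)"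
proof -
  consider "s > 0" | "s = 0" | "s < 0" by linarith
  then show ?thesis
  proof cases
    case 1 then show ?thesis using mgf_centered_pos[of s 1] by simp
  next
    case 3
    have "(- s) * (-1 * (y - \<mu>)) = s * (y - \<mu>)" for y by (simp add: algebra_simps)
    then show ?thesis using mgf_centered_pos[of "- s" "-1"] 3 by simp
  qed simp
qed

lemma mgf_dot:
  assumes "vnorm n q \<le> 2"
  shows "Mean (rvec n) (\<lambda>X. exp (s * (\<Sum>j<n. (X j - \<mu>) * q j))) \<le> exp (2 * K\<^sup>2 * s\<^sup>2)"
proof -
  have "Mean (rvec n) (\<lambda>X. exp (s * (\<Sum>j<n. (X j - \<mu>) * q j))) =
     Mean (rvec n) (\<lambda>X. \<Prod>j<n. exp (s * q j * (X j - \<mu>)))"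
    by (simp add: sum_distrib_left mult_ac flip: exp_sum)
  also have "\<dots> = (\<Prod>j<n. Mean \<xi> (\<lambda>y. exp (s * q j * (y - \<mu>))))"
    by (rule expectation_prod_Pi_pmf_finite) (use fin in auto)
  also have "\<dots> \<le> (\<Prod>j<n. exp ((s * q j)\<^sup>2 * K\<^sup>2 / 2))"
    by (intro prod_mono conjI mgf_centered integral_nonneg_AE) auto
  also have "\<dots> = exp (s\<^sup>2 * K\<^sup>2 / 2 * (\<Sum>j<n. (q j)\<^sup>2))"
    by (simp add: sum_distrib_left power_mult_distrib mult_ac flip: exp_sum)
  also have "\<dots> \<le> exp (s\<^sup>2 * K\<^sup>2 / 2 * 4)"
  proof -
    have "(\<Sum>j<n. (q j)\<^sup>2) = (vnorm n q)\<^sup>2" by (simp add: L2_set_def sum_nonneg)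
    also have "\<dots> \<le> 2\<^sup>2" using assms by (intro power_mono) auto
    finally have "s\<^sup>2 * K\<^sup>2 / 2 * (\<Sum>j<n. (q j)\<^sup>2) \<le> s\<^sup>2 * K\<^sup>2 / 2 * 4"
      by (intro mult_left_mono) auto
    then show ?thesis by simp
  qed
  finally show ?thesis by (simp add: mult_ac)
qed

text \<open>The square in the exponent is linearized by an auxiliary Gaussian: exp(S^2 / (16 K^2))
  is the mean over g of exp(c S g) with c^2 = 1 / (8 K^2). The subgaussian bound then leaves the
  mean of exp(g^2 / 4), which is sqrt 2. The norm bound 2 is that of the net points.\<close>

lemma exp_square_dot:
  assumes "vnorm n q \<le> 2"
  shows "Mean (rvec n) (\<lambda>X. exp ((\<Sum>j<n. (X j - \<mu>) * q j)\<^sup>2 / (16 * K\<^sup>2))) \<le> sqrt 2"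
proof -
  define S where "S X = (\<Sum>j<n. (X j - \<mu>) * q j)" for X
  define c where "c = 1 / sqrt (8 * K\<^sup>2)"
  have K0: "K\<^sup>2 > 0" using K by simp
  have c2: "c\<^sup>2 = 1 / (8 * K\<^sup>2)" using K0 by (simp add: c_def power_divide)
  have hb: "has_bochner_integral gauss (\<lambda>g. exp (c * S X * g)) (exp ((S X)\<^sup>2 / (16 * K\<^sup>2)))" for X
    using has_bochner_integral_std_normal_exp[of 0 "c * S X"]
      by (simp add: power_mult_distrib c2 field_simps)
  have "Mean (rvec n) (\<lambda>X. exp ((S X)\<^sup>2 / (16 * K\<^sup>2))) =
     (\<Sum>X\<in>set_pmf (rvec n). pmf (rvec n) X * exp ((S X)\<^sup>2 / (16 * K\<^sup>2)))"
    by (subst integral_measure_pmf[of "set_pmf (rvec n)"]) auto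
  also have "has_bochner_integral gauss (\<lambda>g. \<Sum>X\<in>set_pmf (rvec n). pmf (rvec n) X * exp (c * S X
      * g)) \<dots>"
    by (intro has_bochner_integral_sum has_bochner_integral_mult_right hb)
  also have "(\<lambda>g. \<Sum>X\<in>set_pmf (rvec n). pmf (rvec n) X * exp (c * S X * g)) =
     (\<lambda>g. Mean (rvec n) (\<lambda>X. exp (c * g * S X)))"
    by (intro ext, subst integral_measure_pmf[of "set_pmf (rvec n)"]) (auto simp: mult_ac)
  finally have hb1: "has_bochner_integral gauss (\<lambda>g. Mean (rvec n) (\<lambda>X. exp (c * g * S X)))
    (Mean (rvec n) (\<lambda>X. exp ((S X)\<^sup>2 / (16 * K\<^sup>2))))" .
  have hb2: "has_bochner_integral gauss (\<lambda>g. exp (- (- 1/4) * g\<^sup>2)) (1 / sqrt (1 + 2 * (- 1/4)))"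
    by (rule has_bochner_integral_std_normal_exp_sq) simp
  have "exp (2 * K\<^sup>2 * (c * g)\<^sup>2) = exp (- (- 1/4) * g\<^sup>2)" for g
    using K0 by (simp add: power_mult_distrib c2)
  then have le: "Mean (rvec n) (\<lambda>X. exp (c * g * S X)) \<le> exp (- (- 1/4) * g\<^sup>2)" for g
    using mgf_dot[OF assms, of "c * g"] unfolding S_def by (simp only:)
  have "Mean (rvec n) (\<lambda>X. exp ((S X)\<^sup>2 / (16 * K\<^sup>2))) \<le> 1 / sqrt (1 + 2 * (- 1/4))"
    using hb1 hb2 unfolding has_bochner_integral_iff
    by (metis (no_types, lifting) integral_mono le)
  then show ?thesis by (simp add: S_def real_sqrt_divide)
qed

abbreviation centered :: "(nat \<times> nat \<Rightarrow> real) \<Rightarrow> nat \<times> nat \<Rightarrow> real" where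
  "centered f \<equiv> (\<lambda>ij. f ij - \<mu>)"

text \<open>The threshold is 8 n units of 16 K^2, so Markov gives exp(-8 n); each row costs at most
  a factor e, and the remaining exp(-7 n) beats the size exp(6 n) of the net.\<close>

lemma prob_centered_fixed:
  assumes "finite I" "card I \<le> n" "vnorm n q \<le> 2"
  shows "Pr (rmat I n) {f. (\<Sum>i\<in>I. (mv n (centered f) q i)\<^sup>2) \<ge> 16 * K\<^sup>2 * (8 * real n)}
      \<le> exp (- 7 * real n)"
proof -
  define F where "F X = exp ((\<Sum>j<n. (X j - \<mu>) * q j)\<^sup>2 / (16 * K\<^sup>2))" for X
  have K0: "K\<^sup>2 > 0" using K by simp
  have "Pr (rmat I n) {f. (\<Sum>i\<in>I. (mv n (centered f) q i)\<^sup>2) \<ge> 16 * K\<^sup>2 * (8 * real n)} \<le>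
     Mean (rmat I n) (\<lambda>f. exp (- 8 * real n) * (\<Prod>i\<in>I. F (\<lambda>j. f (i, j))))"
  proof (rule prob_le_expectation, goal_cases)
    case (3 f)
    have "(\<Prod>i\<in>I. F (\<lambda>j. f (i, j))) = exp ((\<Sum>i\<in>I. (mv n (centered f) q i)\<^sup>2) / (16 * K\<^sup>2))"
      using assms by (simp add: F_def mv_def sum_divide_distrib flip: exp_sum)
    with 3 K0 show ?case by (simp add: exp_add[symmetric] field_simps)
  qed (use assms fin in \<open>auto simp: F_def prod_nonneg\<close>)
  also have "\<dots> = exp (- 8 * real n) * Mean (rvec n) F ^ card I"
    using expectation_prod_rows[OF assms(1) _ fin, of "{..<n}" 0 "\<lambda>_. F"] by simp
  also have "\<dots> \<le> exp (- 8 * real n) * exp 1 ^ n"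
  proof (intro mult_left_mono)
    have "sqrt 2 \<le> exp 1" using exp_ge_add_one_self[of "1::real"] real_sqrt_le_mono[of 2 4] by simp
    then have "Mean (rvec n) F \<le> exp 1"
      using exp_square_dot[OF assms(3)] unfolding F_def by linarith
    then have "Mean (rvec n) F ^ card I \<le> exp 1 ^ card I"
      by (intro power_mono) (auto simp: F_def intro!: integral_nonneg_AE)
    also have "\<dots> \<le> exp 1 ^ n" using assms by (intro power_increasing) auto
    finally show "Mean (rvec n) F ^ card I \<le> exp 1 ^ n" .
  qed simp
  also have "\<dots> = exp (- 7 * real n)" by (simp add: exp_of_nat_mult[symmetric] exp_add[symmetric])
  finally show ?thesis .
qed

text \<open>Self-improvement of the supremum M over the unit sphere: rounding 2 sqrt n x to integers
  gives a net point of norm at most 2 with error at most 1/4, hence M \<le> R + M / 4.\<close>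

lemma opnorm_from_net:
  assumes "finite I" "n \<ge> 1" and R: "R \<ge> 0"
    and net: "\<And>p. p \<in> int_l1_ball n (4 * real n)
        \<Longrightarrow> L2_set (\<lambda>j. real_of_int (p j) / (2 * sqrt n)) {..<n} \<le> 2 \<Longrightarrow>
      L2_set (mv n b (\<lambda>j. real_of_int (p j) / (2 * sqrt n))) I \<le> R"
  shows "L2_set (mv n b x) I \<le> 2 * R * vnorm n x"
proof -
  define U where "U = {x. vnorm n x = 1}"
  define N where "N = (\<lambda>x. L2_set (mv n b x) I)"
  define M where "M = Sup (N ` U)"
  have n0: "sqrt n > 0" using assms by simp
  \<comment> \<open>Finiteness of the supremum, without which M \<le> R + M / 4 would give no
    information.\<close>
  have bdd: "bdd_above (N ` U)"
  proof (rule bdd_aboveI2)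
    fix x assume x: "x \<in> U"
    have "N x \<le> (\<Sum>i\<in>I. \<bar>mv n b x i\<bar>)" unfolding N_def by (rule L2_set_le_sum_abs)
    also have "\<dots> \<le> (\<Sum>i\<in>I. \<Sum>j<n. \<bar>b (i, j)\<bar>)"
    proof (rule sum_mono)
      fix i
      have "\<bar>mv n b x i\<bar> \<le> (\<Sum>j<n. \<bar>b (i, j) * x j\<bar>)" unfolding mv_def by (rule sum_abs)
      also have "\<dots> \<le> (\<Sum>j<n. \<bar>b (i, j)\<bar> * 1)"
      proof (rule sum_mono)
        fix j assume "j \<in> {..<n}"
        then have "\<bar>x j\<bar> \<le> 1" using member_le_L2_set[of "{..<n}" j "\<lambda>j. \<bar>x j\<bar>"] x
          by (simp add: L2_set_def U_def)
        then show "\<bar>b (i, j) * x j\<bar> \<le> \<bar>b (i, j)\<bar> * 1" unfolding abs_mult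
          by (intro mult_left_mono) auto
      qed
      finally show "\<bar>mv n b x i\<bar> \<le> (\<Sum>j<n. \<bar>b (i, j)\<bar>)" by simp
    qed
    finally show "N x \<le> (\<Sum>i\<in>I. \<Sum>j<n. \<bar>b (i, j)\<bar>)" .
  qed
  have NM: "N x \<le> M * vnorm n x" for x
  proof (cases "vnorm n x = 0")
    case True
    then have "x j = 0" if "j < n" for j using that by (simp add: L2_set_eq_0_iff)
    then have "mv n b x = (\<lambda>_. 0)" by (simp add: mv_def fun_eq_iff)
    then have "N x = 0" by (simp add: N_def L2_set_0')
    with True show ?thesis by simp
  next
    case False
    then have pos: "vnorm n x > 0" using L2_set_nonneg[of x "{..<n}"] by linarith
    define y where "y = (\<lambda>j. (1 / vnorm n x) * x j)"
    have "y \<in> U" using pos unfolding U_def y_def by (simp only: L2_set_scale mem_Collect_eq) simp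
    then have "N y \<le> M" unfolding M_def using bdd by (intro cSUP_upper)
    moreover have "N y = (1 / vnorm n x) * N x"
      unfolding N_def y_def using pos by (simp only: mv_scale[abs_def] L2_set_scale) simp
    ultimately show ?thesis using pos by (simp add: field_simps)
  qed
  have ne: "U \<noteq> {}"
  proof -
    have "(\<lambda>j. if j = 0 then 1 else 0) \<in> U"
      using assms by (simp add: U_def L2_set_def if_distrib[of "\<lambda>x. x\<^sup>2"] cong: if_cong)
    then show ?thesis by blast
  qed
  have M0: "M \<ge> 0"
  proof -
    obtain x where x: "x \<in> U" using ne by blast
    have "0 \<le> N x" by (simp add: N_def)
    also have "N x \<le> M" unfolding M_def using bdd x by (intro cSUP_upper)
    finally show ?thesis .
  qed
  have "N x \<le> R + M / 4" if x: "x \<in> U" for x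
  proof -
    define p where "p = (\<lambda>j\<in>{..<n}. round (2 * sqrt n * x j))"
    define q where "q = (\<lambda>j. real_of_int (p j) / (2 * sqrt n))"
    \<comment> \<open>The nearest integer is no farther from u than 0 is, so rounding at most
      doubles the absolute value. This keeps the net points inside the l1 ball and bounds their
      norm.\<close>
    have rb: "\<bar>real_of_int (round u)\<bar> \<le> 2 * \<bar>u\<bar>" for u :: real
    proof (cases "round u = 0")
      case False
      have "rdist u \<le> \<bar>u\<bar>" by (rule rdist_le_abs)
      then show ?thesis unfolding rdist_def by linarith
    qed simp
    have x1: "vnorm n x = 1" using x by (simp add: U_def)
    have pj: "\<bar>real_of_int (p j)\<bar> \<le> 4 * sqrt n * \<bar>x j\<bar>" if "j < n" for j
      using rb[of "2 * sqrt n * x j"] that n0 by (simp add: p_def abs_mult)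
    have "(\<Sum>j<n. \<bar>real_of_int (p j)\<bar>) \<le> 4 * sqrt n * (\<Sum>j<n. \<bar>x j\<bar>)"
      unfolding sum_distrib_left by (intro sum_mono) (use pj in auto)
    also have "\<dots> \<le> 4 * sqrt n * (sqrt n * 1)"
      using sum_abs_le_sqrt_L2[of x n] x1 n0 by (intro mult_left_mono) auto
    finally have "(\<Sum>j<n. \<bar>real_of_int (p j)\<bar>) \<le> 4 * real n" by (simp add: mult.assoc)
    then have pin: "p \<in> int_l1_ball n (4 * real n)" by (simp add: int_l1_ball_def p_def)
    have "vnorm n q \<le> L2_set (\<lambda>j. 2 * x j) {..<n}"
      unfolding L2_set_def
    proof (intro real_sqrt_le_mono sum_mono)
      fix j assume "j \<in> {..<n}"
      then have "\<bar>q j\<bar> \<le> \<bar>2 * x j\<bar>" using pj[of j] n0 by (simp add: q_def field_simps abs_mult)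
      then show "(q j)\<^sup>2 \<le> (2 * x j)\<^sup>2" by (simp only: abs_le_square_iff)
    qed
    also have "\<dots> = 2" by (simp add: L2_set_scale x1)
    finally have "vnorm n q \<le> 2" .
    then have Nq: "N q \<le> R" unfolding N_def q_def by (intro net pin)
    have "L2_set (\<lambda>j. x j - q j) {..<n} \<le> L2_set (\<lambda>j. 1 / (4 * sqrt n)) {..<n}"
      unfolding L2_set_def
    proof (intro real_sqrt_le_mono sum_mono)
      fix j assume j: "j \<in> {..<n}"
      have "\<bar>2 * sqrt n * x j - real_of_int (p j)\<bar> \<le> 1/2"
        using rdist_le_half[of "2 * sqrt n * x j"] j by (simp add: p_def rdist_def)
      moreover have "2 * sqrt n * x j - real_of_int (p j) = 2 * sqrt n * (x j - q j)"
        using n0 by (simp add: q_def field_simps)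
      ultimately have "2 * sqrt n * \<bar>x j - q j\<bar> \<le> 1/2" using n0 by (simp add: abs_mult)
      then have "\<bar>x j - q j\<bar> \<le> \<bar>1 / (4 * sqrt n)\<bar>" using n0 by (simp add: field_simps)
      then show "(x j - q j)\<^sup>2 \<le> (1 / (4 * sqrt n))\<^sup>2" by (simp only: abs_le_square_iff)
    qed
    also have "\<dots> = 1 / 4" using n0 by (simp add: L2_set_constant)
    finally have d: "L2_set (\<lambda>j. x j - q j) {..<n} \<le> 1 / 4" .
    have "N x \<le> N q + N (\<lambda>j. x j - q j)"
      unfolding N_def mv_diff[abs_def] by (rule L2_set_triangle_diff)
    also have "N (\<lambda>j. x j - q j) \<le> M * L2_set (\<lambda>j. x j - q j) {..<n}" by (rule NM)
    also have "\<dots> \<le> M * (1 / 4)" using d M0 by (intro mult_left_mono)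
    finally show ?thesis using Nq by simp
  qed
  then have "M \<le> R + M / 4" unfolding M_def using ne by (intro cSUP_least) 
  then have "M \<le> 2 * R" using R by linarith
  then have "M * vnorm n x \<le> 2 * R * vnorm n x" by (intro mult_right_mono) auto
  with NM[of x] show ?thesis unfolding N_def by linarith
qed

text \<open>A factor 2 comes from the net, and sqrt (16 * 8) < 12 from the threshold for a single
  vector.\<close>

definition op_const :: real where "op_const = 24 * K"

definition op_good :: "nat set \<Rightarrow> nat \<Rightarrow> (nat \<times> nat \<Rightarrow> real) \<Rightarrow> bool" where
  "op_good I n f \<longleftrightarrow> (\<forall>x. L2_set (mv n (centered f) x) I \<le> op_const * sqrt n * vnorm n x)"

abbreviation op_bad :: "nat set \<Rightarrow> nat \<Rightarrow> (nat \<times> nat \<Rightarrow> real) set" where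
  "op_bad I n \<equiv> {f. \<not> op_good I n f}"

lemma prob_op_bad:
  assumes "finite I" "card I \<le> n" "n \<ge> 1"
  shows "Pr (rmat I n) (op_bad I n) \<le> exp (- real n)"
proof -
  define P where "P = {p \<in> int_l1_ball n (4 * real n). L2_set (\<lambda>j. real_of_int (p j) / (2
      * sqrt n)) {..<n} \<le> 2}"
  define T where "T = 16 * K\<^sup>2 * (8 * real n)"
  define E where "E p = {f. (\<Sum>i\<in>I. (mv n (centered f) (\<lambda>j. real_of_int (p j) / (2
      * sqrt n)) i)\<^sup>2) \<ge> T}" for p
  have finP: "finite P" unfolding P_def using finite_int_l1_ball[of 1] by simp
  have "(op_bad I n) \<subseteq> (\<Union>p\<in>P. E p)"
  proof (intro subsetI, rule ccontr)
    fix f assume f: "f \<in> (op_bad I n)" and nf: "f \<notin> (\<Union>p\<in>P. E p)"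
    have T: "sqrt T \<le> 12 * K * sqrt n"
    proof -
      have "T \<le> (12 * K)\<^sup>2 * real n" using K by (simp add: T_def power_mult_distrib)
      then have "sqrt T \<le> sqrt ((12 * K)\<^sup>2 * real n)" by (rule real_sqrt_le_mono)
      also have "\<dots> = 12 * K * sqrt n" using K by (simp add: real_sqrt_mult)
      finally show ?thesis .
    qed
    have "L2_set (mv n (centered f) x) I \<le> 2 * (12 * K * sqrt n) * vnorm n x" for x
    proof (rule opnorm_from_net[OF assms(1,3)])
      show "0 \<le> 12 * K * sqrt n" using K by simp
      fix p assume "p \<in> int_l1_ball n (4 * real n)" "L2_set (\<lambda>j. real_of_int (p j) / (2
          * sqrt n)) {..<n} \<le> 2"
      then have "f \<notin> E p" using nf by (auto simp: P_def)
      then have "L2_set (mv n (centered f) (\<lambda>j. real_of_int (p j) / (2 * sqrt n))) I \<le> sqrt T"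
        unfolding L2_set_def E_def by simp
      with T show "L2_set (mv n (centered f) (\<lambda>j. real_of_int (p j) / (2 * sqrt n))) I
          \<le> 12 * K * sqrt n" by linarith
    qed
    then have "op_good I n f" by (simp add: op_good_def op_const_def mult_ac)
    with f show False by simp
  qed
  then have "Pr (rmat I n) (op_bad I n) \<le> Pr (rmat I n) (\<Union>p\<in>P. E p)"
    by (intro measure_pmf.finite_measure_mono) auto
  also have "\<dots> \<le> (\<Sum>p\<in>P. Pr (rmat I n) (E p))"
    using finP by (intro measure_pmf.finite_measure_subadditive_finite) auto
  also have "\<dots> \<le> (\<Sum>p\<in>P. exp (- 7 * real n))"
    unfolding E_def T_def by (intro sum_mono prob_centered_fixed assms) (auto simp: P_def)
  also have "\<dots> = card P * exp (- 7 * real n)" by simp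
  also have "\<dots> \<le> (exp (1 * (4 * real n)) * ((1 + exp (-1)) / (1 - exp (-1))) ^ n) * exp (- 7
      * real n)"
  proof (intro mult_right_mono)
    have "real (card P) \<le> real (card (int_l1_ball n (4 * real n)))"
      unfolding P_def using finite_int_l1_ball[of 1] by (intro of_nat_mono card_mono) auto
    also have "\<dots> \<le> exp (1 * (4 * real n)) * ((1 + exp (-1)) / (1 - exp (-1))) ^ n"
      by (rule card_int_l1_ball) simp
    finally show "real (card P) \<le> exp (1 * (4 * real n)) * ((1 + exp (-1)) / (1 - exp (-1))) ^ n" .
  qed simp
  also have "\<dots> \<le> (exp (1 * (4 * real n)) * exp 2 ^ n) * exp (- 7 * real n)"
  proof (intro mult_right_mono mult_left_mono power_mono)
    have e: "exp (1::real) \<ge> 2" using exp_ge_add_one_self[of "1::real"] by simp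
    then have h: "exp (-1) \<le> (1/2::real)" by (simp add: exp_minus field_simps)
    then have "(1 + exp (-1)) / (1 - exp (-1)) \<le> (3 :: real)" by (simp add: field_simps)
    also have "3 \<le> exp (2::real)" using exp_ge_add_one_self[of "2::real"] by simp
    finally show "(1 + exp (-1)) / (1 - exp (-1)) \<le> exp (2::real)" .
    show "0 \<le> (1 + exp (-1)) / (1 - exp (-1::real))" using h by simp
  qed auto
  also have "\<dots> = exp (- real n)" by (simp add: exp_of_nat_mult[symmetric] exp_add[symmetric])
  finally show ?thesis .
qed

end

section \<open>Vectors with a small approximate denominator\<close>

lemma L2_set_diff_commute: "L2_set (\<lambda>i. f i - g i) A = L2_set (\<lambda>i. g i - f i) A"
  by (simp add: L2_set_def power2_commute)

definition ivec :: "(nat \<Rightarrow> int) \<Rightarrow> nat \<Rightarrow> real" where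
  "ivec p j = real_of_int (p j)"

definition nvec :: "nat \<Rightarrow> (nat \<Rightarrow> int) \<Rightarrow> nat \<Rightarrow> real" where
  "nvec n p j = (1 / L2_set (ivec p) {..<n}) * ivec p j"

lemma L2_set_nvec: "L2_set (ivec p) {..<n} > 0 \<Longrightarrow> L2_set (nvec n p) {..<n} = 1"
  unfolding nvec_def[abs_def] by (simp only: L2_set_scale) simp

text \<open>Rounding \<theta> x to p gives an error of at most a, that is a / \<theta> after
  division by \<theta>. Since the norm of p differs from \<theta> by at most a, normalizing p costs
  a / \<theta> once more.\<close>

lemma integer_approximation:
  assumes x: "vnorm n x = 1" and a: "0 \<le> a" "a < \<theta>" and int_dist_sq: "int_dist_sq n \<theta> x \<le> a\<^sup>2"
  obtains p where "p \<in> {..<n} \<rightarrow>\<^sub>E UNIV" "L2_set (ivec p) {..<n} > 0" "L2_set (ivec p) {..<n}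
      \<le> \<theta> + a"
    "L2_set (\<lambda>j. x j - nvec n p j) {..<n} \<le> 2 * a / \<theta>"
proof -
  define p where "p = (\<lambda>j\<in>{..<n}. round (\<theta> * x j))"
  define N where "N = L2_set (ivec p) {..<n}"
  have \<theta>: "\<theta> > 0" using a by linarith
  have "L2_set (\<lambda>j. \<theta> * x j - ivec p j) {..<n} = sqrt (int_dist_sq n \<theta> x)"
    unfolding L2_set_def int_dist_sq_def by (intro arg_cong[of _ _ sqrt] sum.cong) (auto simp: p_def
        ivec_def rdist_def)
  also have "\<dots> \<le> a" using int_dist_sq a by (intro real_le_lsqrt) auto
  finally have d: "L2_set (\<lambda>j. \<theta> * x j - ivec p j) {..<n} \<le> a" .
  have \<theta>x: "L2_set (\<lambda>j. \<theta> * x j) {..<n} = \<theta>" using \<theta> x by (simp add: L2_set_scale)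
  have N1: "\<theta> \<le> N + a" using L2_set_triangle_diff[of "\<lambda>j. \<theta> * x j" "{..<n}" "ivec p"] d \<theta>x
    by (simp add: N_def)
  have N2: "N \<le> \<theta> + a"
    using L2_set_triangle_diff[of "ivec p" "{..<n}" "\<lambda>j. \<theta> * x j"] d \<theta>x
    by (simp add: N_def L2_set_diff_commute[of "ivec p"])
  have N0: "N > 0" using N1 a by linarith
  have eq: "x j - nvec n p j = (1 / \<theta>) * (\<theta> * x j - ivec p j) + (1 / \<theta> - 1 / N) * ivec p j" for j
    using \<theta> by (simp add: nvec_def N_def[symmetric] field_simps)
  have "L2_set (\<lambda>j. x j - nvec n p j) {..<n} \<le> L2_set (\<lambda>j. (1 / \<theta>) * (\<theta> * x j - ivec p j)) {..<n}
      + L2_set (\<lambda>j. (1 / \<theta> - 1 / N) * ivec p j) {..<n}"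
    unfolding eq by (rule L2_set_triangle_ineq)
  also have "L2_set (\<lambda>j. (1 / \<theta>) * (\<theta> * x j - ivec p j)) {..<n} \<le> a / \<theta>"
    using d \<theta> by (simp only: L2_set_scale) (simp add: divide_right_mono)
  also have "L2_set (\<lambda>j. (1 / \<theta> - 1 / N) * ivec p j) {..<n} = \<bar>1 / \<theta> - 1 / N\<bar> * N"
    by (simp only: L2_set_scale N_def)
  also have "\<dots> = \<bar>N - \<theta>\<bar> / \<theta>"
  proof -
    have "1 / \<theta> - 1 / N = (N - \<theta>) / (\<theta> * N)" using \<theta> N0 by (simp add: field_simps)
    then show ?thesis using \<theta> N0 by (simp add: abs_mult)
  qed
  also have "\<dots> \<le> a / \<theta>" using N1 N2 \<theta> by (intro divide_right_mono) auto
  finally have "L2_set (\<lambda>j. x j - nvec n p j) {..<n} \<le> 2 * a / \<theta>" by simp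
  moreover have "p \<in> {..<n} \<rightarrow>\<^sub>E UNIV" by (simp add: p_def)
  ultimately show thesis using that[of p] N0 N2 by (simp add: N_def)
qed

lemma int_l1_ballI:
  assumes "p \<in> {..<n} \<rightarrow>\<^sub>E UNIV" "L2_set (ivec p) {..<n} \<le> R"
  shows "p \<in> int_l1_ball n (sqrt n * R)"
proof -
  have "(\<Sum>j<n. \<bar>ivec p j\<bar>) \<le> sqrt n * L2_set (ivec p) {..<n}" by (rule sum_abs_le_sqrt_L2)
  also have "\<dots> \<le> sqrt n * R" using assms by (intro mult_left_mono) auto
  finally show ?thesis using assms by (simp add: int_l1_ball_def ivec_def)
qed

text \<open>The least common denominator of Rudelson and Vershynin, split into two ranges: up to \<open>c \<surd>n\<close>
  the distance of \<open>\<theta> x\<close> to the lattice has to be proportional to \<open>\<theta>\<close> (\<open>low_ok\<close>, which replaces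
      incompressibility), beyond that
  it has to be at least \<open>\<alpha> n\<close> (\<open>high_ok\<close> below).\<close>

definition low_ok :: "real \<Rightarrow> real \<Rightarrow> nat \<Rightarrow> (nat \<Rightarrow> real) \<Rightarrow> bool" where
  "low_ok \<gamma> c n x \<longleftrightarrow> (\<forall>\<theta>. \<bar>\<theta>\<bar> \<le> c * sqrt n \<longrightarrow> (\<gamma> * \<theta>)\<^sup>2 \<le> int_dist_sq n \<theta> x)"

text \<open>All rows of a square matrix, or all but one; the second case arises for normals of n - 1
  columns.\<close>

abbreviation row_set :: "nat \<Rightarrow> nat set \<Rightarrow> bool" where
  "row_set n I \<equiv> finite I \<and> n - 1 \<le> card I \<and> card I \<le> n"

abbreviation low_event :: "real \<Rightarrow> real \<Rightarrow> nat \<Rightarrow> nat set \<Rightarrow> real \<Rightarrow> (nat \<times> nat \<Rightarrow> real) set" where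
  "low_event \<gamma> c n I e \<equiv>
     {f. \<exists>x. vnorm n x = 1 \<and> \<not> low_ok \<gamma> c n x \<and> L2_set (mv n f x) I \<le> e * sqrt n}"

context discrete_law
begin

section \<open>Discretization of vectors and of the shift caused by the mean\<close>

lemma mv_decompose: "mv n f z i = mv n (centered f) z i + \<mu> * (\<Sum>j<n. z j)"
  by (simp add: mv_def algebra_simps sum_subtractf sum_distrib_left)

text \<open>The mean of the entries acts on the rounding error \<open>x - w\<close> as one scalar shift common to all rows,
  so that it is enough to discretize this scalar.\<close>

lemma shift_discretization:
  assumes op: "op_good I n f" and d: "L2_set (\<lambda>j. x j - w j) {..<n} \<le> d"
    and e: "L2_set (mv n f x) I \<le> e" and \<eta>: "\<eta> > 0" and I: "finite I" "card I \<le> n"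
  obtains k :: int where "\<bar>real_of_int k\<bar> \<le> K * sqrt n * d / \<eta> + 1"
    "L2_set (\<lambda>i. mv n f w i - \<eta> * real_of_int k) I \<le> e + op_const * sqrt n * d + \<eta> * sqrt n"
proof -
  define z where "z = (\<lambda>j. w j - x j)"
  define s where "s = \<mu> * (\<Sum>j<n. z j)"
  define k where "k = round (s / \<eta>)"
  have op_const: "op_const \<ge> 0" using K by (simp add: op_const_def)
  have z: "vnorm n z \<le> d" using d by (simp add: z_def L2_set_diff_commute[of w])
  have "\<bar>s\<bar> \<le> K * (sqrt n * d)"
  proof -
    have "\<bar>\<Sum>j<n. z j\<bar> \<le> (\<Sum>j<n. \<bar>z j\<bar>)" by (rule sum_abs)
    also have "\<dots> \<le> sqrt n * vnorm n z" by (rule sum_abs_le_sqrt_L2)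
    also have "\<dots> \<le> sqrt n * d" using z by (intro mult_left_mono) auto
    finally show ?thesis unfolding s_def abs_mult using abs_mean_le K by (intro mult_mono) auto
  qed
  then have sk: "\<bar>s / \<eta>\<bar> \<le> K * sqrt n * d / \<eta>"
    using \<eta> by (simp add: abs_mult divide_right_mono mult.assoc)
  have k1: "\<bar>s / \<eta> - real_of_int k\<bar> \<le> 1/2"
    using rdist_le_half[of "s / \<eta>"] by (simp add: rdist_def k_def)
  have "\<bar>s - \<eta> * real_of_int k\<bar> = \<eta> * \<bar>s / \<eta> - real_of_int k\<bar>"
  proof -
    have "s - \<eta> * real_of_int k = \<eta> * (s / \<eta> - real_of_int k)" using \<eta> by (simp add: field_simps)
    then show ?thesis using \<eta> by (simp add: abs_mult)
  qed
  also have "\<dots> \<le> \<eta> * 1" using k1 \<eta> by (intro mult_left_mono) auto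
  finally have s\<eta>: "\<bar>s - \<eta> * real_of_int k\<bar> \<le> \<eta>" by simp
  \<comment> \<open>The image of the net point splits into the image of x, the centered matrix
    applied to w - x, and the rounding error of the scalar shift s.\<close>
  have eq: "mv n f w i - \<eta> * real_of_int k = mv n f x i + (mv n (centered f) z i + (s - \<eta>
      * real_of_int k))" for i
  proof -
    have "mv n f z i = mv n f w i - mv n f x i" unfolding z_def by (rule mv_diff)
    then show ?thesis using mv_decompose[of n f z i] by (simp add: s_def)
  qed
  have "L2_set (\<lambda>i. mv n f w i - \<eta> * real_of_int k) I \<le> L2_set (mv n f x) I +
      L2_set (\<lambda>i. mv n (centered f) z i + (s - \<eta> * real_of_int k)) I"
    unfolding eq by (rule L2_set_triangle_ineq)
  also have "L2_set (\<lambda>i. mv n (centered f) z i + (s - \<eta> * real_of_int k)) I \<le>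
      L2_set (mv n (centered f) z) I + L2_set (\<lambda>i. s - \<eta> * real_of_int k) I"
    by (rule L2_set_triangle_ineq)
  also have "L2_set (mv n (centered f) z) I \<le> op_const * sqrt n * d"
  proof -
    have "L2_set (mv n (centered f) z) I \<le> op_const * sqrt n * vnorm n z" using op
      by (simp add: op_good_def)
    also have "\<dots> \<le> op_const * sqrt n * d" using z op_const by (intro mult_left_mono) auto
    finally show ?thesis .
  qed
  also have "L2_set (\<lambda>i. s - \<eta> * real_of_int k) I \<le> \<eta> * sqrt n"
  proof -
    have "sqrt (card I) * \<bar>s - \<eta> * real_of_int k\<bar> \<le> sqrt n * \<eta>"
      using I s\<eta> by (intro mult_mono) auto
    then show ?thesis by (simp add: L2_set_constant mult.commute)
  qed
  finally have "L2_set (\<lambda>i. mv n f w i - \<eta> * real_of_int k) I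
      \<le> e + op_const * sqrt n * d + \<eta> * sqrt n"
    using e by simp
  moreover have "\<bar>real_of_int k\<bar> \<le> K * sqrt n * d / \<eta> + 1" using sk k1 by linarith
  ultimately show thesis by (rule that[rotated])
qed

text \<open>A union bound over net points and shifts. At most 2 \<kappa> + 1 shifts occur; \<kappa>
  will be of order sqrt n, a negligible price against the product over the rows.\<close>

lemma prob_net_union:
  fixes \<kappa> :: real
  assumes "finite P" "finite I" "t > 0" and B: "\<And>p. p \<in> P \<Longrightarrow> Q n (w p) (h / t) \<le> B" and \<kappa>: "\<kappa> \<ge> 0"
  shows "Pr (rmat I n) {f. \<exists>p\<in>P. \<exists>k::int. \<bar>real_of_int k\<bar> \<le> \<kappa> \<and>
      L2_set (\<lambda>i. mv n f (w p) i - \<eta> * real_of_int k) I \<le> sqrt M * t}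
    \<le> card P * (2 * \<kappa> + 1) * (exp (M / 2) * B ^ card I)"
proof -
  define Z where "Z = {-\<lfloor>\<kappa>\<rfloor>..\<lfloor>\<kappa>\<rfloor>}"
  define E where "E = (\<lambda>(p, k). {f. (\<Sum>i\<in>I. (mv n f (w p) i - \<eta> * real_of_int k)\<^sup>2) \<le> M * t\<^sup>2})"
  have Z: "real (card Z) \<le> 2 * \<kappa> + 1"
  proof -
    have "0 \<le> \<lfloor>\<kappa>\<rfloor>" "real_of_int \<lfloor>\<kappa>\<rfloor> \<le> \<kappa>" using \<kappa> by simp_all
    then show ?thesis unfolding Z_def by (simp add: of_nat_nat)
  qed
  have "Pr (rmat I n) {f. \<exists>p\<in>P. \<exists>k::int. \<bar>real_of_int k\<bar> \<le> \<kappa> \<and>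
      L2_set (\<lambda>i. mv n f (w p) i - \<eta> * real_of_int k) I \<le> sqrt M * t}
          \<le> Pr (rmat I n) (\<Union>pk\<in>P \<times> Z. E pk)"
  proof (intro measure_pmf.finite_measure_mono subsetI, goal_cases)
    case (1 f)
    then obtain p k where pk: "p \<in> P" "\<bar>real_of_int k\<bar> \<le> \<kappa>"
      "L2_set (\<lambda>i. mv n f (w p) i - \<eta> * real_of_int k) I \<le> sqrt M * t" by blast
    have "k \<le> \<lfloor>\<kappa>\<rfloor>" "- k \<le> \<lfloor>\<kappa>\<rfloor>" using pk(2) by (simp_all add: le_floor_iff)
    then have "k \<in> Z" unfolding Z_def by auto
    moreover have "f \<in> E (p, k)"
    proof -
      have "(\<Sum>i\<in>I. (mv n f (w p) i - \<eta> * real_of_int k)\<^sup>2)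
          = (L2_set (\<lambda>i. mv n f (w p) i - \<eta> * real_of_int k) I)\<^sup>2"
        by (simp add: L2_set_def sum_nonneg)
      also have "\<dots> \<le> (sqrt M * t)\<^sup>2" using pk(3) by (intro power_mono) auto
      also have "\<dots> = M * t\<^sup>2"
      proof -
        have "0 \<le> sqrt M * t" using pk(3) L2_set_nonneg order_trans by blast
        then have "M \<ge> 0" using assms(3) by (simp add: zero_le_mult_iff)
        then show ?thesis by (simp add: power_mult_distrib)
      qed
      finally show ?thesis by (simp add: E_def)
    qed
    ultimately show ?case using pk(1) by blast
  qed simp
  also have "\<dots> \<le> (\<Sum>pk\<in>P \<times> Z. Pr (rmat I n) (E pk))"
    using assms(1) by (intro measure_pmf.finite_measure_subadditive_finite) (auto simp: Z_def)
  also have "\<dots> \<le> (\<Sum>pk\<in>P \<times> Z. exp (M / 2) * B ^ card I)"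
  proof (intro sum_mono)
    fix pk assume "pk \<in> P \<times> Z"
    then obtain p k where pk: "pk = (p, k)" "p \<in> P" by auto
    have "Pr (rmat I n) (E pk) \<le> exp (M / 2) * Q n (w p) (h / t) ^ card I"
      unfolding E_def pk prod.case by (rule prob_rows_small[OF assms(2,3)])
    also have "\<dots> \<le> exp (M / 2) * B ^ card I"
      using B[OF pk(2)] Q_nonneg by (intro mult_left_mono power_mono) auto
    finally show "Pr (rmat I n) (E pk) \<le> exp (M / 2) * B ^ card I" .
  qed
  also have "\<dots> = card P * card Z * (exp (M / 2) * B ^ card I)" by (simp add: card_cartesian_product)
  also have "\<dots> \<le> card P * (2 * \<kappa> + 1) * (exp (M / 2) * B ^ card I)"
  \<comment> \<open>Nonnegativity of B can only be read off from a point of P; for empty P both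
    sides vanish.\<close>
  proof (cases "P = {}")
    case False
    then obtain p where "p \<in> P" by blast
    then have "0 \<le> B" using B Q_nonneg order_trans by blast
    then show ?thesis using Z by (intro mult_right_mono) (simp_all add: mult_left_mono)
  qed simp
  finally show ?thesis .
qed

text \<open>A violation of \<open>low_ok\<close> puts x within 2 \<gamma> of a normalized integer
  vector of norm at most 2 c sqrt n. For small c there are at most exp(L n / 4) of these. Each is
  mapped close to a given shift by at least n - 1 rows with probability at most exp(L n / 4) exp(-L
  (n - 1)), where exp(-L) is the uniform bound q < 1 on the unit sphere.\<close>

lemma low_structured:
  obtains \<gamma> c c2 c3 where "0 < \<gamma>" "\<gamma> \<le> 1/4" "0 < c" "0 < c2" "0 < c3"
    "\<forall>\<^sub>F n in sequentially. \<forall>I. row_set n I \<longrightarrow>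
      Pr (rmat I n) (low_event \<gamma> c n I c2) \<le> exp (- c3 * real n)"
proof -
  \<comment> \<open>The maximum with 1/2 keeps q positive, as the logarithm requires.\<close>
  define q where "q = max unit_decay (1/2)"
  define L where "L = - ln q"
  have q: "0 < q" "q < 1" "unit_decay \<le> q" using unit_decay_less_1 by (auto simp: q_def)
  have L: "L > 0" using q by (simp add: L_def)
  have qe: "q = exp (- L)" using q by (simp add: L_def)
  \<comment> \<open>With the budget M = L n / 2 this gives sqrt M h = 4 \<eta> sqrt n, of which
    three parts are spent: on the image of x, on the approximation error and on the discretization
    of the shift.\<close>
  define \<rho> where "\<rho> = L * h\<^sup>2 / 2"
  have \<rho>: "\<rho> > 0" using L h by (simp add: \<rho>_def)
  define \<eta> where "\<eta> = sqrt \<rho> / 4"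
  have \<eta>: "\<eta> > 0" using \<rho> by (simp add: \<eta>_def)
  have op_const: "op_const \<ge> 1" using K by (simp add: op_const_def)
  \<comment> \<open>A distance of 2 \<gamma> from the net, magnified by the operator norm, may cost
    at most one part \<eta>.\<close>
  define \<gamma> where "\<gamma> = min (1/4) (sqrt \<rho> / (8 * op_const))"
  have \<gamma>: "0 < \<gamma>" "\<gamma> \<le> 1/4" "op_const * (2 * \<gamma>) \<le> \<eta>"
  proof -
    show "0 < \<gamma>" "\<gamma> \<le> 1/4" using \<rho> op_const by (auto simp: \<gamma>_def)
    have "op_const * (2 * \<gamma>) \<le> op_const * (2 * (sqrt \<rho> / (8 * op_const)))" using op_const
      by (intro mult_left_mono) (auto simp: \<gamma>_def)
    also have "\<dots> = \<eta>" using op_const by (simp add: \<eta>_def)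
    finally show "op_const * (2 * \<gamma>) \<le> \<eta>" .
  qed
  have "((\<lambda>l::real. (1 + exp (-l)) / (1 - exp (-l))) \<longlongrightarrow> 1) at_top" by real_asymp
  moreover have "exp (L / 8) > 1" using L by simp
  ultimately have "eventually (\<lambda>l::real. (1 + exp (-l)) / (1 - exp (-l)) < exp (L / 8)) at_top"
    by (rule order_tendstoD)
  then have "eventually (\<lambda>l::real. (1 + exp (-l)) / (1 - exp (-l)) < exp (L / 8) \<and> l > 0) at_top"
    using eventually_gt_at_top[of "0::real"] by eventually_elim auto
  then obtain l :: real where l: "(1 + exp (-l)) / (1 - exp (-l)) < exp (L / 8)" "l > 0"
    unfolding eventually_at_top_linorder by blast
  \<comment> \<open>Then exp(l (2 c n)) = exp(L n / 8); together with the factor exp(L / 8) for each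
    coordinate the net has at most exp(L n / 4) points.\<close>
  define c where "c = L / (16 * l)"
  have c: "c > 0" "l * (2 * c) = L / 8" using L l by (auto simp: c_def)
  define \<kappa> where "\<kappa> n = K * sqrt (real n) * (2 * \<gamma>) / \<eta> + 1" for n :: nat
  \<comment> \<open>The exponents L n / 4 + L n / 4 - L (n - 1) leave about -L n / 2; giving up half
    of this absorbs the number of shifts and the constants.\<close>
  have evA: "\<forall>\<^sub>F n in sequentially. exp (- real n) + exp (L * real n / 4) * (2 * (A * sqrt (real n)
      + 1) + 1) * (exp (L * real n / 4) * (exp (- L * (real n - 1))))
      \<le> exp (- min (1/2) (L / 4) * real n)" if "A > 0" for A :: real
  proof -
    have 1: "\<forall>\<^sub>F n in sequentially. exp (- real n) \<le> exp (- (1/2) * real n) / 2" by real_asymp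
    have 2: "\<forall>\<^sub>F n in sequentially. exp (L * real n / 4) * (2 * (A * sqrt (real n) + 1) + 1)
        * (exp (L * real n / 4) * (exp (- L * (real n - 1)))) \<le> exp (- (L / 4) * real n) / 2"
      using L that by real_asymp
    show ?thesis using 1 2
    proof eventually_elim
      case (elim n)
      have "min (1/2) (L / 4) * real n \<le> 1/2 * real n" "min (1/2) (L / 4) * real n \<le> L / 4 * real n"
        by (intro mult_right_mono; simp)+
      then have "exp (- (1/2) * real n) \<le> exp (- min (1/2) (L / 4) * real n)" "exp (- (L / 4)
          * real n) \<le> exp (- min (1/2) (L / 4) * real n)"
        by simp_all
      with elim show ?case by linarith
    qed
  qed
  have "K * (2 * \<gamma>) / \<eta> > 0" using K \<gamma> \<eta> by simp
  from evA[OF this] have ev: "\<forall>\<^sub>F n in sequentially. exp (- real n) + exp (L * real n / 4) * (2 * (K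
      * (2 * \<gamma>) / \<eta> * sqrt (real n) + 1) + 1) * (exp (L * real n / 4) * (exp (- L * (real n - 1))))
      \<le> exp (- min (1/2) (L / 4) * real n)" .
  show thesis
  proof (rule that[of \<gamma> c \<eta> "min (1/2) (L / 4)"])
    show "\<forall>\<^sub>F n in sequentially. \<forall>I. row_set n I \<longrightarrow>
      Pr (rmat I n) (low_event \<gamma> c n I \<eta>) \<le> exp (- min (1/2) (L / 4) * real n)"
      using ev eventually_ge_at_top[of 1]
    proof eventually_elim
      case (elim n)
      show ?case
      proof (intro allI impI)
        fix I :: "nat set" assume I: "row_set n I"
        define P where "P = {p \<in> int_l1_ball n (sqrt n * (2 * (c
            * sqrt n))). L2_set (ivec p) {..<n} > 0}"
        define M where "M = L * real n / 2"
        define E where "E = {f. \<exists>p\<in>P. \<exists>k::int. \<bar>real_of_int k\<bar> \<le> \<kappa> n \<and>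
           L2_set (\<lambda>i. mv n f (nvec n p) i - \<eta> * real_of_int k) I \<le> sqrt M * h}"
        have finP: "finite P" unfolding P_def using finite_int_l1_ball[OF l(2)] by simp
        have Mh: "sqrt M * h = 4 * \<eta> * sqrt n"
        proof -
          have "sqrt M * h = sqrt (M * h\<^sup>2)" using h by (simp add: real_sqrt_mult)
          also have "M * h\<^sup>2 = \<rho> * real n" by (simp add: M_def \<rho>_def)
          finally show ?thesis by (simp add: real_sqrt_mult \<eta>_def)
        qed
        have "Pr (rmat I n) (low_event \<gamma> c n I \<eta>)
           \<le> Pr (rmat I n) ((op_bad I n) \<union> E)"
        proof (intro measure_pmf.finite_measure_mono subsetI, goal_cases)
          case (1 f)
          then obtain x where x: "vnorm n x = 1" "\<not> low_ok \<gamma> c n x" "L2_set (mv n f x) I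
              \<le> \<eta> * sqrt n" by blast
          show ?case
          proof (cases "op_good I n f")
            case True
            obtain \<theta>' where \<theta>': "\<bar>\<theta>'\<bar> \<le> c * sqrt n" "int_dist_sq n \<theta>' x < (\<gamma> * \<theta>')\<^sup>2"
              using x(2) unfolding low_ok_def by force
            define \<theta> where "\<theta> = \<bar>\<theta>'\<bar>"
            have int_dist_sq: "int_dist_sq n \<theta> x < (\<gamma> * \<theta>)\<^sup>2" using \<theta>'
              by (simp add: \<theta>_def power_mult_distrib)
            have \<theta>0: "\<theta> > 0"
            proof (rule ccontr)
              assume "\<not> \<theta> > 0"
              then have "(\<gamma> * \<theta>)\<^sup>2 = 0" by (simp add: \<theta>_def)
              with int_dist_sq int_dist_sq_nonneg[of n \<theta> x] show False by linarith
            qed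
            have \<gamma>\<theta>: "0 \<le> \<gamma> * \<theta>" "\<gamma> * \<theta> < \<theta>" using \<gamma> \<theta>0 by auto
            obtain p where p: "p \<in> {..<n} \<rightarrow>\<^sub>E UNIV" "L2_set (ivec p) {..<n} > 0" "L2_set (ivec p)
                {..<n} \<le> \<theta> + \<gamma> * \<theta>"
              "L2_set (\<lambda>j. x j - nvec n p j) {..<n} \<le> 2 * (\<gamma> * \<theta>) / \<theta>"
              using integer_approximation[OF x(1) \<gamma>\<theta> less_imp_le[OF int_dist_sq]] by blast
            have N2: "\<theta> + \<gamma> * \<theta> \<le> 2 * (c * sqrt n)" using \<gamma>\<theta> \<theta>'(1) unfolding \<theta>_def by linarith
            have pP: "p \<in> P"
              unfolding P_def using int_l1_ballI[OF p(1) order_trans[OF p(3) N2]] p(2) by simp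
            have d: "L2_set (\<lambda>j. x j - nvec n p j) {..<n} \<le> 2 * \<gamma>" using p(4) \<theta>0 by simp
            obtain k :: int where k: "\<bar>real_of_int k\<bar> \<le> K * sqrt n * (2 * \<gamma>) / \<eta> + 1"
               "L2_set (\<lambda>i. mv n f (nvec n p) i - \<eta> * real_of_int k) I
                   \<le> \<eta> * sqrt n + op_const * sqrt n * (2 * \<gamma>) + \<eta> * sqrt n"
              using shift_discretization[OF True d x(3) \<eta>] I by blast
            have "op_const * (2 * \<gamma>) * sqrt n \<le> \<eta> * sqrt n" using \<gamma> by (intro mult_right_mono) auto
            then have "L2_set (\<lambda>i. mv n f (nvec n p) i - \<eta> * real_of_int k) I \<le> 3 * (\<eta> * sqrt n)"
              using k(2) by (simp add: mult_ac)
            also have "\<dots> \<le> sqrt M * h" unfolding Mh using \<eta> by simp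
            finally have "f \<in> E" unfolding E_def \<kappa>_def using k(1) pP by blast
            then show ?thesis by blast
          qed simp
        qed simp
        also have "\<dots> \<le> Pr (rmat I n) (op_bad I n) + Pr (rmat I n) E"
          by (rule measure_Un_le) auto
        also have "Pr (rmat I n) (op_bad I n) \<le> exp (- real n)"
          using I elim by (intro prob_op_bad) auto
        also have "Pr (rmat I n) E \<le> card P * (2 * \<kappa> n + 1) * (exp (M / 2) * q ^ card I)"
          unfolding E_def
        proof (rule prob_net_union[OF finP _ h])
          show "finite I" using I by simp
          show "Q n (nvec n p) (h / h) \<le> q" if "p \<in> P" for p
            using Q_unit_le_decay[OF L2_set_nvec[of p n]] that q(3) h by (simp add: P_def)
          show "0 \<le> \<kappa> n" using K \<gamma> \<eta> by (simp add: \<kappa>_def)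
        qed
        also have "\<dots> \<le> exp (L * real n / 4) * (2 * \<kappa> n + 1) * (exp (L * real n / 4) * exp (- L
            * (real n - 1)))"
        proof (intro mult_mono)
          have "real (card P) \<le> card (int_l1_ball n (sqrt n * (2 * (c * sqrt n))))"
            unfolding P_def using finite_int_l1_ball[OF l(2)] by (intro of_nat_mono card_mono) auto
          also have "\<dots> \<le> exp (l * (sqrt n * (2 * (c * sqrt n)))) * ((1 + exp (-l)) / (1
              - exp (-l))) ^ n"
            by (rule card_int_l1_ball[OF l(2)])
          also have "\<dots> \<le> exp (L * real n / 8) * exp (L / 8) ^ n"
          proof (intro mult_mono power_mono)
            have "l * (sqrt n * (2 * (c * sqrt n))) = l * (2 * c) * (sqrt n * sqrt n)"
              by (simp only: mult_ac)
            also have "\<dots> = L * real n / 8" by (simp add: c(2))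
            finally show "exp (l * (sqrt n * (2 * (c * sqrt n)))) \<le> exp (L * real n / 8)" by simp
          qed (use l in auto)
          also have "\<dots> = exp (L * real n / 4)"
            by (simp add: exp_of_nat_mult[symmetric] exp_add[symmetric])
          finally show "real (card P) \<le> exp (L * real n / 4)" .
          show "exp (M / 2) \<le> exp (L * real n / 4)" by (simp add: M_def)
          have "q ^ card I \<le> q ^ (n - 1)" using I q by (intro power_decreasing) auto
          also have "\<dots> = exp (- L * (real n - 1))"
            using elim by (simp add: qe exp_of_nat_mult[symmetric] of_nat_diff mult.commute)
          finally show "q ^ card I \<le> exp (- L * (real n - 1))" .
          show "0 \<le> 2 * \<kappa> n + 1" using K \<gamma> \<eta> by (simp add: \<kappa>_def)
        qed (use q K \<gamma> \<eta> in \<open>auto simp: \<kappa>_def\<close>)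
        also have "2 * \<kappa> n + 1 = 2 * (K * (2 * \<gamma>) / \<eta> * sqrt (real n) + 1) + 1" by (simp add: \<kappa>_def)
        finally show "Pr (rmat I n) (low_event \<gamma> c n I \<eta>)
           \<le> exp (- min (1/2) (L / 4) * real n)" using elim(1) by linarith
      qed
    qed
  qed (use \<gamma> c \<eta> L in auto)
qed

end

section \<open>Vectors with a large approximate denominator\<close>

lemma rdist_lipschitz: "rdist u \<le> rdist v + \<bar>u - v\<bar>"
  using rdist_le_int[of u "round v"] by (simp add: rdist_def)

lemma int_dist_sq_lipschitz: "sqrt (int_dist_sq n \<theta> x)
    \<le> sqrt (int_dist_sq n \<theta> w) + \<bar>\<theta>\<bar> * L2_set (\<lambda>j. x j - w j) {..<n}"
proof -
  have "sqrt (int_dist_sq n \<theta> x) = L2_set (\<lambda>j. rdist (\<theta> * x j)) {..<n}"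
    by (simp add: L2_set_def int_dist_sq_def)
  also have "\<dots> \<le> L2_set (\<lambda>j. rdist (\<theta> * w j) + \<bar>\<theta> * (x j - w j)\<bar>) {..<n}"
    by (intro L2_set_mono) (use rdist_lipschitz in \<open>auto simp: right_diff_distrib\<close>)
  also have "\<dots> \<le> L2_set (\<lambda>j. rdist (\<theta> * w j)) {..<n} + L2_set (\<lambda>j. \<bar>\<theta> * (x j - w j)\<bar>) {..<n}"
    by (rule L2_set_triangle_ineq)
  also have "L2_set (\<lambda>j. rdist (\<theta> * w j)) {..<n} = sqrt (int_dist_sq n \<theta> w)"
    by (simp add: L2_set_def int_dist_sq_def)
  also have "L2_set (\<lambda>j. \<bar>\<theta> * (x j - w j)\<bar>) {..<n} = L2_set (\<lambda>j. \<theta> * (x j - w j)) {..<n}"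
    by (simp add: L2_set_def)
  finally show ?thesis by (simp add: L2_set_scale)
qed

text \<open>Passes lower bounds on the lattice distance from x to its net point, at the price
  |\<theta>| d.\<close>

lemma int_dist_sq_lower_transfer:
  assumes "b \<ge> 0" "b\<^sup>2 \<le> int_dist_sq n \<theta> x" "L2_set (\<lambda>j. x j - w j) {..<n} \<le> d" "a \<ge> 0" "a + \<bar>\<theta>\<bar> * d
      \<le> b"
  shows "a\<^sup>2 \<le> int_dist_sq n \<theta> w"
proof -
  have "b = sqrt (b\<^sup>2)" using assms(1) by simp
  also have "\<dots> \<le> sqrt (int_dist_sq n \<theta> x)" using assms(2) by (rule real_sqrt_le_mono)
  also have "\<dots> \<le> sqrt (int_dist_sq n \<theta> w) + \<bar>\<theta>\<bar> * L2_set (\<lambda>j. x j - w j) {..<n}"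
    by (rule int_dist_sq_lipschitz)
  also have "\<dots> \<le> sqrt (int_dist_sq n \<theta> w) + \<bar>\<theta>\<bar> * d" using assms(3)
    by (intro add_left_mono mult_left_mono) auto
  finally have "a \<le> sqrt (int_dist_sq n \<theta> w)" using assms(5) by linarith
  then have "a\<^sup>2 \<le> (sqrt (int_dist_sq n \<theta> w))\<^sup>2" using assms(4) by (intro power_mono)
  then show ?thesis by simp
qed

text \<open>The exponent lies between 3/8 and 1/2: below 1/2, the product over the rows beats the
  net by a superexponential factor; above 3/8, the error exp(-\<kappa> (\<alpha> n)^2) is smaller
  than exp(-n^(3/4)).\<close>

definition \<alpha> :: "nat \<Rightarrow> real" where
  "\<alpha> n = real n powr (2/5)"

text \<open>The largest D for which the errors exp(-\<kappa> (\<alpha> n)^2) in the small ball bound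
  stay below 1 / D.\<close>

definition Tmax :: "real \<Rightarrow> nat \<Rightarrow> real" where
  "Tmax \<kappa> n = exp (\<kappa> * (\<alpha> n)\<^sup>2)"

definition high_ok :: "real \<Rightarrow> real \<Rightarrow> nat \<Rightarrow> (nat \<Rightarrow> real) \<Rightarrow> bool" where
  "high_ok \<kappa> c n x \<longleftrightarrow> (\<forall>\<theta>. c * sqrt n \<le> \<bar>\<theta>\<bar> \<and> \<bar>\<theta>\<bar> \<le> Tmax \<kappa> n \<longrightarrow> (\<alpha> n)\<^sup>2 \<le> int_dist_sq n \<theta> x)"

abbreviation high_event :: "real \<Rightarrow> real \<Rightarrow> real \<Rightarrow> nat \<Rightarrow> nat set \<Rightarrow> (nat \<times> nat \<Rightarrow> real) set" where
  "high_event \<gamma> c \<kappa> n I \<equiv>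
     {f. \<exists>x. vnorm n x = 1 \<and> low_ok \<gamma> c n x \<and> \<not> high_ok \<kappa> c n x \<and> (\<forall>i\<in>I. mv n f x i = 0)}"

text \<open>The minimal dyadic scale at which a bad \<theta> exists. Minimality excludes bad
  multipliers below that scale, and this is what gives the net points belonging to it a good small
  ball bound.\<close>

lemma dyadic_scale:
  fixes D0 :: real
  assumes D0: "D0 > 0" and bad: "D0 \<le> \<theta>0" "\<theta>0 \<le> T" "int_dist_sq n \<theta>0 x < b"
  obtains l :: nat and \<theta> where "D0 * 2 ^ l \<le> \<theta>" "\<theta> \<le> 2 * (D0 * 2 ^ l)" "\<theta>
      \<le> T" "int_dist_sq n \<theta> x < b"
    "\<And>\<theta>'. D0 \<le> \<theta>' \<Longrightarrow> \<theta>' < D0 * 2 ^ l \<Longrightarrow> b \<le> int_dist_sq n \<theta>' x"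
proof -
  define P where "P l = (\<exists>\<theta>. D0 \<le> \<theta> \<and> \<theta> \<le> T \<and> int_dist_sq n \<theta> x < b \<and> \<theta>
      \<le> 2 * (D0 * 2 ^ l))" for l :: nat
  obtain l0 :: nat where "\<theta>0 / D0 < 2 ^ l0" using real_arch_pow[of 2 "\<theta>0 / D0"] by auto
  then have "\<theta>0 \<le> 2 * (D0 * 2 ^ l0)" using D0 bad by (simp add: field_simps)
  then have "P l0" unfolding P_def using bad by blast
  define l where "l = (LEAST l. P l)"
  have "P l" unfolding l_def using \<open>P l0\<close> by (rule LeastI)
  then obtain \<theta> where \<theta>: "D0 \<le> \<theta>" "\<theta> \<le> T" "int_dist_sq n \<theta> x < b" "\<theta> \<le> 2 * (D0 * 2 ^ l)"
    unfolding P_def by blast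
  have below: "b \<le> int_dist_sq n \<theta>' x" if "D0 \<le> \<theta>'" "\<theta>' < D0 * 2 ^ l" "\<theta>' \<le> T" for \<theta>'
  proof (rule ccontr)
    assume nb: "\<not> b \<le> int_dist_sq n \<theta>' x"
    show False
    proof (cases l)
      case 0 then show False using that by simp
    next
      case (Suc m)
      then have "P m" unfolding P_def using that nb by (intro exI[of _ \<theta>']) auto
      moreover have "m < (LEAST l. P l)" using Suc l_def by simp
      ultimately show False using not_less_Least by blast
    qed
  qed
  \<comment> \<open>Minimality applied to \<theta> itself; afterwards \<theta>' \<le> T is automatic
    below the scale.\<close>
  have "D0 * 2 ^ l \<le> \<theta>" using below[OF \<theta>(1) _ \<theta>(2)] \<theta>(3) by linarith
  moreover have "b \<le> int_dist_sq n \<theta>' x" if "D0 \<le> \<theta>'" "\<theta>' < D0 * 2 ^ l" for \<theta>'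
    using below[OF that] that \<theta>(2) calculation by linarith
  ultimately show thesis using that \<theta> by blast
qed

text \<open>From exp l \<ge> 1 + l. For small l the net has a factor of order 1 / l for each
  coordinate, which becomes D / sqrt n for l = sqrt n / D.\<close>

lemma net_factor_le:
  fixes l :: real
  assumes "l > 0"
  shows "(1 + exp (-l)) / (1 - exp (-l)) \<le> 2 * (1 + l) / l"
proof -
  have "exp (-l) \<le> 1 / (1 + l)"
    using exp_ge_add_one_self[of l] assms by (simp add: exp_minus field_simps)
  then have "l / (1 + l) \<le> 1 - exp (-l)" using assms by (simp add: field_simps)
  moreover have "l / (1 + l) > 0" using assms by simp
  moreover have "1 + exp (-l) \<le> 2" using assms by simp
  ultimately have "(1 + exp (-l)) / (1 - exp (-l)) \<le> 2 / (l / (1 + l))"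
    by (intro frac_le) auto
  then show ?thesis by simp
qed

context discrete_law
begin

lemma Q_le_1: "Q n x \<sigma> \<le> 1"
proof -
  interpret G: prob_space gauss by (rule prob_space_std_normal)
  have "Q n x \<sigma> \<le> (\<integral>g. 1 \<partial>gauss)" unfolding Q_def
    by (rule integral_mono[OF integrable_exp_int_dist_sq]) (use exp_int_dist_sq_le_1 in auto)
  then show ?thesis using G.prob_space by simp
qed

text \<open>The clause for \<theta>' < D carries the minimality of the scale and controls the middle
  range of the small ball bound.\<close>

definition scale_event :: "real \<Rightarrow> real \<Rightarrow> nat \<Rightarrow> nat set \<Rightarrow> real \<Rightarrow> (nat \<times> nat \<Rightarrow> real) set" where
  "scale_event \<gamma> c n I D = {f. \<exists>x \<theta>. vnorm n x = 1 \<and> low_ok \<gamma> c n x \<and>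
     D \<le> \<theta> \<and> \<theta> \<le> 2 * D \<and> int_dist_sq n \<theta> x < (\<alpha> n)\<^sup>2 \<and>
     (\<forall>\<theta>'. c * sqrt n \<le> \<theta>' \<and> \<theta>' < D \<longrightarrow> (\<alpha> n)\<^sup>2 \<le> int_dist_sq n \<theta>' x) \<and> (\<forall>i\<in>I. mv n f x i = 0)}"

text \<open>At precision t = \<alpha> n / D the powers of D in the net size and in the product over
  the rows cancel up to one factor D, which remains because possibly only n - 1 rows are available.
  The net is restricted to integer vectors whose normalization inherits the lattice bounds of x,
  with halved constants and up to D / 4: moving x by 2 t changes \<theta> x by at most \<alpha> n /
  2 there.\<close>

lemma prob_scale_event:
  assumes \<gamma>: "0 < \<gamma>" and c: "0 < c" and n: "n \<ge> 1"
    and I: "finite I" "n - 1 \<le> card I" "card I \<le> n"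
    and D: "c * sqrt n \<le> D" and big: "4 * \<alpha> n \<le> \<gamma> * c * sqrt n" "\<gamma> \<le> 1"
    and small: "exp (- c0 * (\<alpha> n / 2)\<^sup>2) \<le> 1 / D" "exp (- (\<alpha> n / (4 * h))\<^sup>2 / 4) \<le> 1 / D"
  defines "A2 \<equiv> 2 / (h * \<gamma> * sqrt (2 * c0)) + 3"
    and "A3 \<equiv> exp 3 * (2 * (1 + 1 / c)) * exp ((2 * op_const + 1)\<^sup>2 / 2)"
  shows "Pr (rmat I n) (scale_event \<gamma> c n I D - (op_bad I n))
    \<le> (A2 * A3) ^ n * (4 * K * sqrt n + 3) * (\<alpha> n / sqrt n) ^ n * D"
proof -
  \<comment> \<open>The multiplier \<theta> is at most 2 D, and the rounding error is below
    D.\<close>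
  define R where "R = 3 * D"
  define t where "t = \<alpha> n / D"
  \<comment> \<open>Then sqrt M t is exactly the distance 2 t magnified by \<open>op_const\<close>,
    plus the shift step t, both times sqrt n.\<close>
  define M where "M = (2 * op_const + 1)\<^sup>2 * real n"
  define P where "P = {p \<in> int_l1_ball n (sqrt n * R). L2_set (ivec p) {..<n} > 0 \<and>
     (\<forall>\<theta>. \<bar>\<theta>\<bar> \<le> c * sqrt n \<longrightarrow> (\<gamma> / 2 * \<theta>)\<^sup>2 \<le> int_dist_sq n \<theta> (nvec n p)) \<and>
     (\<forall>\<theta>. c * sqrt n \<le> \<bar>\<theta>\<bar> \<and> \<bar>\<theta>\<bar> \<le> D / 4 \<longrightarrow> (\<alpha> n / 2)\<^sup>2 \<le> int_dist_sq n \<theta> (nvec n p))}"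
  define \<kappa> where "\<kappa> = 2 * K * sqrt n + 1"
  define E where "E = {f. \<exists>p\<in>P. \<exists>k::int. \<bar>real_of_int k\<bar> \<le> \<kappa> \<and>
           L2_set (\<lambda>i. mv n f (nvec n p) i - t * real_of_int k) I \<le> sqrt M * t}"
  \<comment> \<open>Capped at 1, so that a product over n rows may be weakened to one over n - 1
    rows.\<close>
  define B where "B = min 1 (A2 * t)"
  have n0: "sqrt n > 0" using n by simp
  have csn: "c * sqrt n > 0" using c n0 by simp
  have D0: "D > 0" using D csn by linarith
  have \<alpha>1: "\<alpha> n \<ge> 1" using n by (simp add: \<alpha>_def ge_one_powr_ge_zero)
  have t: "t > 0" using \<alpha>1 D0 by (simp add: t_def)
  have op_const: "op_const \<ge> 0" using K by (simp add: op_const_def)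
  have A2: "A2 > 0" using h \<gamma> c0 by (simp add: A2_def add_pos_pos)
  have \<alpha>D: "4 * \<alpha> n \<le> \<gamma> * D"
    using big(1) mult_left_mono[OF D less_imp_le[OF \<gamma>]] by (simp add: mult.assoc)
  have "\<gamma> * D \<le> 1 * D" using big(2) D0 by (intro mult_right_mono) auto
  then have \<alpha>D': "\<alpha> n < D" using \<alpha>D \<alpha>1 by linarith
  have finb: "finite (int_l1_ball n (sqrt n * R))" by (rule finite_int_l1_ball[of 1]) simp
  have finP: "finite P" unfolding P_def using finb by simp
  have sub: "scale_event \<gamma> c n I D - (op_bad I n) \<subseteq> E"
  proof
    fix f assume "f \<in> scale_event \<gamma> c n I D - (op_bad I n)"
    then obtain x \<theta> where op: "op_good I n f" and x: "vnorm n x = 1" "low_ok \<gamma> c n x"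
      and \<theta>: "D \<le> \<theta>" "\<theta> \<le> 2 * D" "int_dist_sq n \<theta> x < (\<alpha> n)\<^sup>2"
      and below: "\<And>\<theta>'. c * sqrt n \<le> \<theta>' \<Longrightarrow> \<theta>' < D \<Longrightarrow> (\<alpha> n)\<^sup>2 \<le> int_dist_sq n \<theta>' x"
      and zero: "\<And>i. i \<in> I \<Longrightarrow> mv n f x i = 0" unfolding scale_event_def by blast
    have a: "0 \<le> \<alpha> n" "\<alpha> n < \<theta>" using \<alpha>1 \<alpha>D' \<theta>(1) by auto
    obtain p where p: "p \<in> {..<n} \<rightarrow>\<^sub>E UNIV" "L2_set (ivec p) {..<n} > 0" "L2_set (ivec p) {..<n}
        \<le> \<theta> + \<alpha> n"
      "L2_set (\<lambda>j. x j - nvec n p j) {..<n} \<le> 2 * \<alpha> n / \<theta>"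
      using integer_approximation[OF x(1) a less_imp_le[OF \<theta>(3)]] by blast
    have "2 * \<alpha> n / \<theta> \<le> 2 * \<alpha> n / D" using \<theta>(1) D0 \<alpha>1 by (intro divide_left_mono) auto
    then have d: "L2_set (\<lambda>j. x j - nvec n p j) {..<n} \<le> 2 * t" using p(4) by (simp add: t_def)
    have N: "\<theta> + \<alpha> n \<le> R" using \<theta>(2) \<alpha>D' by (simp add: R_def)
    have ball: "p \<in> int_l1_ball n (sqrt n * R)"
      by (rule int_l1_ballI[OF p(1) order_trans[OF p(3) N]])
    have lo: "(\<gamma> / 2 * \<theta>')\<^sup>2 \<le> int_dist_sq n \<theta>' (nvec n p)" if "\<bar>\<theta>'\<bar> \<le> c * sqrt n" for \<theta>'
    proof -
      have "(\<gamma> / 2 * \<bar>\<theta>'\<bar>)\<^sup>2 \<le> int_dist_sq n \<theta>' (nvec n p)"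
      proof (rule int_dist_sq_lower_transfer[OF _ _ d, where b = "\<gamma> * \<bar>\<theta>'\<bar>"])
        show "(\<gamma> * \<bar>\<theta>'\<bar>)\<^sup>2 \<le> int_dist_sq n \<theta>' x" using x(2) that
          by (simp add: low_ok_def power_mult_distrib)
        have "2 * t \<le> \<gamma> / 2" using \<alpha>D D0 by (simp add: t_def field_simps)
        then have "\<bar>\<theta>'\<bar> * (2 * t) \<le> \<bar>\<theta>'\<bar> * (\<gamma> / 2)" by (intro mult_left_mono) auto
        then show "\<gamma> / 2 * \<bar>\<theta>'\<bar> + \<bar>\<theta>'\<bar> * (2 * t) \<le> \<gamma> * \<bar>\<theta>'\<bar>" by (simp add: field_simps)
      qed (use \<gamma> in auto)
      then show ?thesis by (simp add: power_mult_distrib power_divide)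
    qed
    have hi: "(\<alpha> n / 2)\<^sup>2 \<le> int_dist_sq n \<theta>' (nvec n p)" if "c * sqrt n \<le> \<bar>\<theta>'\<bar>" "\<bar>\<theta>'\<bar>
        \<le> D / 4" for \<theta>'
    proof (rule int_dist_sq_lower_transfer[OF _ _ d, where b = "\<alpha> n"])
      have "(\<alpha> n)\<^sup>2 \<le> int_dist_sq n \<bar>\<theta>'\<bar> x" using that D0 by (intro below) auto
      then show "(\<alpha> n)\<^sup>2 \<le> int_dist_sq n \<theta>' x" by simp
      have "\<bar>\<theta>'\<bar> * (2 * t) \<le> D / 4 * (2 * t)" using that t by (intro mult_right_mono) auto
      also have "\<dots> = \<alpha> n / 2" using D0 by (simp add: t_def)
      finally show "\<alpha> n / 2 + \<bar>\<theta>'\<bar> * (2 * t) \<le> \<alpha> n" by simp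
    qed (use \<alpha>1 in auto)
    have pP: "p \<in> P" unfolding P_def using ball p(2) lo hi by simp
    have "L2_set (mv n f x) I \<le> 0" using zero by (simp add: L2_set_0')
    from shift_discretization[OF op d this t I(1,3)]
    obtain k :: int where k: "\<bar>real_of_int k\<bar> \<le> K * sqrt n * (2 * t) / t + 1"
      "L2_set (\<lambda>i. mv n f (nvec n p) i - t * real_of_int k) I
          \<le> 0 + op_const * sqrt n * (2 * t) + t * sqrt n" by blast
    have "0 + op_const * sqrt n * (2 * t) + t * sqrt n = sqrt M * t"
      using op_const by (simp add: M_def real_sqrt_mult algebra_simps)
    moreover have "K * sqrt n * (2 * t) / t + 1 = \<kappa>" using t by (simp add: \<kappa>_def)
    ultimately show "f \<in> E" unfolding E_def using k pP by auto
  qed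
  have QB: "Q n (nvec n p) (h / t) \<le> B" if "p \<in> P" for p
  proof -
    have ht: "h / t > 0" using h t by simp
    have "Q n (nvec n p) (h / t) \<le> 1 / (h / t * (\<gamma> / 2) * sqrt (2 * c0)) + exp (- c0
        * (\<alpha> n / 2)\<^sup>2) +
       sqrt 2 * exp (- (D / 4 / (h / t))\<^sup>2 / 4)"
      by (rule Q_le_main[OF ht, where ?T1.0 = "c * sqrt n"]) (use \<gamma> D0 that in \<open>auto simp: P_def\<close>)
    also have "1 / (h / t * (\<gamma> / 2) * sqrt (2 * c0)) = (2 / (h * \<gamma> * sqrt (2 * c0))) * t"
      using h t \<gamma> c0 by (simp add: field_simps)
    also have "D / 4 / (h / t) = \<alpha> n / (4 * h)" using D0 h \<alpha>1 by (simp add: t_def field_simps)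
    also have "sqrt 2 * exp (- (\<alpha> n / (4 * h))\<^sup>2 / 4) \<le> 2 * (1 / D)"
      using small(2) real_sqrt_le_mono[of 2 4] by (intro mult_mono) auto
    also note small(1)
    finally have "Q n (nvec n p) (h / t) \<le> 2 / (h * \<gamma> * sqrt (2 * c0)) * t + 3 * (1 / D)"
      by linarith
    \<comment> \<open>This uses \<alpha> n \<ge> 1 and turns all three terms into multiples of
      t.\<close>
    also have "1 / D \<le> t" using \<alpha>1 D0 by (simp add: t_def divide_right_mono)
    finally have "Q n (nvec n p) (h / t) \<le> A2 * t" by (simp add: A2_def algebra_simps)
    then show ?thesis using Q_le_1 by (simp add: B_def)
  qed
  have \<kappa>0: "\<kappa> \<ge> 0" using K by (simp add: \<kappa>_def)
  have "Pr (rmat I n) (scale_event \<gamma> c n I D - (op_bad I n)) \<le> Pr (rmat I n) E"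
    using sub by (intro measure_pmf.finite_measure_mono) auto
  also have "\<dots> \<le> card P * (2 * \<kappa> + 1) * (exp (M / 2) * B ^ card I)"
    unfolding E_def by (rule prob_net_union[OF finP I(1) t QB \<kappa>0])
  also have "\<dots> \<le> (exp 3 * (2 * (1 + 1 / c)) * (D / sqrt n)) ^ n * (2 * \<kappa> + 1) * (exp (M / 2)
      * (A2 ^ n * t ^ (n - 1)))"
  proof (intro mult_mono)
    define l where "l = sqrt n / D"
    have l: "l > 0" using n0 D0 by (simp add: l_def)
    have lc: "l \<le> 1 / c" using D D0 c by (simp add: l_def field_simps)
    have "real (card P) \<le> card (int_l1_ball n (sqrt n * R))"
      unfolding P_def using finb by (intro of_nat_mono card_mono) auto
    also have "\<dots> \<le> exp (l * (sqrt n * R)) * ((1 + exp (-l)) / (1 - exp (-l))) ^ n"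
      by (rule card_int_l1_ball[OF l])
    also have "\<dots> \<le> exp 3 ^ n * (2 * (1 + 1 / c) * (D / sqrt n)) ^ n"
    proof (intro mult_mono power_mono)
      have "l * (sqrt n * R) = 3 * real n" using D0 by (simp add: l_def R_def)
      then show "exp (l * (sqrt n * R)) \<le> exp 3 ^ n"
        by (simp add: exp_of_nat_mult[symmetric] mult.commute)
      have "(1 + exp (-l)) / (1 - exp (-l)) \<le> 2 * (1 + l) / l" by (rule net_factor_le[OF l])
      also have "\<dots> \<le> 2 * (1 + 1 / c) / l" using l lc by (intro divide_right_mono) auto
      also have "\<dots> = 2 * (1 + 1 / c) * (D / sqrt n)" using n0 D0 by (simp add: l_def)
      finally show "(1 + exp (-l)) / (1 - exp (-l)) \<le> 2 * (1 + 1 / c) * (D / sqrt n)" .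
    qed (use l in auto)
    also have "\<dots> = (exp 3 * (2 * (1 + 1 / c)) * (D / sqrt n)) ^ n"
      by (simp only: power_mult_distrib mult_ac)
    finally show "real (card P) \<le> (exp 3 * (2 * (1 + 1 / c)) * (D / sqrt n)) ^ n" .
    have "B ^ card I \<le> B ^ (n - 1)" using I A2 t by (intro power_decreasing) (auto simp: B_def)
    also have "\<dots> \<le> (A2 * t) ^ (n - 1)" using A2 t by (intro power_mono) (auto simp: B_def)
    also have "\<dots> = A2 ^ (n - 1) * t ^ (n - 1)" by (rule power_mult_distrib)
    also have "\<dots> \<le> A2 ^ n * t ^ (n - 1)"
    proof (intro mult_right_mono power_increasing)
      have "0 \<le> 2 / (h * \<gamma> * sqrt (2 * c0))" using h \<gamma> c0 by simp
      then show "1 \<le> A2" by (simp add: A2_def)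
    qed (use t in auto)
    finally show "B ^ card I \<le> A2 ^ n * t ^ (n - 1)" .
  qed (use c D0 \<kappa>0 A2 t in \<open>auto simp: B_def\<close>)
  also have "\<dots> = (A2 * A3) ^ n * (4 * K * sqrt n + 3) * ((D / sqrt n) ^ n * t ^ (n - 1))"
  proof -
    have "exp (M / 2) = exp ((2 * op_const + 1)\<^sup>2 / 2) ^ n"
      by (simp add: M_def exp_of_nat_mult[symmetric] mult.commute)
    moreover have "2 * \<kappa> + 1 = 4 * K * sqrt n + 3" by (simp add: \<kappa>_def)
    ultimately show ?thesis unfolding A3_def by (simp only: power_mult_distrib mult_ac)
  qed
  also have "(D / sqrt n) ^ n * t ^ (n - 1) = (\<alpha> n / sqrt n) ^ n * (D / \<alpha> n)"
  proof -
    have "t ^ (n - 1) = t ^ n / t" using n t by (simp add: power_diff)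
    then have "(D / sqrt n) ^ n * t ^ (n - 1) = (D / sqrt n * t) ^ n / t"
      by (simp only: power_mult_distrib times_divide_eq_right)
    also have "D / sqrt n * t = \<alpha> n / sqrt n" using D0 by (simp add: t_def)
    finally show ?thesis by (simp add: t_def)
  qed
  also have "(A2 * A3) ^ n * (4 * K * sqrt n + 3) * ((\<alpha> n / sqrt n) ^ n * (D / \<alpha> n)) \<le>
     (A2 * A3) ^ n * (4 * K * sqrt n + 3) * ((\<alpha> n / sqrt n) ^ n * D)"
  proof (intro mult_left_mono)
    have "D / \<alpha> n \<le> D / 1" using D0 \<alpha>1 by (intro divide_left_mono) auto
    then show "D / \<alpha> n \<le> D" by simp
  qed (use A2 c K \<alpha>1 in \<open>auto simp: A3_def\<close>)
  finally show ?thesis by (simp add: mult.assoc)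
qed

text \<open>A union over the dyadic scales between c sqrt n and \<open>Tmax \<kappa> n\<close>. Both
  their number, crudely at most \<open>Tmax \<kappa> n + 1\<close>, and the stray factor D are of
  size exp(\<kappa> n^(4/5)), negligible against exp(-n ln n / 10).\<close>

lemma high_structured:
  assumes \<gamma>: "0 < \<gamma>" "\<gamma> \<le> 1" and c: "0 < c"
  obtains \<kappa> where "0 < \<kappa>" "\<kappa> \<le> c0"
    "\<forall>\<^sub>F n in sequentially. \<forall>I. row_set n I \<longrightarrow>
      Pr (rmat I n) (high_event \<gamma> c \<kappa> n I) \<le> exp (- real n / 2)"
proof -
  \<comment> \<open>Bounds both remainders of the small ball estimate by exp(-\<kappa> (\<alpha>
    n)^2) \<le> 1 / D: c0 / 4 comes from the halved \<alpha>, and 1 / (64 h^2) from the Gaussian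
    tail beyond D / 4.\<close>
  define \<kappa> where "\<kappa> = min (c0 / 4) (1 / (64 * h\<^sup>2))"
  have \<kappa>: "\<kappa> > 0" "\<kappa> \<le> c0" using c0 h by (auto simp: \<kappa>_def)
  define A2 where "A2 = 2 / (h * \<gamma> * sqrt (2 * c0)) + 3"
  define A3 where "A3 = exp 3 * (2 * (1 + 1 / c)) * exp ((2 * op_const + 1)\<^sup>2 / 2)"
  have "A2 * A3 > 0" using h \<gamma> c0 c by (simp add: A2_def A3_def add_pos_pos)
  define a where "a = ln (A2 * A3)"
  have ea: "exp a = A2 * A3" using \<open>A2 * A3 > 0\<close> by (simp add: a_def)
  have a0: "a > 0"
  proof -
    have "0 \<le> 2 / (h * \<gamma> * sqrt (2 * c0))" using h \<gamma> c0 by simp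
    then have "A2 \<ge> 3" by (simp add: A2_def)
    moreover have "A3 \<ge> 1 * (2 * 1) * 1" unfolding A3_def using c by (intro mult_mono) auto
    ultimately have "3 * 2 \<le> A2 * A3" by (intro mult_mono) auto
    then show ?thesis unfolding a_def by simp
  qed
  have ev1: "\<forall>\<^sub>F n in sequentially. 4 * \<alpha> n \<le> \<gamma> * c * sqrt n"
    unfolding \<alpha>_def using \<gamma> c by real_asymp
  have ev2: "\<forall>\<^sub>F n in sequentially. 1 \<le> c * sqrt n" using c by real_asymp
  have ev3: "\<forall>\<^sub>F n in sequentially. exp (- real n) + (exp (\<kappa> * real n powr (4/5)) + 1) * (exp (a
      * real n) * (4 * K * sqrt n + 3) * exp (- (1/10) * real n * ln (real n)) * exp (\<kappa>
      * real n powr (4/5))) \<le> exp (- real n / 2)"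
  proof -
    have 1: "\<forall>\<^sub>F n in sequentially. exp (- real n) \<le> exp (- real n / 2) / 2" by real_asymp
    have "K > 0" using K by simp
    then have 2: "\<forall>\<^sub>F n in sequentially. (exp (\<kappa> * real n powr (4/5)) + 1) * (exp (a * real n) * (4
        * K * sqrt n + 3) * exp (- (1/10) * real n * ln (real n)) * exp (\<kappa> * real n powr (4/5)))
        \<le> exp (- real n / 2) / 2"
      using \<kappa>(1) a0 by real_asymp
    show ?thesis using 1 2 by eventually_elim simp
  qed
  show thesis
  proof (rule that[OF \<kappa>])
    show "\<forall>\<^sub>F n in sequentially. \<forall>I. row_set n I \<longrightarrow>
      Pr (rmat I n) (high_event \<gamma> c \<kappa> n I) \<le> exp (- real n / 2)"
      using ev1 ev2 ev3 eventually_ge_at_top[of 1]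
    proof eventually_elim
      case (elim n)
      have \<alpha>2: "(\<alpha> n)\<^sup>2 = real n powr (4/5)"
        using elim by (simp add: \<alpha>_def powr_power)
      have T: "Tmax \<kappa> n = exp (\<kappa> * real n powr (4/5))" by (simp add: Tmax_def \<alpha>2)
      define X where "X = exp (a * real n) * (4 * K * sqrt n + 3) * exp (- (1/10) * real n
          * ln (real n)) * Tmax \<kappa> n"
      have X0: "X \<ge> 0" using K by (simp add: X_def Tmax_def)
      show ?case
      proof (intro allI impI)
        fix I :: "nat set" assume I: "row_set n I"
        define Ls where "Ls = {l :: nat. c * sqrt n * 2 ^ l \<le> Tmax \<kappa> n}"
        have Ls: "Ls \<subseteq> {..nat \<lfloor>Tmax \<kappa> n\<rfloor>}"
        proof
          fix l assume l: "l \<in> Ls"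
          have "real l \<le> 2 ^ l" using less_exp[of l] of_nat_mono[of l "2 ^ l"]
            by (simp add: less_imp_le)
          also have "\<dots> \<le> c * sqrt n * 2 ^ l" using elim(2) by simp
          also have "\<dots> \<le> Tmax \<kappa> n" using l by (simp add: Ls_def)
          finally show "l \<in> {..nat \<lfloor>Tmax \<kappa> n\<rfloor>}" by (simp add: le_nat_floor)
        qed
        have finL: "finite Ls" using Ls finite_subset by blast
        have cardL: "card Ls \<le> Tmax \<kappa> n + 1"
        proof -
          have "card Ls \<le> card {..nat \<lfloor>Tmax \<kappa> n\<rfloor>}" using Ls by (intro card_mono) auto
          then have "real (card Ls) \<le> real (nat \<lfloor>Tmax \<kappa> n\<rfloor>) + 1" by simp
          also have "\<dots> \<le> Tmax \<kappa> n + 1" by (simp add: Tmax_def of_nat_floor)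
          finally show ?thesis .
        qed
        have each: "Pr (rmat I n) (scale_event \<gamma> c n I (c * sqrt n * 2 ^ l) - (op_bad I n)) \<le> X"
          if l: "l \<in> Ls" for l
        proof -
          define D where "D = c * sqrt n * 2 ^ l"
          have DT: "D \<le> Tmax \<kappa> n" using l by (simp add: Ls_def D_def)
          have "c * sqrt n * 1 \<le> D" unfolding D_def using elim(2) by (intro mult_left_mono) auto
          then have D: "c * sqrt n \<le> D" by simp
          then have D0: "D > 0" using elim(2) by linarith
          have "exp (- \<kappa> * (\<alpha> n)\<^sup>2) \<le> 1 / D"
          proof -
            have "1 / Tmax \<kappa> n \<le> 1 / D" using DT D0
              by (intro divide_left_mono) (auto simp: Tmax_def)
            then show ?thesis by (simp add: Tmax_def exp_minus field_simps)
          qed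
          moreover have "\<kappa> * (\<alpha> n)\<^sup>2 \<le> c0 / 4 * (\<alpha> n)\<^sup>2" "\<kappa> * (\<alpha> n)\<^sup>2 \<le> 1 / (64 * h\<^sup>2) * (\<alpha> n)\<^sup>2"
            by (intro mult_right_mono; simp add: \<kappa>_def)+
          then have "exp (- c0 * (\<alpha> n / 2)\<^sup>2) \<le> exp (- \<kappa> * (\<alpha> n)\<^sup>2)" "exp (- (\<alpha> n / (4 * h))\<^sup>2 / 4)
              \<le> exp (- \<kappa> * (\<alpha> n)\<^sup>2)"
            by (simp_all add: power_divide power_mult_distrib)
          ultimately have small: "exp (- c0 * (\<alpha> n / 2)\<^sup>2) \<le> 1 / D" "exp (- (\<alpha> n / (4 * h))\<^sup>2 / 4)
              \<le> 1 / D"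
            by linarith+
          have "Pr (rmat I n) (scale_event \<gamma> c n I D - (op_bad I n)) \<le>
             (A2 * A3) ^ n * (4 * K * sqrt n + 3) * (\<alpha> n / sqrt n) ^ n * D"
            unfolding A2_def A3_def by (rule prob_scale_event) (use \<gamma> c elim I D small in auto)
          also have "\<dots> \<le> (A2 * A3) ^ n * (4 * K * sqrt n + 3) * (\<alpha> n / sqrt n) ^ n * Tmax \<kappa> n"
            using DT K \<open>A2 * A3 > 0\<close> by (intro mult_left_mono) (auto simp: \<alpha>_def)
          also have "(A2 * A3) ^ n = exp (a * real n)" unfolding ea[symmetric]
            by (simp add: exp_of_nat_mult[symmetric] mult.commute)
          also have "(\<alpha> n / sqrt n) ^ n = exp (- (1/10) * real n * ln (real n))"
          proof -
            have "\<alpha> n / sqrt n = real n powr (2/5) / real n powr (1/2)" using elim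
              by (simp add: \<alpha>_def powr_half_sqrt)
            also have "\<dots> = real n powr (- (1/10))" by (simp add: powr_diff[symmetric])
            also have "\<dots> = exp (- (1/10) * ln (real n))" using elim by (simp add: powr_def)
            finally show ?thesis by (simp add: exp_of_nat_mult[symmetric] mult_ac)
          qed
          finally show ?thesis by (simp add: X_def D_def)
        qed
        have "(high_event \<gamma> c \<kappa> n I) \<subseteq>
           (op_bad I n) \<union> (\<Union>l\<in>Ls. scale_event \<gamma> c n I (c * sqrt n * 2 ^ l) - (op_bad I n))"
        proof
          fix f assume "f \<in> (high_event \<gamma> c \<kappa> n I)"
          then obtain x where x: "vnorm n x = 1" "low_ok \<gamma> c n x" "\<not> high_ok \<kappa> c n x" "\<forall>i\<in>I. mv n f
              x i = 0" by blast
          obtain \<theta>' where \<theta>': "c * sqrt n \<le> \<bar>\<theta>'\<bar>" "\<bar>\<theta>'\<bar> \<le> Tmax \<kappa> n" "int_dist_sq n \<bar>\<theta>'\<bar> x < (\<alpha> n)\<^sup>2"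
            using x(3) unfolding high_ok_def by force
          have "c * sqrt n > 0" using elim(2) by linarith
          from dyadic_scale[OF this \<theta>']
          obtain l \<theta> where l: "c * sqrt n * 2 ^ l \<le> \<theta>" "\<theta> \<le> 2 * (c * sqrt n * 2 ^ l)" "\<theta>
              \<le> Tmax \<kappa> n" "int_dist_sq n \<theta> x < (\<alpha> n)\<^sup>2"
             "\<And>\<theta>'. c * sqrt n \<le> \<theta>' \<Longrightarrow> \<theta>' < c * sqrt n * 2 ^ l \<Longrightarrow> (\<alpha> n)\<^sup>2 \<le> int_dist_sq n \<theta>' x"
               by blast
          have "l \<in> Ls" using l(1,3) by (simp add: Ls_def)
          moreover have "f \<in> scale_event \<gamma> c n I (c * sqrt n * 2 ^ l)"
            unfolding scale_event_def mem_Collect_eq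
              by (intro exI[of _ x] exI[of _ \<theta>]) (use x l in simp)
          ultimately show "f \<in> (op_bad I n) \<union> (\<Union>l\<in>Ls. scale_event \<gamma> c n I (c * sqrt n * 2 ^ l)
              - (op_bad I n))"
            by blast
        qed
        then have "Pr (rmat I n) (high_event \<gamma> c \<kappa> n I) \<le>
           Pr (rmat I n) ((op_bad I n) \<union> (\<Union>l\<in>Ls. scale_event \<gamma> c n I (c * sqrt n * 2 ^ l)
               - (op_bad I n)))"
          by (intro measure_pmf.finite_measure_mono) simp_all
        also have "\<dots> \<le> Pr (rmat I n) (op_bad I n) +
           Pr (rmat I n) (\<Union>l\<in>Ls. scale_event \<gamma> c n I (c * sqrt n * 2 ^ l) - (op_bad I n))"
          by (rule measure_Un_le) auto
        also have "Pr (rmat I n) (op_bad I n) \<le> exp (- real n)"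
          using I elim by (intro prob_op_bad) auto
        also have "Pr (rmat I n) (\<Union>l\<in>Ls. scale_event \<gamma> c n I (c * sqrt n * 2 ^ l) - (op_bad I n)) \<le>
           (\<Sum>l\<in>Ls. Pr (rmat I n) (scale_event \<gamma> c n I (c * sqrt n * 2 ^ l) - (op_bad I n)))"
          using finL by (intro measure_pmf.finite_measure_subadditive_finite) auto
        also have "\<dots> \<le> (\<Sum>l\<in>Ls. X)" by (intro sum_mono each)
        also have "\<dots> = card Ls * X" by simp
        also have "\<dots> \<le> (Tmax \<kappa> n + 1) * X" using cardL X0 by (intro mult_right_mono)
        also have "exp (- real n) + (Tmax \<kappa> n + 1) * X \<le> exp (- real n / 2)"
          using elim(3) unfolding X_def T .
        finally show "Pr (rmat I n) (high_event \<gamma> c \<kappa> n I) \<le> exp (- real n / 2)"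
          by simp
      qed
    qed
  qed
qed

end

section \<open>The smallest singular value\<close>

abbreviation small_image :: "nat \<Rightarrow> real \<Rightarrow> (nat \<times> nat \<Rightarrow> real) set" where
  "small_image n s \<equiv> {f. \<exists>x. vnorm n x = 1 \<and> L2_set (mv n f x) {..<n} \<le> s}"

text \<open>The transposed matrix with row j replaced by 0 is singular, and a kernel vector is
  orthogonal to all the other columns.\<close>

lemma exists_unit_normal:
  fixes g :: "nat \<times> nat \<Rightarrow> real"
  assumes "j < n"
  shows "\<exists>u. vnorm n u = 1 \<and> (\<forall>k<n. k \<noteq> j \<longrightarrow> (\<Sum>i<n. g (i, k) * u i) = 0)"
proof -
  define M where "M = Matrix.mat n n (\<lambda>(k, i). if k = j then 0 else g (i, k))"
  have M: "M \<in> carrier_mat n n" by (simp add: M_def)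
  have "Determinant.det M = 0"
    unfolding Determinant.det_def'[OF M]
  proof (intro sum.neutral ballI)
    fix p assume "p \<in> {p. p permutes {0..<n}}"
    then have "p j < n" using permutes_in_image[of p "{0..<n}" j] assms by auto
    then have "M $$ (j, p j) = 0" using assms by (simp add: M_def)
    then have "(\<Prod>i = 0..<n. M $$ (i, p i)) = 0" using assms by (intro prod_zero) auto
    then show "signof p * (\<Prod>i = 0..<n. M $$ (i, p i)) = 0" by simp
  qed
  then obtain v where v: "v \<in> carrier_vec n" "v \<noteq> 0\<^sub>v n" "M *\<^sub>v v = 0\<^sub>v n"
    using det_0_iff_vec_prod_zero[OF M] by blast
  define N where "N = L2_set (\<lambda>i. v $ i) {..<n}"
  have "N \<noteq> 0"
  proof
    assume "N = 0"
    then have "\<forall>i<n. v $ i = 0" by (simp add: N_def L2_set_eq_0_iff)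
    then have "v = 0\<^sub>v n" using v(1) by (intro eq_vecI) auto
    with v(2) show False by simp
  qed
  then have N: "N > 0" using L2_set_nonneg[of "\<lambda>i. v $ i" "{..<n}"] unfolding N_def by linarith
  show ?thesis
  proof (intro exI[of _ "\<lambda>i. (1 / N) * v $ i"] conjI allI impI)
    show "L2_set (\<lambda>i. (1 / N) * v $ i) {..<n} = 1" using N
      by (simp only: L2_set_scale) (simp add: N_def)
    fix k assume k: "k < n" "k \<noteq> j"
    have "(M *\<^sub>v v) $ k = (\<Sum>i<n. g (i, k) * v $ i)"
      using v(1) k M by (auto simp: scalar_prod_def M_def lessThan_atLeast0 intro!: sum.cong)
    then have "(\<Sum>i<n. g (i, k) * v $ i) = 0" using v(3) k by simp
    moreover have "(\<Sum>i<n. g (i, k) * ((1 / N) * v $ i)) = (1 / N) * (\<Sum>i<n. g (i, k) * v $ i)"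
      by (simp add: sum_distrib_left mult_ac)
    ultimately show "(\<Sum>i<n. g (i, k) * ((1 / N) * v $ i)) = 0" by simp
  qed
qed

text \<open>\<open>low_ok\<close> at the end of its range, \<theta> = c sqrt n. The small
  coordinates together supply at most a quarter of (\<gamma> \<theta>)^2 and every other one
  supplies at most 1/4, so a positive proportion of the coordinates has to be large.\<close>

lemma low_ok_spread:
  assumes x: "vnorm n x = 1" and low: "low_ok \<gamma> c n x" and \<gamma>: "\<gamma> > 0" and c: "c > 0" and n: "n \<ge> 1"
  shows "3 * (\<gamma> * c)\<^sup>2 * real n \<le> card {j. j < n \<and> \<gamma> / (2 * sqrt n) \<le> \<bar>x j\<bar>}"
proof -
  define J where "J = {j. j < n \<and> \<gamma> / (2 * sqrt n) \<le> \<bar>x j\<bar>}"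
  define \<theta> where "\<theta> = c * sqrt n"
  have J: "J \<subseteq> {..<n}" "finite J" by (auto simp: J_def)
  have \<theta>2: "\<theta>\<^sup>2 = c\<^sup>2 * real n" by (simp add: \<theta>_def power_mult_distrib)
  have pt: "(rdist (\<theta> * x j))\<^sup>2 \<le> (if j \<in> J then 1/4 else \<theta>\<^sup>2 * (\<gamma>\<^sup>2 / (4
      * real n)))" if "j < n" for j
  proof (cases "j \<in> J")
    case True
    have "(rdist (\<theta> * x j))\<^sup>2 \<le> (1/2)\<^sup>2" using rdist_le_half by (intro power_mono) auto
    then show ?thesis using True by (simp add: power2_eq_square)
  next
    case False
    have "(rdist (\<theta> * x j))\<^sup>2 \<le> \<bar>\<theta> * x j\<bar>\<^sup>2" using rdist_le_abs by (intro power_mono) auto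
    also have "\<dots> = \<theta>\<^sup>2 * \<bar>x j\<bar>\<^sup>2" by (simp add: power_mult_distrib)
    also have "\<dots> \<le> \<theta>\<^sup>2 * (\<gamma> / (2 * sqrt n))\<^sup>2"
      using False that \<gamma> by (intro mult_left_mono power_mono) (auto simp: J_def)
    also have "(\<gamma> / (2 * sqrt n))\<^sup>2 = \<gamma>\<^sup>2 / (4 * real n)"
      by (simp add: power_divide power_mult_distrib)
    finally show ?thesis using False by simp
  qed
  have "\<bar>\<theta>\<bar> \<le> c * sqrt n" using c by (simp add: \<theta>_def)
  then have "(\<gamma> * \<theta>)\<^sup>2 \<le> int_dist_sq n \<theta> x" using low by (simp add: low_ok_def)
  also have "\<dots> \<le> (\<Sum>j<n. if j \<in> J then 1/4 else \<theta>\<^sup>2 * (\<gamma>\<^sup>2 / (4 * real n)))"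
    unfolding int_dist_sq_def by (intro sum_mono pt) auto
  also have "\<dots> \<le> (\<Sum>j<n. (if j \<in> J then 1/4 else 0) + \<theta>\<^sup>2 * (\<gamma>\<^sup>2 / (4 * real n)))"
    by (intro sum_mono) auto
  also have "\<dots> = card J / 4 + real n * (\<theta>\<^sup>2 * (\<gamma>\<^sup>2 / (4 * real n)))"
    using J by (simp add: sum.distrib sum.If_cases Int_absorb1)
  also have "real n * (\<theta>\<^sup>2 * (\<gamma>\<^sup>2 / (4 * real n))) = c\<^sup>2 * real n * \<gamma>\<^sup>2 / 4" using n
    by (simp add: \<theta>2)
  finally have "\<gamma>\<^sup>2 * (c\<^sup>2 * real n) \<le> card J / 4 + c\<^sup>2 * real n * \<gamma>\<^sup>2 / 4"
    by (simp add: power_mult_distrib \<theta>2)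
  then show ?thesis unfolding J_def[symmetric] by (simp add: power_mult_distrib algebra_simps)
qed

context discrete_law
begin

text \<open>Radii below \<open>t0\<close>, which is \<open>Tmax\<close> to the power -1/2, are
  raised to \<open>t0\<close>. This costs only C t0, and it keeps \<open>Tmax\<close> times the
  radius large, so that the Gaussian tail beyond \<open>Tmax\<close> is negligible. Passing from
  n^(4/5) to n^(3/4) absorbs the constants.\<close>

lemma good_small_ball:
  assumes \<gamma>: "\<gamma> > 0" and c: "c > 0" and \<kappa>: "\<kappa> > 0" "\<kappa> \<le> c0"
  obtains C where "C > 0" "\<forall>\<^sub>F n in sequentially. \<forall>x t. low_ok \<gamma> c n x \<and> high_ok \<kappa> c n x \<and> 0 \<le> t \<longrightarrow>
    Pr (rvec n) {X. \<bar>\<Sum>j<n. X j * x j\<bar> \<le> t} \<le> C * t + exp (- (real n powr (3/4)))"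
proof -
  define C where "C = exp (1/2) * (1 / (h * \<gamma> * sqrt (2 * c0)))"
  have C: "C > 0" using h \<gamma> c0 by (simp add: C_def)
  have ev: "\<forall>\<^sub>F n in sequentially. C * exp (- \<kappa> * real n powr (4/5) / 2) + exp (1/2) * (exp (- \<kappa>
      * real n powr (4/5)) +
     sqrt 2 * exp (- (exp (\<kappa> * real n powr (4/5) / 2) / h)\<^sup>2 / 4)) \<le> exp (- (real n powr (3/4)))"
    using C \<kappa>(1) h by real_asymp
  show thesis
  proof (rule that[OF C])
    show "\<forall>\<^sub>F n in sequentially. \<forall>x t. low_ok \<gamma> c n x \<and> high_ok \<kappa> c n x \<and> 0 \<le> t \<longrightarrow>
    Pr (rvec n) {X. \<bar>\<Sum>j<n. X j * x j\<bar> \<le> t} \<le> C * t + exp (- (real n powr (3/4)))"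
      using ev eventually_ge_at_top[of 1]
    proof eventually_elim
      case (elim n)
      have \<alpha>2: "(\<alpha> n)\<^sup>2 = real n powr (4/5)" using elim by (simp add: \<alpha>_def powr_power)
      show ?case
      proof (intro allI impI, elim conjE)
        fix x t assume x: "low_ok \<gamma> c n x" "high_ok \<kappa> c n x" and t: "0 \<le> (t::real)"
        define T where "T = Tmax \<kappa> n"
        define t0 where "t0 = exp (- \<kappa> * real n powr (4/5) / 2)"
        define s where "s = max t t0"
        have s: "s > 0" "t \<le> s" "t0 \<le> s" "s \<le> t + t0" using t
          by (auto simp: s_def t0_def less_max_iff_disj)
        have hs: "h / s > 0" using h s by simp
        have T0: "T > 0" by (simp add: T_def Tmax_def)
        have "Pr (rvec n) {X. \<bar>\<Sum>j<n. X j * x j\<bar> \<le> t} \<le> Pr (rvec n) {X. \<bar>(\<Sum>j<n. X j * x j) - 0\<bar> \<le> s}"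
          using s by (intro measure_pmf.finite_measure_mono) auto
        also have "\<dots> \<le> exp (1/2) * Q n x (h / s)" by (rule prob_dot_small[OF s(1)])
        also have "Q n x (h / s) \<le> 1 / (h / s * \<gamma> * sqrt (2 * c0)) + exp (- c0 * (\<alpha> n)\<^sup>2) + sqrt 2
            * exp (- (T / (h / s))\<^sup>2 / 4)"
          by (rule Q_le_main[OF hs \<gamma>, where ?T1.0
              = "c * sqrt n"]) (use x T0 in \<open>auto simp: low_ok_def high_ok_def T_def\<close>)
        also have "1 / (h / s * \<gamma> * sqrt (2 * c0)) = 1 / (h * \<gamma> * sqrt (2 * c0)) * s" by simp
        also have "exp (- c0 * (\<alpha> n)\<^sup>2) \<le> exp (- \<kappa> * (\<alpha> n)\<^sup>2)" using \<kappa>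
          by (simp add: mult_right_mono)
        also have "exp (- (T / (h / s))\<^sup>2 / 4)
            \<le> exp (- (exp (\<kappa> * real n powr (4/5) / 2) / h)\<^sup>2 / 4)"
        proof -
          have "T * t0 = exp (\<kappa> * real n powr (4/5) / 2)"
            by (simp add: T_def Tmax_def t0_def \<alpha>2 exp_add[symmetric])
          moreover have "T * t0 / h \<le> T * s / h" using s T0 h
            by (intro divide_right_mono mult_left_mono) auto
          ultimately have "exp (\<kappa> * real n powr (4/5) / 2) / h \<le> T / (h / s)" by simp
          then have "(exp (\<kappa> * real n powr (4/5) / 2) / h)\<^sup>2 \<le> (T / (h / s))\<^sup>2" using h
            by (intro power_mono) auto
          then show ?thesis by simp
        qed
        finally have "Pr (rvec n) {X. \<bar>\<Sum>j<n. X j * x j\<bar> \<le> t}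
            \<le> exp (1/2) * (1 / (h * \<gamma> * sqrt (2 * c0)) * s +
           exp (- \<kappa> * (\<alpha> n)\<^sup>2) + sqrt 2 * exp (- (exp (\<kappa> * real n powr (4/5) / 2) / h)\<^sup>2 / 4))"
             by simp
        also have "\<dots> = C * s + exp (1/2) * (exp (- \<kappa> * real n powr (4/5)) + sqrt 2 * exp (- (exp (\<kappa>
            * real n powr (4/5) / 2) / h)\<^sup>2 / 4))"
          unfolding C_def \<alpha>2 by (simp only: distrib_left mult.assoc add.assoc)
        also have "C * s \<le> C * (t + t0)" using s C by (intro mult_left_mono) auto
        finally show "Pr (rvec n) {X. \<bar>\<Sum>j<n. X j * x j\<bar> \<le> t} \<le> C * t + exp (- (real n powr (3/4)))"
          using elim(1) unfolding t0_def by (simp add: distrib_left)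
      qed
    qed
  qed
qed

text \<open>Column j has distance at most t from the span of the others: that distance is the
  supremum of these inner products. Quantifying over all unit normals avoids choosing one.\<close>

definition col_event :: "nat \<Rightarrow> real \<Rightarrow> nat \<Rightarrow> (nat \<times> nat \<Rightarrow> real) set" where
  "col_event n t j = {f. \<forall>u. vnorm n u = 1 \<and> (\<forall>k<n. k \<noteq> j \<longrightarrow> (\<Sum>i<n. f (i, k) * u i) = 0) \<longrightarrow>
     \<bar>\<Sum>i<n. f (i, j) * u i\<bar> \<le> t}"

text \<open>A normal of the other columns is a function of them alone, hence independent of column
  j. Either it violates G, which after transposition is an event about n - 1 rows, or the small ball
  bound applies to column j.\<close>

lemma prob_col_event:
  assumes j: "j < n" and
    bad: "Pr (rmat ({..<n} - {j}) n) {f. \<exists>u. vnorm n u = 1 \<and> \<not> G u \<and> (\<forall>k\<in>{..<n} - {j}. mv n f u k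
        = 0)} \<le> p"
    and good: "\<And>u. vnorm n u = 1 \<Longrightarrow> G u \<Longrightarrow> Pr (rvec n) {X. \<bar>\<Sum>i<n. X i * u i\<bar> \<le> t} \<le> r"
    and r: "0 \<le> r"
  shows "Pr (sqmat n) (col_event n t j) \<le> p + r"
proof -
  define J where "J = {..<n} - {j}"
  define u where "u g = (SOME u. vnorm n u = 1 \<and> (\<forall>k<n. k \<noteq> j \<longrightarrow> (\<Sum>i<n. g (i, k) * u i)
      = 0))" for g :: "nat \<times> nat \<Rightarrow> real"
  have u: "L2_set (u g) {..<n} = 1 \<and> (\<forall>k<n. k \<noteq> j \<longrightarrow> (\<Sum>i<n. g (i, k) * u g i) = 0)" for g
    unfolding u_def
    by (rule someI_ex[OF exists_unit_normal[OF j]])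
  define PB where "PB = Pi_pmf ({..<n} \<times> J) 0 (\<lambda>_. \<xi>)"
  define PA where "PA = Pi_pmf ({..<n} \<times> {j}) 0 (\<lambda>_. \<xi>)"
  define bd where "bd = {g. \<exists>u. vnorm n u = 1 \<and> \<not> G u \<and> (\<forall>k\<in>J. (\<Sum>i<n. g (i, k) * u i) = 0)}"
  have colA: "rvec n = map_pmf (\<lambda>g. g \<circ> (\<lambda>i. (i, j))) PA"
    unfolding PA_def by (rule Pi_pmf_bij_betw) (auto simp: bij_betw_def inj_on_def)
  have swp: "rmat J n = map_pmf (\<lambda>g. g \<circ> prod.swap) PB"
    unfolding PB_def by (rule Pi_pmf_bij_betw) (auto simp: bij_betw_def J_def product_swap)
  have pbd: "Pr PB bd \<le> p"
  proof -
    have "Pr PB bd = Pr (rmat J n) {f. \<exists>u. vnorm n u = 1 \<and> \<not> G u \<and> (\<forall>k\<in>J. mv n f u k = 0)}"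
      unfolding swp by (simp add: bd_def mv_def vimage_def)
    then show ?thesis using bad by (simp add: J_def)
  qed
  have finA: "finite (set_pmf PA)" and finB: "finite (set_pmf PB)" using fin
    by (auto simp: PA_def PB_def J_def)
  have un: "sqmat n = Pi_pmf ({..<n} \<times> J \<union> {..<n} \<times> {j}) 0 (\<lambda>_. \<xi>)"
    using j by (intro arg_cong[of _ _ "\<lambda>A. Pi_pmf A 0 (\<lambda>_. \<xi>)"]) (auto simp: J_def)
  have inner: "Mean PA (\<lambda>a. indicat_real (col_event n t j) (\<lambda>z. if z \<in> {..<n} \<times> J then b z else a
      z)) \<le> indicat_real bd b + r"
    for b
  proof -
    have ub: "L2_set (u b) {..<n} = 1" "\<And>k. k < n \<Longrightarrow> k \<noteq> j \<Longrightarrow> (\<Sum>i<n. b (i, k) * u b i) = 0" using u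
      by auto
    have "Mean PA (\<lambda>a. indicat_real (col_event n t j) (\<lambda>z. if z \<in> {..<n} \<times> J then b z else a z)) \<le>
       Mean PA (\<lambda>a. indicat_real {X. \<bar>\<Sum>i<n. X i * u b i\<bar> \<le> t} (a \<circ> (\<lambda>i. (i, j))))"
    proof (intro integral_mono integrable_measure_pmf_finite finA)
      fix a
      show "indicat_real (col_event n t j) (\<lambda>z. if z \<in> {..<n} \<times> J then b z else a z)
          \<le> indicat_real {X. \<bar>\<Sum>i<n. X i * u b i\<bar> \<le> t} (a \<circ> (\<lambda>i. (i, j)))"
      proof (cases "(\<lambda>z. if z \<in> {..<n} \<times> J then b z else a z) \<in> col_event n t j")
        case True
        have "\<forall>k<n. k \<noteq> j \<longrightarrow> (\<Sum>i<n. (if (i, k) \<in> {..<n} \<times> J then b (i, k) else a (i, k)) * u b i)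
            = 0"
        proof (intro allI impI)
          fix k assume k: "k < n" "k \<noteq> j"
          then have "(\<Sum>i<n. (if (i, k) \<in> {..<n} \<times> J then b (i, k) else a (i, k)) * u b i)
              = (\<Sum>i<n. b (i, k) * u b i)"
            by (intro sum.cong) (auto simp: J_def)
          then show "(\<Sum>i<n. (if (i, k) \<in> {..<n} \<times> J then b (i, k) else a (i, k)) * u b i) = 0"
            using ub(2)[OF k] by simp
        qed
        then have "\<bar>\<Sum>i<n. (if (i, j) \<in> {..<n} \<times> J then b (i, j) else a (i, j)) * u b i\<bar> \<le> t"
          using True ub(1) unfolding col_event_def by blast
        then show ?thesis by (simp add: J_def)
      qed simp
    qed
    also have "\<dots> = Pr (rvec n) {X. \<bar>\<Sum>i<n. X i * u b i\<bar> \<le> t}"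
    proof -
      have "Pr (rvec n) {X. \<bar>\<Sum>i<n. X i * u b i\<bar> \<le> t}
          = Mean (rvec n) (indicat_real {X. \<bar>\<Sum>i<n. X i * u b i\<bar> \<le> t})"
        by simp
      also have "\<dots> = Mean PA (\<lambda>a. indicat_real {X. \<bar>\<Sum>i<n. X i * u b i\<bar> \<le> t} (a \<circ> (\<lambda>i. (i, j))))"
        unfolding colA by (rule integral_map_pmf)
      finally show ?thesis by simp
    qed
    also have "\<dots> \<le> indicat_real bd b + r"
    proof (cases "G (u b)")
      case True
      have "0 \<le> indicat_real bd b" by simp
      with good[OF ub(1) True] show ?thesis by linarith
    next
      case False
      then have "b \<in> bd" unfolding bd_def using ub by (auto simp: J_def)
      moreover have "Pr (rvec n) {X. \<bar>\<Sum>i<n. X i * u b i\<bar> \<le> t} \<le> 1" by simp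
      ultimately show ?thesis using r by (simp add: add_increasing2)
    qed
    finally show ?thesis .
  qed
  have "Pr (sqmat n) (col_event n t j) = Mean (sqmat n) (indicat_real (col_event n t j))" by simp
  also have "\<dots> = Mean PB (\<lambda>b. Mean PA (\<lambda>a. indicat_real (col_event n t j) (\<lambda>z. if z \<in> {..<n} \<times> J
      then b z else a z)))"
    unfolding un PA_def PB_def by (rule expectation_Pi_pmf_union) (use fin in \<open>auto simp: J_def\<close>)
  also have "\<dots> \<le> Mean PB (\<lambda>b. indicat_real bd b + r)"
    by (intro integral_mono integrable_measure_pmf_finite finB inner)
  also have "\<dots> = Pr PB bd + r"
    by (subst Bochner_Integration.integral_add) (auto intro!: integrable_measure_pmf_finite finB)
  finally show ?thesis using pbd by simp
qed

text \<open>Invertibility through distances: if |f x| \<le> s and u is a unit normal of the columns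
  other than j, then |x j| times the inner product of column j with u is at most s in absolute
  value. At least c5 n coordinates of x have size \<gamma> / (2 sqrt n), so that many column events
  hold at once, and averaging over j avoids a factor n.\<close>

lemma smallest_singular_value:
  obtains C where "C > 0" "\<forall>\<^sub>F n in sequentially. \<forall>s\<ge>0.
    Pr (sqmat n) (small_image n s) \<le> C * sqrt n * s + exp (- (real n powr (7/10)))"
proof -
  obtain \<gamma> c c2 c3 where low: "0 < \<gamma>" "\<gamma> \<le> 1/4" "0 < c" "0 < c2" "0 < c3"
    "\<forall>\<^sub>F n in sequentially. \<forall>I. row_set n I \<longrightarrow>
      Pr (rmat I n) (low_event \<gamma> c n I c2) \<le> exp (- c3 * real n)"
    by (rule low_structured)
  have \<gamma>1: "\<gamma> \<le> 1" using low(2) by simp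
  obtain \<kappa> where high: "0 < \<kappa>" "\<kappa> \<le> c0" "\<forall>\<^sub>F n in sequentially. \<forall>I. row_set n I \<longrightarrow>
      Pr (rmat I n) (high_event \<gamma> c \<kappa> n I) \<le> exp (- real n / 2)"
    by (rule high_structured[OF low(1) \<gamma>1 low(3)])
  obtain C0 where C0: "C0 > 0" "\<forall>\<^sub>F n in sequentially. \<forall>x t. low_ok \<gamma> c n x \<and> high_ok \<kappa> c n x \<and> 0
      \<le> t \<longrightarrow>
    Pr (rvec n) {X. \<bar>\<Sum>j<n. X j * x j\<bar> \<le> t} \<le> C0 * t + exp (- (real n powr (3/4)))"
    by (rule good_small_ball[OF low(1,3) high(1,2)])
  define c5 where "c5 = 3 * (\<gamma> * c)\<^sup>2"
  have c5: "c5 > 0" using low by (simp add: c5_def)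
  define C where "C = max (1 / c2) (C0 * 2 / (\<gamma> * c5))"
  have C: "C > 0" "1 / c2 \<le> C" "C0 * 2 / (\<gamma> * c5) \<le> C" using low(4)
    by (auto simp: C_def less_max_iff_disj)
  have ev: "\<forall>\<^sub>F n in sequentially. exp (- c3 * real n) + (1 / c5) * (exp (- c3 * real n)
      + exp (- real n / 2) + exp (- (real n powr (3/4)))) \<le> exp (- (real n powr (7/10)))"
  proof -
    \<comment> \<open>Shares the target among one term of weight 1 and three terms of weight 1 /
      c5.\<close>
    define w where "w = 1 / (1 + 3 / c5)"
    have "1 + 3 / c5 > 0" using c5 by (simp add: add_pos_pos)
    then have w: "w > 0" "w * (1 + 3 / c5) = 1" by (simp_all add: w_def)
    have "\<forall>\<^sub>F n in sequentially. exp (- c3 * real n) \<le> w * exp (- (real n powr (7/10)))"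
      using low(5) w(1) by real_asymp
    moreover have "\<forall>\<^sub>F n in sequentially. exp (- real n / 2) \<le> w * exp (- (real n powr (7/10)))"
      using w(1) by real_asymp
    moreover have "\<forall>\<^sub>F n in sequentially. exp (- (real n powr (3/4)))
        \<le> w * exp (- (real n powr (7/10)))" using w(1) by real_asymp
    ultimately show ?thesis
    proof eventually_elim
      case (elim n)
      have "exp (- c3 * real n) + (1 / c5) * (exp (- c3 * real n) + exp (- real n / 2)
          + exp (- (real n powr (3/4)))) \<le>
        w * exp (- (real n powr (7/10))) + (1 / c5) * (w * exp (- (real n powr (7/10))) + w
            * exp (- (real n powr (7/10))) + w * exp (- (real n powr (7/10))))"
        using c5 elim by (intro add_mono mult_left_mono) auto
      also have "\<dots> = w * (1 + 3 / c5) * exp (- (real n powr (7/10)))" by (simp add: algebra_simps)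
      finally show ?case using w by simp
    qed
  qed
  show thesis
  proof (rule that[OF C(1)])
    show "\<forall>\<^sub>F n in sequentially. \<forall>s\<ge>0.
    Pr (sqmat n) (small_image n s) \<le> C * sqrt n * s + exp (- (real n powr (7/10)))"
      using low(6) high(3) C0(2) ev eventually_ge_at_top[of 1]
    proof eventually_elim
      case (elim n)
      have n0: "sqrt n > 0" using elim by simp
      show ?case
      proof (intro allI impI)
        fix s :: real assume s: "s \<ge> 0"
        define A where "A = (small_image n s)"
        show "Pr (sqmat n) A \<le> C * sqrt n * s + exp (- (real n powr (7/10)))"
        \<comment> \<open>For larger s the claimed bound is at least 1, because C \<ge> 1 / c2;
          otherwise x itself falls under the low event unless it is \<open>low_ok\<close>.\<close>
        proof (cases "s \<le> c2 * sqrt n")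
          case False
          have "1 \<le> (1 / c2) * sqrt n * (c2 * sqrt n)" using low(4) elim by simp
          also have "\<dots> \<le> C * sqrt n * s" using C False low(4) by (intro mult_mono) auto
          finally have "1 \<le> C * sqrt n * s" .
          moreover have "Pr (sqmat n) A \<le> 1" by simp
          moreover have "0 \<le> exp (- (real n powr (7/10)))" by simp
          ultimately show ?thesis by linarith
        next
          case True
          define t where "t = 2 * sqrt n * s / \<gamma>"
          have t: "t \<ge> 0" using s low by (simp add: t_def)
          define LB where "LB = (low_event \<gamma> c n {..<n} c2)"
          define r where "r = exp (- c3 * real n) + exp (- real n / 2) + (C0 * t
              + exp (- (real n powr (3/4))))"
          have pLB: "Pr (sqmat n) LB \<le> exp (- c3 * real n)"
            unfolding LB_def using elim(1) by simp
          have pcol: "Pr (sqmat n) (col_event n t j) \<le> r" if j: "j < n" for j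
            unfolding r_def
          proof (rule prob_col_event[OF j, where G = "\<lambda>u. low_ok \<gamma> c n u \<and> high_ok \<kappa> c n u"])
            let ?I = "{..<n} - {j}"
            have I: "row_set n ?I" using j by simp
            have "Pr (rmat ?I n) {f. \<exists>u. vnorm n u = 1 \<and> \<not> (low_ok \<gamma> c n u \<and> high_ok \<kappa> c n u)
                \<and> (\<forall>k\<in>?I. mv n f u k = 0)} \<le>
              Pr (rmat ?I n) ((low_event \<gamma> c n ?I c2) \<union>
              (high_event \<gamma> c \<kappa> n ?I))"
            proof (intro measure_pmf.finite_measure_mono subsetI, goal_cases)
              case (1 f)
              then obtain u where u: "vnorm n u = 1" "\<not> (low_ok \<gamma> c n u
                  \<and> high_ok \<kappa> c n u)" "\<forall>k\<in>?I. mv n f u k = 0" by blast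
              have "L2_set (mv n f u) ?I = 0" using u(3) by (rule L2_set_0')
              then have "L2_set (mv n f u) ?I \<le> c2 * sqrt n" using low(4) by simp
              with u show ?case by blast
            qed simp
            also have "\<dots> \<le> Pr (rmat ?I n) (low_event \<gamma> c n ?I c2) +
              Pr (rmat ?I n) (high_event \<gamma> c \<kappa> n ?I)"
              by (rule measure_Un_le) auto
            also have "\<dots> \<le> exp (- c3 * real n) + exp (- real n / 2)"
              by (intro add_mono elim(1)[rule_format] elim(2)[rule_format] I)
            finally show "Pr (rmat ?I n) {f. \<exists>u. vnorm n u = 1 \<and> \<not> (low_ok \<gamma> c n u
                \<and> high_ok \<kappa> c n u) \<and> (\<forall>k\<in>?I. mv n f u k = 0)} \<le>
               exp (- c3 * real n) + exp (- real n / 2)" .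
            show "0 \<le> C0 * t + exp (- (real n powr (3/4)))" using C0(1) t by simp
            show "Pr (rvec n) {X. \<bar>\<Sum>i<n. X i * u i\<bar> \<le> t} \<le> C0 * t + exp (- (real n powr (3/4)))"
              if "vnorm n u = 1" "low_ok \<gamma> c n u \<and> high_ok \<kappa> c n u" for u
              by (rule elim(3)[rule_format]) (use that t in simp)
          qed
          have pt: "indicat_real A f \<le> indicat_real LB f + 1 / (c5 * real n)
              * (\<Sum>j<n. indicat_real (col_event n t j) f)" for f
          proof (cases "f \<in> A - LB")
            case False
            have "0 \<le> 1 / (c5 * real n) * (\<Sum>j<n. indicat_real (col_event n t j) f)" using c5
              by (intro mult_nonneg_nonneg sum_nonneg) auto
            with False show ?thesis by (auto simp: indicator_def)
          next
            case fA: True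
            then obtain x where x: "vnorm n x = 1" "L2_set (mv n f x) {..<n} \<le> s" unfolding A_def
              by blast
            then have lo: "low_ok \<gamma> c n x" using fA True unfolding LB_def by force
            define J where "J = {j. j < n \<and> \<gamma> / (2 * sqrt n) \<le> \<bar>x j\<bar>}"
            have J: "c5 * real n \<le> card J" unfolding c5_def J_def
              by (rule low_ok_spread[OF x(1) lo low(1,3) elim(5)])
            have inc: "f \<in> col_event n t j" if j: "j \<in> J" for j
              unfolding col_event_def mem_Collect_eq
            proof (intro allI impI, elim conjE)
              fix u assume u: "vnorm n u = 1" "\<forall>k<n. k \<noteq> j \<longrightarrow> (\<Sum>i<n. f (i, k) * u i) = 0"
              have jn: "j < n" "\<gamma> / (2 * sqrt n) \<le> \<bar>x j\<bar>" using j by (auto simp: J_def)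
              have "(\<Sum>i<n. mv n f x i * u i) = (\<Sum>k<n. x k * (\<Sum>i<n. f (i, k) * u i))"
                unfolding mv_def sum_distrib_left sum_distrib_right
                  by (subst sum.swap) (simp add: mult_ac)
              also have "\<dots> = (\<Sum>k\<in>{j}. x k * (\<Sum>i<n. f (i, k) * u i))"
                using jn u(2) by (intro sum.mono_neutral_right) auto
              finally have eq: "\<bar>x j\<bar> * \<bar>\<Sum>i<n. f (i, j) * u i\<bar> = \<bar>\<Sum>i<n. mv n f x i * u i\<bar>"
                by (simp add: abs_mult)
              also have "\<dots> \<le> (\<Sum>i<n. \<bar>mv n f x i\<bar> * \<bar>u i\<bar>)"
                by (rule order_trans[OF sum_abs]) (simp add: abs_mult)
              also have "\<dots> \<le> L2_set (mv n f x) {..<n} * vnorm n u" by (rule L2_set_mult_ineq)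
              also have "\<dots> \<le> s" using x u by simp
              finally have "\<bar>x j\<bar> * \<bar>\<Sum>i<n. f (i, j) * u i\<bar> \<le> s" .
              moreover have "\<gamma> / (2 * sqrt n) * \<bar>\<Sum>i<n. f (i, j) * u i\<bar>
                  \<le> \<bar>x j\<bar> * \<bar>\<Sum>i<n. f (i, j) * u i\<bar>"
                using jn by (intro mult_right_mono) auto
              ultimately have "\<gamma> / (2 * sqrt n) * \<bar>\<Sum>i<n. f (i, j) * u i\<bar> \<le> s" by linarith
              then show "\<bar>\<Sum>i<n. f (i, j) * u i\<bar> \<le> t" using low(1) n0
                by (simp add: t_def field_simps)
            qed
            have "real (card J) = (\<Sum>j\<in>J. indicat_real (col_event n t j) f)" using inc by simp
            also have "\<dots> \<le> (\<Sum>j<n. indicat_real (col_event n t j) f)"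
              by (intro sum_mono2) (auto simp: J_def)
            finally have "c5 * real n \<le> (\<Sum>j<n. indicat_real (col_event n t j) f)" using J
              by linarith
            then have "1 \<le> 1 / (c5 * real n) * (\<Sum>j<n. indicat_real (col_event n t j) f)"
              using c5 elim(5) by (simp add: field_simps)
            then show ?thesis by (auto simp: indicator_def)
          qed
          have finr: "finite (set_pmf (sqmat n))" using fin by simp
          have "Pr (sqmat n) A \<le> Mean (sqmat n)
             (\<lambda>f. indicat_real LB f + 1 / (c5 * real n) * (\<Sum>j<n. indicat_real (col_event n t j) f))"
          proof (rule prob_le_expectation[OF finr])
            fix f
            show "0 \<le> indicat_real LB f + 1 / (c5 * real n)
                * (\<Sum>j<n. indicat_real (col_event n t j) f)"
              using c5 by (intro add_nonneg_nonneg mult_nonneg_nonneg sum_nonneg) auto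
            assume "f \<in> A"
            then show "1 \<le> indicat_real LB f + 1 / (c5 * real n)
                * (\<Sum>j<n. indicat_real (col_event n t j) f)"
              using pt[of f] by simp
          qed
          also have "\<dots> = Pr (sqmat n) LB + 1 / (c5 * real n)
              * (\<Sum>j<n. Pr (sqmat n) (col_event n t j))"
            by (subst Bochner_Integration.integral_add) (auto simp: Bochner_Integration.integral_sum
                integrable_measure_pmf_finite[OF finr])
          also have "\<dots> \<le> exp (- c3 * real n) + 1 / (c5 * real n) * (\<Sum>j<n. r)"
            using c5 by (intro add_mono pLB mult_left_mono sum_mono pcol) auto
          also have "\<dots> = exp (- c3 * real n) + (1 / c5) * r" using elim(5) by simp
          also have "\<dots> = C0 * 2 / (\<gamma> * c5) * sqrt n * s + (exp (- c3 * real n) + (1 / c5)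
              * (exp (- c3 * real n) + exp (- real n / 2) + exp (- (real n powr (3/4)))))"
            using c5 low(1) by (simp add: r_def t_def field_simps)
          also have "C0 * 2 / (\<gamma> * c5) * sqrt n * s \<le> C * sqrt n * s" using C s
            by (intro mult_right_mono) auto
          finally show ?thesis using elim(4) by linarith
        qed
      qed
    qed
  qed
qed

end

section \<open>Littlewood-Offord and Odlyzko bounds\<close>

text \<open>Refers only to the leading m x m block, so that a single f serves for all leading
  blocks.\<close>

definition nonsing :: "nat \<Rightarrow> (nat \<times> nat \<Rightarrow> real) \<Rightarrow> bool" where
  "nonsing m f \<longleftrightarrow> (\<forall>x. (\<forall>i<m. mv m f x i = 0) \<longrightarrow> (\<forall>j<m. x j = 0))"

section \<open>Kernels, determinants and linear systems\<close>

lemma mult_mat_vec_mv: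
  assumes "v \<in> carrier_vec m" "i < m"
  shows "(Matrix.mat m m f *\<^sub>v v) $ i = mv m f (\<lambda>j. v $ j) i"
  using assms by (auto simp: scalar_prod_def mv_def lessThan_atLeast0 intro!: sum.cong)

lemma nonsing_iff_det: "nonsing m f \<longleftrightarrow> Determinant.det (Matrix.mat m m f) \<noteq> 0"
proof -
  have c: "Matrix.mat m m f \<in> carrier_mat m m" by simp
  have "Determinant.det (Matrix.mat m m f) = 0 \<longleftrightarrow> \<not> nonsing m f"
  proof
    assume "Determinant.det (Matrix.mat m m f) = 0"
    then obtain v where v: "v \<in> carrier_vec m" "v \<noteq> 0\<^sub>v m" "Matrix.mat m m f *\<^sub>v v = 0\<^sub>v m"
      using det_0_iff_vec_prod_zero[OF c] by blast
    have "\<forall>i<m. mv m f (\<lambda>j. v $ j) i = 0" using v(3) mult_mat_vec_mv[OF v(1), of _ f] by simp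
    moreover have "\<not> (\<forall>j<m. v $ j = 0)"
    proof
      assume "\<forall>j<m. v $ j = 0"
      then have "v = 0\<^sub>v m" using v(1) by (intro eq_vecI) auto
      with v(2) show False by simp
    qed
    ultimately show "\<not> nonsing m f" unfolding nonsing_def by blast
  next
    assume "\<not> nonsing m f"
    then obtain x j where x: "\<forall>i<m. mv m f x i = 0" "j < m" "x j \<noteq> 0" unfolding nonsing_def by blast
    define v where "v = Matrix.vec m x"
    have v: "v \<in> carrier_vec m" by (simp add: v_def)
    have "v $ j \<noteq> 0\<^sub>v m $ j" using x by (simp add: v_def)
    then have "v \<noteq> 0\<^sub>v m" by auto
    moreover have "Matrix.mat m m f *\<^sub>v v = 0\<^sub>v m"
    proof (rule eq_vecI)
      fix i assume "i < dim_vec (0\<^sub>v m :: real vec)"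
      then have i: "i < m" by simp
      have "mv m f (\<lambda>j. v $ j) i = mv m f x i" unfolding mv_def
        by (intro sum.cong) (auto simp: v_def)
      then show "(Matrix.mat m m f *\<^sub>v v) $ i = 0\<^sub>v m $ i" using mult_mat_vec_mv[OF v i] x(1) i
        by simp
    qed simp
    ultimately show "Determinant.det (Matrix.mat m m f) = 0" using det_0_iff_vec_prod_zero[OF c] v
      by blast
  qed
  then show ?thesis by blast
qed

lemma nonsing_solve:
  assumes "nonsing m f"
  shows "\<exists>w. \<forall>i<m. mv m f w i = y i"
proof -
  have c: "Matrix.mat m m f \<in> carrier_mat m m" by simp
  have "Determinant.det (Matrix.mat m m f) \<noteq> 0" using assms nonsing_iff_det by blast
  then obtain B where B: "B \<in> carrier_mat m m" "Matrix.mat m m f * B = 1\<^sub>m m"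
    by (rule nonsing_inverse[OF c])
  define v where "v = B *\<^sub>v Matrix.vec m y"
  have v: "v \<in> carrier_vec m" using B by (simp add: v_def)
  have "Matrix.mat m m f *\<^sub>v v = Matrix.vec m y"
    unfolding v_def using B by (subst assoc_mult_mat_vec[OF c B(1), symmetric]) auto
  then have "\<forall>i<m. mv m f (\<lambda>j. v $ j) i = y i" using mult_mat_vec_mv[OF v, of _ f] by auto
  then show ?thesis by blast
qed

lemma mv_cong: "(\<And>j. j < m \<Longrightarrow> f (i, j) = g (i, j)) \<Longrightarrow> mv m f x i = mv m g x i"
  unfolding mv_def by (intro sum.cong) auto

lemma nonsing_cong: "(\<And>i j. i < m \<Longrightarrow> j < m \<Longrightarrow> f (i, j) = g (i, j)) \<Longrightarrow> nonsing m f \<longleftrightarrow> nonsing m g"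
proof -
  assume fg: "\<And>i j. i < m \<Longrightarrow> j < m \<Longrightarrow> f (i, j) = g (i, j)"
  have "mv m f x i = mv m g x i" if "i < m" for x i using fg that by (intro mv_cong) auto
  then show ?thesis unfolding nonsing_def by simp
qed

text \<open>The periodic function is dominated by Gaussian bumps around the integers, each with an
  explicit integral. The result is a theta sum of exp(-b k^2) with b = a / (1 + 2 a s^2). Comparison
  with a geometric series gives order 1 / sqrt a + 1 / sqrt (1 + 2 a s^2), and |s| \<ge> 1 makes the
  second term of the order of the first.\<close>

lemma periodic_gaussian_bound:
  assumes a: "a > 0" and s: "\<bar>s\<bar> \<ge> 1"
  shows "(\<integral>g. exp (- a * (rdist (s * g))\<^sup>2) \<partial>gauss) \<le> (3 * exp 1 + 1) / sqrt a"
proof -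
  define b where "b = a / (1 + 2 * a * s\<^sup>2)"
  have s2: "s\<^sup>2 \<ge> 1" using s abs_le_square_iff[of 1 s] by simp
  have den: "1 + 2 * a * s\<^sup>2 > 0" using a by (simp add: add_pos_nonneg)
  have b: "b > 0" using a den by (simp add: b_def)
  have lim: "((\<lambda>N. sqrt 2 * exp (- (real N / \<bar>s\<bar>)\<^sup>2 / 4)) \<longlongrightarrow> 0) sequentially" using s by real_asymp
  have "\<forall>\<^sub>F N in sequentially. sqrt 2 * exp (- (real N / \<bar>s\<bar>)\<^sup>2 / 4) < 1 / sqrt a"
    by (rule order_tendstoD(2)[OF lim]) (use a in simp)
  \<comment> \<open>Truncation to finitely many bumps; what lies beyond is a Gaussian tail below 1 /
    sqrt a.\<close>
  then obtain N :: nat where N: "sqrt 2 * exp (- (real N / \<bar>s\<bar>)\<^sup>2 / 4) < 1 / sqrt a"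
    unfolding eventually_sequentially by blast
  define Z where "Z = {- int N..int N}"
  define e where "e k = exp (- a * (real_of_int k)\<^sup>2)" for k
  define F where "F g = (\<Sum>k\<in>Z. e k * exp (2 * a * real_of_int k * s * g - a * s\<^sup>2 * g\<^sup>2))
      + exp (- (real N / \<bar>s\<bar>)\<^sup>2 / 4) * exp (- (- 1/4) * g\<^sup>2)" for g
  have ek: "e k * exp (2 * a * real_of_int k * s * g - a * s\<^sup>2 * g\<^sup>2)
      = exp (- a * (s * g - real_of_int k)\<^sup>2)" for k g
    unfolding e_def exp_add[symmetric] by (simp add: power2_eq_square algebra_simps)
  have pw: "exp (- a * (rdist (s * g))\<^sup>2) \<le> F g" for g
  proof (cases "round (s * g) \<in> Z")
    case True
    have "exp (- a * (rdist (s * g))\<^sup>2) = e (round (s * g)) * exp (2 * a * real_of_int (round (s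
        * g)) * s * g - a * s\<^sup>2 * g\<^sup>2)"
      unfolding ek rdist_def by simp
    also have "\<dots> \<le> (\<Sum>k\<in>Z. e k * exp (2 * a * real_of_int k * s * g - a * s\<^sup>2 * g\<^sup>2))"
      using True by (intro member_le_sum) (auto simp: e_def Z_def)
    finally show ?thesis unfolding F_def by (simp add: add_increasing2)
  next
    case False
    then have "int N + 1 \<le> \<bar>round (s * g)\<bar>" by (auto simp: Z_def)
    then have "real N + 1 \<le> \<bar>real_of_int (round (s * g))\<bar>" by linarith
    moreover have "rdist (s * g) \<le> 1/2" by (rule rdist_le_half)
    ultimately have "real N \<le> \<bar>s * g\<bar>" unfolding rdist_def by linarith
    then have "real N / \<bar>s\<bar> \<le> \<bar>g\<bar>" using s by (simp add: abs_mult field_simps)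
    then have "(real N / \<bar>s\<bar>)\<^sup>2 \<le> \<bar>g\<bar>\<^sup>2" by (intro power_mono) auto
    then have "1 \<le> exp (- (real N / \<bar>s\<bar>)\<^sup>2 / 4) * exp (- (- 1/4) * g\<^sup>2)"
      by (simp add: exp_add[symmetric])
    moreover have "0 \<le> (\<Sum>k\<in>Z. e k * exp (2 * a * real_of_int k * s * g - a * s\<^sup>2 * g\<^sup>2))"
      by (intro sum_nonneg) (auto simp: e_def)
    moreover have "exp (- a * (rdist (s * g))\<^sup>2) \<le> 1" using a by simp
    ultimately show ?thesis unfolding F_def by linarith
  qed
  have hb: "has_bochner_integral gauss F
     ((\<Sum>k\<in>Z. e k * (exp ((2 * a * real_of_int k * s)\<^sup>2 / (2 * (1 + 2 * (a * s\<^sup>2)))) / sqrt (1 + 2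
         * (a * s\<^sup>2)))) +
      exp (- (real N / \<bar>s\<bar>)\<^sup>2 / 4) * (1 / sqrt (1 + 2 * (- 1/4))))"
    unfolding F_def using den
    by (intro has_bochner_integral_add has_bochner_integral_sum has_bochner_integral_mult_right
        has_bochner_integral_std_normal_exp_sq has_bochner_integral_std_normal_exp) (auto simp:
            mult.assoc)
  have int: "integrable gauss (\<lambda>g. exp (- a * (rdist (s * g))\<^sup>2))"
    using a by (intro integrable_std_normal_bounded[of _ 1]) auto
  have "(\<integral>g. exp (- a * (rdist (s * g))\<^sup>2) \<partial>gauss) \<le> (\<integral>g. F g \<partial>gauss)"
    using hb by (intro integral_mono[OF int _ pw]) (auto simp: has_bochner_integral_iff)
  also have "\<dots> = (\<Sum>k\<in>Z. e k * (exp ((2 * a * real_of_int k * s)\<^sup>2 / (2 * (1 + 2 * (a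
      * s\<^sup>2)))) / sqrt (1 + 2 * (a * s\<^sup>2)))) +
      exp (- (real N / \<bar>s\<bar>)\<^sup>2 / 4) * (1 / sqrt (1 + 2 * (- 1/4)))"
    using hb by (simp add: has_bochner_integral_iff)
  also have "1 / sqrt (1 + 2 * (- 1/4)) = sqrt 2" by (simp add: real_sqrt_divide)
  finally have le: "(\<integral>g. exp (- a * (rdist (s * g))\<^sup>2) \<partial>gauss) \<le>
     (\<Sum>k\<in>Z. e k * (exp ((2 * a * real_of_int k * s)\<^sup>2 / (2 * (1 + 2 * (a * s\<^sup>2)))) / sqrt (1 + 2
         * (a * s\<^sup>2)))) + 1 / sqrt a"
    using N by (simp add: mult.commute)
  have "(\<Sum>k\<in>Z. e k * (exp ((2 * a * real_of_int k * s)\<^sup>2 / (2 * (1 + 2 * (a * s\<^sup>2)))) / sqrt (1 + 2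
      * (a * s\<^sup>2)))) =
     (\<Sum>k\<in>Z. exp (- b * (real_of_int k)\<^sup>2)) / sqrt (1 + 2 * a * s\<^sup>2)"
    unfolding sum_divide_distrib
  proof (rule sum.cong[OF refl])
    fix k
    have "- a * (real_of_int k)\<^sup>2 + (2 * a * real_of_int k * s)\<^sup>2 / (2 * (1 + 2 * (a * s\<^sup>2)))
        = - b * (real_of_int k)\<^sup>2"
    proof -
      have "(2 * a * real_of_int k * s)\<^sup>2 / (2 * (1 + 2 * (a * s\<^sup>2)))
          = (a * (real_of_int k)\<^sup>2) * ((2 * a * s\<^sup>2) / (1 + 2 * a * s\<^sup>2))"
      proof -
        have "(2 * a * real_of_int k * s)\<^sup>2 / (2 * D)
            = (a * (real_of_int k)\<^sup>2) * ((2 * a * s\<^sup>2) / D)" for D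
          by (simp add: power2_eq_square)
        from this[of "1 + 2 * a * s\<^sup>2"] show ?thesis by (simp only: mult.assoc)
      qed
      also have "(2 * a * s\<^sup>2) / (1 + 2 * a * s\<^sup>2) = 1 - 1 / (1 + 2 * a * s\<^sup>2)"
        using den by (simp add: field_simps)
      finally show ?thesis by (simp add: b_def algebra_simps)
    qed
    then have "e k * exp ((2 * a * real_of_int k * s)\<^sup>2 / (2 * (1 + 2 * (a * s\<^sup>2))))
        = exp (- b * (real_of_int k)\<^sup>2)"
      unfolding e_def exp_add[symmetric] by simp
    then show "e k * (exp ((2 * a * real_of_int k * s)\<^sup>2 / (2 * (1 + 2 * (a * s\<^sup>2)))) / sqrt (1 + 2
        * (a * s\<^sup>2))) =
      exp (- b * (real_of_int k)\<^sup>2) / sqrt (1 + 2 * a * s\<^sup>2)" by (simp add: mult.assoc)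
  qed
  also have "\<dots> \<le> (exp 1 * (2 * (1 + 2 * sqrt b) / (2 * sqrt b))) / sqrt (1 + 2 * a * s\<^sup>2)"
  proof (intro divide_right_mono)
    define q where "q = exp (- (2 * sqrt b))"
    have q: "0 < q" "q < 1" using b by (auto simp: q_def)
    have "(\<Sum>k\<in>Z. exp (- b * (real_of_int k)\<^sup>2)) \<le> (\<Sum>k\<in>Z. exp 1 * q ^ nat \<bar>k\<bar>)"
    proof (rule sum_mono)
      fix k
      \<comment> \<open>Completing this square gives -b k^2 \<le> 1 - 2 sqrt b |k|, which is the
        origin of the ratio q.\<close>
      have "0 \<le> (sqrt b * \<bar>real_of_int k\<bar> - 1)\<^sup>2" by simp
      also have "\<dots> = b * (real_of_int k)\<^sup>2 - 2 * sqrt b * \<bar>real_of_int k\<bar> + 1"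
        using b by (simp add: power2_diff power_mult_distrib)
      finally have "- b * (real_of_int k)\<^sup>2 \<le> 1 + real (nat \<bar>k\<bar>) * - (2 * sqrt b)"
        by (simp add: algebra_simps)
      then have "exp (- b * (real_of_int k)\<^sup>2) \<le> exp (1 + real (nat \<bar>k\<bar>) * - (2 * sqrt b))"
        by (simp only: exp_le_cancel_iff)
      then show "exp (- b * (real_of_int k)\<^sup>2) \<le> exp 1 * q ^ nat \<bar>k\<bar>"
        by (simp only: exp_add q_def exp_of_nat_mult)
    qed
    also have "\<dots> \<le> exp 1 * ((1 + q) / (1 - q))"
      unfolding sum_distrib_left[symmetric] Z_def by (intro mult_left_mono sum_geometric_abs q) auto
    also have "\<dots> \<le> exp 1 * (2 * (1 + 2 * sqrt b) / (2 * sqrt b))"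
      unfolding q_def using b by (intro mult_left_mono net_factor_le) auto
    finally show "(\<Sum>k\<in>Z. exp (- b * (real_of_int k)\<^sup>2))
        \<le> exp 1 * (2 * (1 + 2 * sqrt b) / (2 * sqrt b))" .
  qed (use den in auto)
  also have "\<dots> = exp 1 * (1 / (sqrt b * sqrt (1 + 2 * a * s\<^sup>2)) + 2 / sqrt (1 + 2 * a * s\<^sup>2))"
    using b den by (simp add: field_simps)
  also have "sqrt b * sqrt (1 + 2 * a * s\<^sup>2) = sqrt a" using den
    by (simp add: b_def real_sqrt_mult[symmetric])
  also have "exp 1 * (1 / sqrt a + 2 / sqrt (1 + 2 * a * s\<^sup>2)) \<le> exp 1 * (1 / sqrt a + 2 / sqrt a)"
  proof (intro mult_left_mono add_left_mono divide_left_mono)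
    have "a * 1 \<le> a * s\<^sup>2" using s2 a by (intro mult_left_mono) auto
    then have "a \<le> 1 + 2 * (a * s\<^sup>2)" using a by linarith
    then show "sqrt a \<le> sqrt (1 + 2 * a * s\<^sup>2)" by (simp add: mult.assoc)
    show "0 < sqrt (1 + 2 * a * s\<^sup>2) * sqrt a" using a den by simp
  qed auto
  finally have "(\<Sum>k\<in>Z. e k * (exp ((2 * a * real_of_int k * s)\<^sup>2 / (2 * (1 + 2 * (a
      * s\<^sup>2)))) / sqrt (1 + 2 * (a * s\<^sup>2)))) \<le> exp 1 * (3 / sqrt a)"
    by simp
  with le have "(\<integral>g. exp (- a * (rdist (s * g))\<^sup>2) \<partial>gauss) \<le> exp 1 * (3 / sqrt a) + 1 / sqrt a"
    by linarith
  then show ?thesis by (simp add: add_divide_distrib mult.commute)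
qed

lemma exp_sum_le_average:
  fixes y :: "'a \<Rightarrow> real"
  assumes "finite J" "J \<noteq> {}"
  shows "exp (\<Sum>j\<in>J. y j) \<le> (\<Sum>j\<in>J. exp (card J * y j)) / card J"
proof -
  have c: "real (card J) > 0" using assms by (simp add: card_gt_0_iff)
  have "exp (\<Sum>j\<in>J. (1 / card J) *\<^sub>R (card J * y j)) \<le> (\<Sum>j\<in>J. (1 / card J) * exp (card J * y j))"
    by (rule convex_on_sum[OF assms exp_convex]) (use c assms in auto)
  also have "(\<Sum>j\<in>J. (1 / card J) *\<^sub>R (card J * y j)) = (\<Sum>j\<in>J. y j)" using c by (intro sum.cong) auto
  finally show ?thesis by (simp add: sum_divide_distrib)
qed

context discrete_law
begin

text \<open>The inequality of arithmetic and geometric means separates the coordinates and leaves one-dimensional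
  periodic Gaussian integrals.\<close>

lemma littlewood_offord:
  assumes J: "J \<subseteq> {..<n}" "J \<noteq> {}" and nz: "\<And>j. j \<in> J \<Longrightarrow> w j \<noteq> 0"
  shows "Pr (rvec n) {X. (\<Sum>j<n. X j * w j) = d}
      \<le> exp (1/2) * (3 * exp 1 + 1) / sqrt c0 / sqrt (card J)"
proof -
  define M where "M = card J"
  have finJ: "finite J" using J(1) finite_subset by blast
  have M: "real M > 0" using J finJ by (simp add: M_def card_gt_0_iff)
  \<comment> \<open>An exact equation permits every radius h / \<sigma>, so \<sigma> can be made so
    large that |\<sigma> w j| \<ge> 1 for all j in J.\<close>
  define \<sigma> where "\<sigma> = 1 / Min ((\<lambda>j. \<bar>w j\<bar>) ` J)"
  have min: "Min ((\<lambda>j. \<bar>w j\<bar>) ` J) > 0" using finJ J(2) nz by (subst Min_gr_iff) auto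
  have \<sigma>: "\<sigma> > 0" using min by (simp add: \<sigma>_def)
  have \<sigma>w: "\<bar>\<sigma> * w j\<bar> \<ge> 1" if "j \<in> J" for j
  proof -
    have "Min ((\<lambda>j. \<bar>w j\<bar>) ` J) \<le> \<bar>w j\<bar>" using finJ that by (intro Min_le) auto
    then show ?thesis using min by (simp add: \<sigma>_def abs_mult)
  qed
  have "Pr (rvec n) {X. (\<Sum>j<n. X j * w j) = d} \<le> Pr (rvec n) {X. \<bar>(\<Sum>j<n. X j * w j) - d\<bar> \<le> h / \<sigma>}"
    using h \<sigma> by (intro measure_pmf.finite_measure_mono) auto
  also have "\<dots> \<le> exp (1/2) * Q n w (h / (h / \<sigma>))" by (rule prob_dot_small) (use h \<sigma> in simp)
  also have "h / (h / \<sigma>) = \<sigma>" using h by simp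
  also have "Q n w \<sigma> \<le> (\<integral>g. (\<Sum>j\<in>J. exp (- (c0 * M) * (rdist (\<sigma> * w j * g))\<^sup>2)) / M \<partial>gauss)"
    unfolding Q_def
  proof (rule integral_mono[OF integrable_exp_int_dist_sq])
    show "integrable gauss (\<lambda>g. (\<Sum>j\<in>J. exp (- (c0 * M) * (rdist (\<sigma> * w j * g))\<^sup>2)) / M)"
      using c0 by (intro integrable_divide Bochner_Integration.integrable_sum
          integrable_std_normal_bounded[of _ 1]) auto
    fix g
    have "(\<Sum>j\<in>J. (rdist (\<sigma> * g * w j))\<^sup>2) \<le> int_dist_sq n (\<sigma> * g) w"
      unfolding int_dist_sq_def using J(1) by (intro sum_mono2) auto
    then have "c0 * (\<Sum>j\<in>J. (rdist (\<sigma> * g * w j))\<^sup>2) \<le> c0 * int_dist_sq n (\<sigma> * g) w" using c0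
      by (intro mult_left_mono) auto
    then have "exp (- c0 * int_dist_sq n (\<sigma> * g) w) \<le> exp (\<Sum>j\<in>J. - c0 * (rdist (\<sigma> * g * w j))\<^sup>2)"
      by (simp add: sum_distrib_left sum_negf)
    also have "\<dots> \<le> (\<Sum>j\<in>J. exp (card J * (- c0 * (rdist (\<sigma> * g * w j))\<^sup>2))) / card J"
      by (rule exp_sum_le_average[OF finJ J(2)])
    also have "\<dots> = (\<Sum>j\<in>J. exp (- (c0 * M) * (rdist (\<sigma> * w j * g))\<^sup>2)) / M"
      by (simp add: M_def mult_ac)
    finally show "exp (- c0 * int_dist_sq n (\<sigma> * g) w)
        \<le> (\<Sum>j\<in>J. exp (- (c0 * M) * (rdist (\<sigma> * w j * g))\<^sup>2)) / M" .
  qed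
  also have "\<dots> = (\<Sum>j\<in>J. (\<integral>g. exp (- (c0 * M) * (rdist (\<sigma> * w j * g))\<^sup>2) \<partial>gauss)) / M"
  proof -
    have "integrable gauss (\<lambda>g. exp (- (c0 * M) * (rdist (\<sigma> * w j * g))\<^sup>2))" for j
      using c0 by (intro integrable_std_normal_bounded[of _ 1]) auto
    then show ?thesis by (subst integral_divide_zero, subst Bochner_Integration.integral_sum) auto
  qed
  also have "\<dots> \<le> (\<Sum>j\<in>J. (3 * exp 1 + 1) / sqrt (c0 * M)) / M"
    using c0 M by (intro divide_right_mono sum_mono periodic_gaussian_bound \<sigma>w) auto
  also have "\<dots> = (3 * exp 1 + 1) / sqrt (c0 * M)" using M by (simp add: M_def)
  finally have "Pr (rvec n) {X. (\<Sum>j<n. X j * w j) = d}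
      \<le> exp (1/2) * ((3 * exp 1 + 1) / sqrt (c0 * M))" by simp
  then show ?thesis by (simp add: M_def real_sqrt_mult)
qed

section \<open>Odlyzko's bound for affine subspaces\<close>

definition \<beta> :: real where "\<beta> = max_atom \<xi>"

lemma pmf_le_\<beta>: "pmf \<xi> a \<le> \<beta>"
  unfolding \<beta>_def max_atom_def by (rule cSUP_upper) (auto intro!: bdd_aboveI[of _ 1] simp: pmf_le_1)

lemma \<beta>_pos: "0 < \<beta>"
proof -
  obtain a where "a \<in> set_pmf \<xi>" using set_pmf_not_empty[of \<xi>] by blast
  then have "0 < pmf \<xi> a" by (simp add: pmf_positive)
  with pmf_le_\<beta>[of a] show ?thesis by linarith
qed

lemma \<beta>_le_1: "\<beta> \<le> 1"
  unfolding \<beta>_def max_atom_def by (rule cSUP_least) (auto simp: pmf_le_1)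

lemma rvec_Suc: "Mean (rvec (Suc m)) F =
   Mean \<xi> (\<lambda>v. Mean (rvec m) (\<lambda>X. F (X(m := v))))" for F :: "_ \<Rightarrow> real"
  by (simp add: lessThan_Suc Pi_pmf_insert expectation_pair_pmf_finite fin case_prod_unfold)

text \<open>Odlyzko's bound. The affine form makes the induction on the number of coordinates work:
  fixing the last coordinate either eliminates a spanning vector or imposes an equation on one entry.\<close>

lemma odlyzko:
  fixes a :: "'j \<Rightarrow> nat \<Rightarrow> real"
  assumes "finite J"
  shows "Pr (rvec m) {X. \<exists>c. \<forall>i<m. X i = b i + (\<Sum>j\<in>J. c j * a j i)} \<le> \<beta> ^ (m - card J)"
  using assms
proof (induction m arbitrary: J a b)
  case 0
  then show ?case by simp
next
  case (Suc m)
  define S where "S m J a b = {X. \<exists>c. \<forall>i<m. X i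
      = b i + (\<Sum>j\<in>J. c j * a j i)}" for m J and a :: "'j \<Rightarrow> nat \<Rightarrow> real" and b :: "nat \<Rightarrow> real"
  have P: "Pr (rvec (Suc m)) (S (Suc m) J a b) =
     Mean \<xi> (\<lambda>v. Mean (rvec m) (\<lambda>X. indicat_real (S (Suc m) J a b) (X(m := v))))"
    using rvec_Suc[of m "indicat_real (S (Suc m) J a b)"] by simp
  show ?case
  proof (cases "\<forall>j\<in>J. a j m = 0")
    case True
    have pt: "indicat_real (S (Suc m) J a b) (X(m := v))
        \<le> indicat_real {b m} v * indicat_real (S m J a b) X" for X v
    proof (cases "X(m := v) \<in> S (Suc m) J a b")
      case T: True
      then obtain c where c: "\<forall>i<Suc m. (X(m := v)) i = b i + (\<Sum>j\<in>J. c j * a j i)" unfolding S_def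
        by blast
      have "v = b m" using c True by (auto dest!: spec[of _ m])
      moreover have "X \<in> S m J a b" unfolding S_def mem_Collect_eq
      proof (intro exI[of _ c] allI impI)
        fix i assume "i < m"
        then show "X i = b i + (\<Sum>j\<in>J. c j * a j i)" using c[rule_format, of i] by simp
      qed
      ultimately show ?thesis by simp
    qed simp
    have "Pr (rvec (Suc m)) (S (Suc m) J a b) \<le>
       Mean \<xi> (\<lambda>v. Mean (rvec m) (\<lambda>X. indicat_real {b m} v * indicat_real (S m J a b) X))"
      unfolding P by (intro integral_mono integrable_measure_pmf_finite fin finite_rvec pt)
    also have "\<dots> = pmf \<xi> (b m) * Pr (rvec m) (S m J a b)"
      by (simp add: measure_pmf_single)
    also have "\<dots> \<le> \<beta> * \<beta> ^ (m - card J)"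
      using Suc.IH[OF Suc.prems, of b a] pmf_le_\<beta> \<beta>_pos by (intro mult_mono) (auto simp: S_def)
    also have "\<dots> = \<beta> ^ Suc (m - card J)" by simp
    \<comment> \<open>The exponents agree unless card J > m, where truncated subtraction makes the
      right one 0.\<close>
    also have "\<dots> \<le> \<beta> ^ (Suc m - card J)" using \<beta>_pos \<beta>_le_1 by (intro power_decreasing) auto
    finally show ?thesis by (simp add: S_def)
  next
    case False
    then obtain j0 where j0: "j0 \<in> J" "a j0 m \<noteq> 0" by blast
    \<comment> \<open>Coordinate m determines \<open>c j0\<close> from v and the other coefficients;
      substituting it produces these vectors and the offset \<open>b'\<close>.\<close>
    define a' where "a' j i = a j i - a j m / a j0 m * a j0 i" for j i
    define b' where "b' v i = b i + (v - b m) / a j0 m * a j0 i" for v i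
    have sub: "X \<in> S m (J - {j0}) a' (b' v)" if X: "X(m := v) \<in> S (Suc m) J a b" for X v
    proof -
      obtain c where c: "\<forall>i<Suc m. (X(m := v)) i = b i + (\<Sum>j\<in>J. c j * a j i)" using X
        unfolding S_def by blast
      have split: "(\<Sum>j\<in>J. c j * a j i) = c j0 * a j0 i + (\<Sum>j\<in>J - {j0}. c j * a j i)" for i
        using Suc.prems j0 by (simp add: sum.remove)
      have "v = b m + (c j0 * a j0 m + (\<Sum>j\<in>J - {j0}. c j * a j m))"
        using c[rule_format, of m] split[of m] by simp
      then have cj: "c j0 = (v - b m) / a j0 m - (\<Sum>j\<in>J - {j0}. c j * (a j m / a j0 m))"
        using j0(2) by (simp add: field_simps sum_divide_distrib[symmetric])
      show ?thesis unfolding S_def mem_Collect_eq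
      proof (intro exI[of _ c] allI impI)
        fix i assume "i < m"
        then have "X i = b i + (c j0 * a j0 i + (\<Sum>j\<in>J - {j0}. c j * a j i))"
          using c[rule_format, of i] split[of i] by simp
        also have "c j0 * a j0 i = (v - b m) / a j0 m * a j0 i - (\<Sum>j\<in>J - {j0}. c j * (a j m / a j0 m
            * a j0 i))"
          unfolding cj left_diff_distrib sum_distrib_right by (simp add: mult.assoc)
        also have "b i + ((v - b m) / a j0 m * a j0 i - (\<Sum>j\<in>J - {j0}. c j * (a j m / a j0 m
            * a j0 i)) + (\<Sum>j\<in>J - {j0}. c j * a j i))
          = b' v i + (\<Sum>j\<in>J - {j0}. c j * a' j i)"
          by (simp add: b'_def a'_def right_diff_distrib sum_subtractf)
        finally show "X i = b' v i + (\<Sum>j\<in>J - {j0}. c j * a' j i)" .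
      qed
    qed
    have "Pr (rvec (Suc m)) (S (Suc m) J a b) \<le>
       Mean \<xi> (\<lambda>v. Mean (rvec m) (indicat_real (S m (J - {j0}) a' (b' v))))"
      unfolding P by (intro integral_mono integrable_measure_pmf_finite fin finite_rvec) (use sub in
          \<open>auto simp: indicator_def\<close>)
    also have "\<dots> \<le> Mean \<xi> (\<lambda>v. \<beta> ^ (m - card (J - {j0})))"
    proof (intro integral_mono integrable_measure_pmf_finite fin)
      fix v
      show "Mean (rvec m) (indicat_real (S m (J - {j0}) a' (b' v))) \<le> \<beta> ^ (m - card (J - {j0}))"
        using Suc.IH[of "J - {j0}" "b' v" a'] Suc.prems by (simp add: S_def)
    qed
    also have "\<dots> = \<beta> ^ (m - (card J - 1))" using j0 Suc.prems by simp
    also have "m - (card J - 1) = Suc m - card J"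
      using j0 Suc.prems card_gt_0_iff[of J] by auto
    finally show ?thesis by (simp add: S_def)
  qed
qed

end

section \<open>All leading submatrices are non-singular\<close>

lemma nonsing_0 [simp]: "nonsing 0 f"
  by (simp add: nonsing_def)

lemma mv_Suc: "mv (Suc m) F x i = mv m F x i + F (i, m) * x m"
  by (simp add: mv_def)

text \<open>A kernel vector of the extended block has x m \<noteq> 0, since otherwise it would give
  a kernel vector of the m x m block. Scaled to last entry -1 it is (w, -1), and the last row has to
  be orthogonal to it.\<close>

lemma singular_extension:
  assumes nonsing: "nonsing m F" and w: "\<And>i. i < m \<Longrightarrow> mv m F w i
      = F (i, m)" and sing: "\<not> nonsing (Suc m) F"
  shows "(\<Sum>j<Suc m. F (m, j) * (if j < m then w j else -1)) = 0"
proof -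
  obtain x j0 where x: "\<And>i. i < Suc m \<Longrightarrow> mv (Suc m) F x i = 0" "j0 < Suc m" "x j0 \<noteq> 0"
    using sing unfolding nonsing_def by blast
  have "mv m F (\<lambda>j. x j - (- x m) * w j) i = 0" if i: "i < m" for i
  proof -
    have "mv m F x i + F (i, m) * x m = 0" using x(1)[of i] i by (simp add: mv_Suc)
    then show ?thesis using w[OF i] by (simp only: mv_diff mv_scale) (simp add: mult.commute)
  qed
  then have xw: "x j = - x m * w j" if "j < m" for j
    using nonsing that unfolding nonsing_def by (metis (no_types, lifting) eq_iff_diff_eq_0)
  have xm: "x m \<noteq> 0"
  proof
    assume "x m = 0"
    then have "x j0 = 0" using xw[of j0] x(2) by (cases "j0 = m") auto
    with x(3) show False by simp
  qed
  have "0 = mv m F x m + F (m, m) * x m" using x(1)[of m] by (simp add: mv_Suc)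
  also have "mv m F x m = - x m * (\<Sum>j<m. F (m, j) * w j)"
    unfolding mv_def sum_distrib_left by (intro sum.cong) (auto simp: xw)
  finally have "x m * (F (m, m) - (\<Sum>j<m. F (m, j) * w j)) = 0" by (auto simp: algebra_simps)
  with xm have "(\<Sum>j<m. F (m, j) * w j) = F (m, m)" by simp
  then show ?thesis by simp
qed

definition lead_nonsing :: "nat \<Rightarrow> (nat \<times> nat \<Rightarrow> real) \<Rightarrow> bool" where
  "lead_nonsing m f \<longleftrightarrow> (\<forall>k\<le>m. nonsing k f)"

lemma lead_nonsing_Suc: "lead_nonsing (Suc m) f \<longleftrightarrow> lead_nonsing m f \<and> nonsing (Suc m) f"
  by (auto simp: lead_nonsing_def le_Suc_eq)

lemma lead_nonsing_cong: "(\<And>i j. i < m \<Longrightarrow> j < m \<Longrightarrow> f (i, j) = g (i, j))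
    \<Longrightarrow> lead_nonsing m f \<longleftrightarrow> lead_nonsing m g"
  unfolding lead_nonsing_def by (intro all_cong nonsing_cong) auto

text \<open>The weights exp(l (c - card J)) are at least 1 on the sets counted, and over the whole
  power set they factor over the elements.\<close>

lemma card_small_subsets:
  fixes m :: nat and l c :: real
  assumes "l > 0"
  shows "real (card {J. J \<subseteq> {..<m} \<and> real (card J) \<le> c}) \<le> exp (l * c) * (1 + exp (-l)) ^ m"
proof -
  let ?S = "{J. J \<subseteq> {..<m} \<and> real (card J) \<le> c}"
  have "real (card ?S) = (\<Sum>J\<in>?S. 1)" by simp
  also have "\<dots> \<le> (\<Sum>J\<in>?S. exp (l * c) * exp (-l) ^ card J)"
  proof (rule sum_mono)
    fix J assume "J \<in> ?S"
    then have "l * real (card J) \<le> l * c" using assms by (intro mult_left_mono) auto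
    then have "1 \<le> exp (l * c) * exp (real (card J) * - l)"
      by (simp add: exp_add[symmetric] mult.commute)
    then show "1 \<le> exp (l * c) * exp (-l) ^ card J" by (simp only: exp_of_nat_mult)
  qed
  also have "\<dots> \<le> (\<Sum>J\<in>Pow {..<m}. exp (l * c) * exp (-l) ^ card J)" by (intro sum_mono2) auto
  also have "\<dots> = exp (l * c) * (\<Sum>J\<in>Pow {..<m}. (\<Prod>j\<in>J. exp (-l)) * (\<Prod>j\<in>{..<m} - J. 1))"
    by (simp add: sum_distrib_left)
  also have "\<dots> = exp (l * c) * (\<Prod>j<m. exp (-l) + 1)" by (subst prod_add) auto
  finally show ?thesis by (simp add: add.commute)
qed

context discrete_law
begin

definition prob_lead_nonsing :: "nat \<Rightarrow> real" where
  "prob_lead_nonsing m = Pr (sqmat m) {f. lead_nonsing m f}"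

lemma prob_corner:
  assumes "m \<le> n" and P: "\<And>f g. (\<And>i j. i < m \<Longrightarrow> j < m \<Longrightarrow> f (i, j) = g (i, j)) \<Longrightarrow> P f \<longleftrightarrow> P g"
  shows "Pr (sqmat n) {f. P f} = Pr (sqmat m) {f. P f}"
proof -
  have *: "sqmat m = map_pmf (\<lambda>f x. if x \<in> {..<m} \<times> {..<m} then f x else 0) (sqmat n)"
    by (rule Pi_pmf_subset) (use assms(1) in auto)
  have "P (\<lambda>x. if x \<in> {..<m} \<times> {..<m} then f x else 0) \<longleftrightarrow> P f" for f by (rule P) simp
  then show ?thesis unfolding * by (simp add: vimage_def)
qed

text \<open>Contains every new row that makes the extension singular, when w solves the old block
  against the new column.\<close>

definition ext_hyperplane :: "nat \<Rightarrow> (nat \<Rightarrow> real) \<Rightarrow> (nat \<Rightarrow> real) set" where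
  "ext_hyperplane m w = {X. (\<Sum>j<Suc m. X j * (if j < m then w j else -1)) = 0}"

text \<open>Made total by choice; it is meaningful for non-singular f, where its first m entries are
  unique.\<close>

definition lin_sol :: "nat \<Rightarrow> (nat \<times> nat \<Rightarrow> real) \<Rightarrow> (nat \<Rightarrow> real) \<Rightarrow> nat \<Rightarrow> real" where
  "lin_sol m f Y = (SOME w. \<forall>i<m. mv m f w i = Y i)"

lemma lin_sol: "nonsing m f \<Longrightarrow> i < m \<Longrightarrow> mv m f (lin_sol m f Y) i = Y i"
  unfolding lin_sol_def using someI_ex[OF nonsing_solve[of m f Y]] by blast

text \<open>The new column and the new row are independent of the old block and of each other. Given
  block and column, singularity forces one linear equation on the new row, with coefficients (w,
  -1). The bound \<rho> is needed only on average over the column, which tolerates the rare columns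
  with sparse w.\<close>

lemma prob_lead_nonsing_step:
  assumes \<rho>: "\<And>f. nonsing m f \<Longrightarrow> Mean (rvec m) (\<lambda>Y. Pr (rvec (Suc m)) (ext_hyperplane m (lin_sol m f
      Y))) \<le> \<rho>"
  shows "(1 - \<rho>) * prob_lead_nonsing m \<le> prob_lead_nonsing (Suc m)"
proof -
  define A where "A = {..<m} \<times> {..<m}"
  define B where "B = {..<m} \<times> {m}"
  define C where "C = {m} \<times> {..<Suc m}"
  define PP where "PP S = Pi_pmf S 0 (\<lambda>_. \<xi>)" for S :: "(nat \<times> nat) set"
  define bad where "bad = {f. lead_nonsing m f \<and> \<not> nonsing (Suc m) f}"
  have fins: "finite A" "finite B" "finite C" "finite (B \<union> C)" by (auto simp: A_def B_def C_def)
  have disj: "A \<inter> (B \<union> C) = {}" "B \<inter> C = {}" by (auto simp: A_def B_def C_def)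
  have finP: "finite (set_pmf (PP S))" if "finite S" for S using that fin by (simp add: PP_def)
  have colB: "rvec m = map_pmf (\<lambda>g. g \<circ> (\<lambda>i. (i, m))) (PP B)"
    unfolding PP_def by (rule Pi_pmf_bij_betw) (auto simp: bij_betw_def inj_on_def B_def)
  have rowC: "rvec (Suc m) = map_pmf (\<lambda>g. g \<circ> (\<lambda>j. (m, j))) (PP C)"
    unfolding PP_def by (rule Pi_pmf_bij_betw) (auto simp: bij_betw_def inj_on_def C_def)
  define glue where "glue a b c = (\<lambda>x. if x \<in> A then a x else if x \<in> B then b x else c x)" for a b c
      :: "nat \<times> nat \<Rightarrow> real"
  have un: "sqmat (Suc m) = PP (A \<union> (B \<union> C))"
    unfolding PP_def by (intro arg_cong[of _ _ "\<lambda>S. Pi_pmf S 0 (\<lambda>_. \<xi>)"]) (auto simp: A_def B_def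
        C_def)
  have gA: "glue a b c (i, j) = a (i, j)" if "i < m" "j < m" for a b c i j using that
    by (simp add: glue_def A_def)
  have gB: "glue a b c (i, m) = b (i, m)" if "i < m" for a b c i using that
    by (simp add: glue_def A_def B_def)
  have gC: "glue a b c (m, j) = c (m, j)" for a b c j by (simp add: glue_def A_def B_def)
  have inner: "Mean (PP B) (\<lambda>b. Mean (PP C) (\<lambda>c. indicat_real bad (glue a b c)))
      \<le> indicat_real {f. lead_nonsing m f} a * \<rho>"
    for a
  proof (cases "lead_nonsing m a")
    case False
    have "glue a b c \<notin> bad" for b c
      using False lead_nonsing_cong[of m "glue a b c" a] gA by (auto simp: bad_def)
    with False show ?thesis by simp
  next
    case True
    then have nsa: "nonsing m a" by (simp add: lead_nonsing_def)
    have "Mean (PP C) (\<lambda>c. indicat_real bad (glue a b c)) \<le>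
       Pr (rvec (Suc m)) (ext_hyperplane m (lin_sol m a (b \<circ> (\<lambda>i. (i, m)))))" for b
    proof -
      let ?w = "lin_sol m a (b \<circ> (\<lambda>i. (i, m)))"
      have "Mean (PP C) (\<lambda>c. indicat_real bad (glue a b c)) \<le>
        Mean (PP C) (\<lambda>c. indicat_real (ext_hyperplane m ?w) (c \<circ> (\<lambda>j. (m, j))))"
      proof (intro integral_mono integrable_measure_pmf_finite finP fins)
        fix c
        show "indicat_real bad (glue a b c) \<le> indicat_real (ext_hyperplane m ?w) (c \<circ> (\<lambda>j. (m, j)))"
        proof (cases "glue a b c \<in> bad")
          case bd: True
          let ?F = "glue a b c"
          have "nonsing m ?F" using bd by (simp add: bad_def lead_nonsing_def)
          moreover have "mv m ?F ?w i = ?F (i, m)" if i: "i < m" for i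
          proof -
            have "mv m ?F ?w i = mv m a ?w i" using i by (intro mv_cong gA)
            then show ?thesis using lin_sol[OF nsa i] gB[OF i] by simp
          qed
          moreover have "\<not> nonsing (Suc m) ?F" using bd by (simp add: bad_def)
          ultimately have "(\<Sum>j<Suc m. ?F (m, j) * (if j < m then ?w j else -1)) = 0"
            by (rule singular_extension)
          then have "c \<circ> (\<lambda>j. (m, j)) \<in> ext_hyperplane m ?w" unfolding ext_hyperplane_def gC
            by (simp only: mem_Collect_eq o_def)
          then show ?thesis by simp
        qed simp
      qed
      also have "\<dots> = Pr (rvec (Suc m)) (ext_hyperplane m ?w)"
      proof -
        have "Pr (rvec (Suc m)) (ext_hyperplane m ?w)
            = Mean (rvec (Suc m)) (indicat_real (ext_hyperplane m ?w))" by simp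
        also have "\<dots> = Mean (PP C) (\<lambda>c. indicat_real (ext_hyperplane m ?w) (c \<circ> (\<lambda>j. (m, j))))"
          unfolding rowC by (rule integral_map_pmf)
        finally show ?thesis by simp
      qed
      finally show ?thesis .
    qed
    then have "Mean (PP B) (\<lambda>b. Mean (PP C) (\<lambda>c. indicat_real bad (glue a b c))) \<le>
      Mean (PP B) (\<lambda>b. Pr (rvec (Suc m)) (ext_hyperplane m (lin_sol m a (b \<circ> (\<lambda>i. (i, m))))))"
      by (intro integral_mono integrable_measure_pmf_finite finP fins)
    also have "\<dots> = Mean (rvec m) (\<lambda>Y. Pr (rvec (Suc m)) (ext_hyperplane m (lin_sol m a Y)))"
      unfolding colB by (rule integral_map_pmf[symmetric])
    also have "\<dots> \<le> \<rho>" by (rule \<rho>[OF nsa])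
    finally show ?thesis using True by simp
  qed
  have "Pr (PP (A \<union> (B \<union> C))) bad = Mean (PP (A \<union> (B \<union> C))) (indicat_real bad)" by simp
  also have "\<dots> = Mean (PP A) (\<lambda>a. Mean (PP B) (\<lambda>b. Mean (PP C) (\<lambda>c. indicat_real bad (glue a b
      c))))"
    unfolding PP_def using fins disj fin
    by (subst expectation_Pi_pmf_union, simp_all, subst expectation_Pi_pmf_union, simp_all add:
        glue_def)
  also have "\<dots> \<le> Mean (PP A) (\<lambda>a. indicat_real {f. lead_nonsing m f} a * \<rho>)"
    by (intro integral_mono integrable_measure_pmf_finite finP fins inner)
  also have "\<dots> = \<rho> * prob_lead_nonsing m" by (simp add: prob_lead_nonsing_def PP_def A_def
      mult.commute)
  finally have bad: "Pr (sqmat (Suc m)) bad \<le> \<rho> * prob_lead_nonsing m" unfolding un .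
  have "prob_lead_nonsing m = Pr (sqmat (Suc m)) {f. lead_nonsing m f}"
    unfolding prob_lead_nonsing_def by (rule prob_corner[symmetric]) (auto intro!:
        lead_nonsing_cong)
  also have "\<dots> \<le> Pr (sqmat (Suc m)) ({f. lead_nonsing (Suc m) f} \<union> bad)"
    by (intro measure_pmf.finite_measure_mono) (auto simp: bad_def lead_nonsing_Suc)
  also have "\<dots> \<le> prob_lead_nonsing (Suc m) + Pr (sqmat (Suc m)) bad"
    unfolding prob_lead_nonsing_def by (rule measure_Un_le) auto
  finally show ?thesis using bad by (simp add: algebra_simps)
qed

text \<open>The hyperplane is spanned by the m vectors e_j + w j e_m in dimension m + 1, so that
  Odlyzko's bound leaves one power of \<beta>.\<close>

lemma prob_ext_hyperplane_le_\<beta>: "Pr (rvec (Suc m)) (ext_hyperplane m w) \<le> \<beta>"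
proof -
  define a where "a j i = (if i = j then 1 else if i = m then w j else 0)" for j i :: nat
  have "ext_hyperplane m w \<subseteq> {X. \<exists>c. \<forall>i<Suc m. X i = 0 + (\<Sum>j\<in>{..<m}. c j * a j i)}"
  proof (intro subsetI CollectI exI allI impI)
    fix X i assume X: "X \<in> ext_hyperplane m w" and i: "i < Suc m"
    have Xm: "(\<Sum>j<m. X j * w j) = X m" using X by (simp add: ext_hyperplane_def)
    show "X i = 0 + (\<Sum>j\<in>{..<m}. X j * a j i)"
    proof (cases "i = m")
      case True
      then have "(\<Sum>j\<in>{..<m}. X j * a j i) = (\<Sum>j<m. X j * w j)"
        by (intro sum.cong) (auto simp: a_def)
      with Xm True show ?thesis by simp
    next
      case False
      then have "(\<Sum>j\<in>{..<m}. X j * a j i) = (\<Sum>j\<in>{..<m}. if j = i then X j else 0)"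
        by (intro sum.cong) (auto simp: a_def)
      with False i show ?thesis by simp
    qed
  qed
  then have "Pr (rvec (Suc m)) (ext_hyperplane m w) \<le> Pr (rvec (Suc m)) {X. \<exists>c. \<forall>i<Suc m. X i
      = 0 + (\<Sum>j\<in>{..<m}. c j * a j i)}"
    by (intro measure_pmf.finite_measure_mono) auto
  also have "\<dots> \<le> \<beta> ^ (Suc m - card {..<m})" using odlyzko[of "{..<m}" "Suc m" "\<lambda>_. 0" a] by simp
  finally show ?thesis by simp
qed

text \<open>The crude rate \<beta> gives (1 - \<beta>)^m, which is too small for large m but
  provides a positive start for the subexponential bound.\<close>

lemma prob_lead_nonsing_pos:
  assumes "\<beta> < 1"
  shows "0 < prob_lead_nonsing m"
proof (induction m)
  case 0
  have "{f. lead_nonsing 0 f} = UNIV" by (auto simp: lead_nonsing_def)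
  then show ?case by (simp add: prob_lead_nonsing_def)
next
  case (Suc m)
  have "(1 - \<beta>) * prob_lead_nonsing m \<le> prob_lead_nonsing (Suc m)"
  proof (rule prob_lead_nonsing_step)
    fix f
    have "Mean (rvec m) (\<lambda>Y. Pr (rvec (Suc m)) (ext_hyperplane m (lin_sol m f Y)))
        \<le> Mean (rvec m) (\<lambda>Y. \<beta>)"
      by (intro integral_mono integrable_measure_pmf_finite finite_rvec prob_ext_hyperplane_le_\<beta>)
    then show "Mean (rvec m) (\<lambda>Y. Pr (rvec (Suc m)) (ext_hyperplane m (lin_sol m f Y))) \<le> \<beta>" by simp
  qed
  then show ?case using Suc assms by (smt (verit) mult_pos_pos)
qed

text \<open>A solution supported on J puts Y into the span of card J columns, which by Odlyzko has
  probability at most \<beta>^(m - card J), hence at most \<beta>^(m / 2) for c \<le> 1/2. The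
  constant c is also so small that the number of sets J costs only half of this exponent.\<close>

lemma prob_sparse_solution:
  assumes "\<beta> < 1"
  obtains c c' where "0 < c" "0 < c'" "\<forall>m f. nonsing m f \<longrightarrow>
    Pr (rvec m) {Y. real (card {j. j < m \<and> lin_sol m f Y j \<noteq> 0}) \<le> c * real m}
        \<le> exp (- c' * real m)"
proof -
  define L where "L = - ln \<beta>"
  have L: "L > 0" and \<beta>e: "\<beta> = exp (- L)" using assms \<beta>_pos by (auto simp: L_def)
  have lim: "((\<lambda>l::real. 1 + exp (-l)) \<longlongrightarrow> 1) at_top" by real_asymp
  have "eventually (\<lambda>l::real. 1 + exp (-l) < exp (L / 8)) at_top"
    by (rule order_tendstoD(2)[OF lim]) (use L in simp)
  then have "eventually (\<lambda>l::real. 1 + exp (-l) < exp (L / 8) \<and> l > 0) at_top"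
    using eventually_gt_at_top[of "0::real"] by eventually_elim auto
  then obtain l :: real where l: "1 + exp (-l) < exp (L / 8)" "l > 0"
    unfolding eventually_at_top_linorder by blast
  define c where "c = min (1/2) (L / (8 * l))"
  have c: "0 < c" "c \<le> 1/2" "l * c \<le> L / 8"
  proof -
    show "0 < c" "c \<le> 1/2" using L l by (auto simp: c_def)
    have "l * c \<le> l * (L / (8 * l))" using l by (intro mult_left_mono) (auto simp: c_def)
    then show "l * c \<le> L / 8" using l by simp
  qed
  show thesis
  proof (rule that[of c "L / 4"], goal_cases)
    case 3
    show ?case
    proof (intro allI impI)
      fix m f assume nonsing: "nonsing m f"
      define \<J> where "\<J> = {J. J \<subseteq> {..<m} \<and> real (card J) \<le> c * real m}"
      define S where "S J = {Y. \<exists>d. \<forall>i<m. Y i = 0 + (\<Sum>j\<in>J. d j * f (i, j))}" for J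
      have fin\<J>: "finite \<J>" unfolding \<J>_def by (rule finite_subset[of _ "Pow {..<m}"]) auto
      have "{Y. real (card {j. j < m \<and> lin_sol m f Y j \<noteq> 0}) \<le> c * real m} \<subseteq> (\<Union>J\<in>\<J>. S J)"
      proof
        fix Y assume Y: "Y \<in> {Y. real (card {j. j < m \<and> lin_sol m f Y j \<noteq> 0}) \<le> c * real m}"
        define J where "J = {j. j < m \<and> lin_sol m f Y j \<noteq> 0}"
        have "J \<in> \<J>" using Y by (auto simp: \<J>_def J_def)
        moreover have "Y \<in> S J" unfolding S_def mem_Collect_eq
        proof (intro exI[of _ "lin_sol m f Y"] allI impI)
          fix i assume "i < m"
          then have "Y i = mv m f (lin_sol m f Y) i" using lin_sol[OF nonsing] by simp
          also have "\<dots> = (\<Sum>j\<in>J. lin_sol m f Y j * f (i, j))"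
            unfolding mv_def by (rule sum.mono_neutral_cong_right) (auto simp: J_def)
          finally show "Y i = 0 + (\<Sum>j\<in>J. lin_sol m f Y j * f (i, j))" by simp
        qed
        ultimately show "Y \<in> (\<Union>J\<in>\<J>. S J)" by blast
      qed
      then have "Pr (rvec m) {Y. real (card {j. j < m \<and> lin_sol m f Y j \<noteq> 0}) \<le> c * real m}
          \<le> Pr (rvec m) (\<Union>J\<in>\<J>. S J)"
        by (intro measure_pmf.finite_measure_mono) auto
      also have "\<dots> \<le> (\<Sum>J\<in>\<J>. Pr (rvec m) (S J))"
        using fin\<J> by (intro measure_pmf.finite_measure_subadditive_finite) auto
      also have "\<dots> \<le> (\<Sum>J\<in>\<J>. exp (- L * real m / 2))"
      proof (rule sum_mono)
        fix J assume J: "J \<in> \<J>"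
        then have fJ: "finite J" unfolding \<J>_def using finite_subset by blast
        have "Pr (rvec m) (S J) \<le> \<beta> ^ (m - card J)"
          unfolding S_def using odlyzko[OF fJ, of m "\<lambda>_. 0" "\<lambda>j i. f (i, j)"] by simp
        also have "\<dots> = exp (- L * real (m - card J))"
          unfolding \<beta>e by (simp add: exp_of_nat_mult[symmetric] mult.commute)
        also have "\<dots> \<le> exp (- L * real m / 2)"
        proof -
          have "c * real m \<le> 1/2 * real m" using c(2) by (intro mult_right_mono) auto
          then have "real m / 2 \<le> real (m - card J)" using J by (simp add: \<J>_def)
          then have "L * (real m / 2) \<le> L * real (m - card J)" using L
            by (intro mult_left_mono) auto
          then show ?thesis by simp
        qed
        finally show "Pr (rvec m) (S J) \<le> exp (- L * real m / 2)" .
      qed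
      also have "\<dots> = card \<J> * exp (- L * real m / 2)" by simp
      also have "\<dots> \<le> exp (L / 8) ^ m * exp (L / 8) ^ m * exp (- L * real m / 2)"
      proof (intro mult_right_mono)
        have "real (card \<J>) \<le> exp (l * (c * real m)) * (1 + exp (-l)) ^ m"
          unfolding \<J>_def by (rule card_small_subsets[OF l(2)])
        also have "\<dots> \<le> exp (L / 8) ^ m * exp (L / 8) ^ m"
        proof (intro mult_mono power_mono)
          have "l * c * real m \<le> L / 8 * real m" using c(3) by (intro mult_right_mono) auto
          then show "exp (l * (c * real m)) \<le> exp (L / 8) ^ m"
            by (simp add: exp_of_nat_mult[symmetric] mult_ac)
        qed (use l in \<open>auto simp: add_nonneg_nonneg\<close>)
        finally show "real (card \<J>) \<le> exp (L / 8) ^ m * exp (L / 8) ^ m" .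
      qed simp
      also have "\<dots> = exp (- (L / 4) * real m)"
        by (simp add: exp_of_nat_mult[symmetric] exp_add[symmetric] field_simps)
      finally show "Pr (rvec m) {Y. real (card {j. j < m \<and> lin_sol m f Y j \<noteq> 0}) \<le> c * real m}
          \<le> exp (- (L / 4) * real m)" .
    qed
  qed (use c L in auto)
qed

text \<open>Sparse solutions are exponentially rare and dense ones fail with probability of order
  m^(-1/2), so the probability decays no faster than the product of 1 - E / sqrt k; the sum of
  k^(-1/2) up to m is of order sqrt m.\<close>

lemma prob_lead_nonsing_lower_bound:
  assumes "\<beta> < 1"
  obtains a C where "0 < a" "0 < C" "\<forall>\<^sub>F m in sequentially. a * exp (- C * sqrt (real m))
      \<le> prob_lead_nonsing m"
proof -
  obtain c c' where c: "0 < c" "0 < c'" and sparse: "\<forall>m f. nonsing m f \<longrightarrow>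
    Pr (rvec m) {Y. real (card {j. j < m \<and> lin_sol m f Y j \<noteq> 0}) \<le> c * real m}
        \<le> exp (- c' * real m)"
    by (rule prob_sparse_solution[OF assms])
  define D where "D = exp (1/2) * (3 * exp 1 + 1) / sqrt c0"
  have D: "D > 0" using c0 by (simp add: D_def add_pos_pos)
  define E where "E = 1 + D / sqrt c"
  have E: "E > 0" using D c by (simp add: E_def add_pos_nonneg)
  define \<rho> where "\<rho> m = exp (- c' * real m) + D / sqrt (c * real m)" for m :: nat
  have qstep: "(1 - \<rho> m) * prob_lead_nonsing m \<le> prob_lead_nonsing (Suc m)" if m: "m \<ge> 1" for m
  proof (rule prob_lead_nonsing_step)
    fix f assume nonsing: "nonsing m f"
    define B where "B = {Y. real (card {j. j < m \<and> lin_sol m f Y j \<noteq> 0}) \<le> c * real m}"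
    have cm: "c * real m > 0" using c m by simp
    have "Pr (rvec (Suc m)) (ext_hyperplane m (lin_sol m f Y))
        \<le> indicat_real B Y + D / sqrt (c * real m)" for Y
    proof (cases "Y \<in> B")
      case True
      have "Pr (rvec (Suc m)) (ext_hyperplane m (lin_sol m f Y)) \<le> 1" by simp
      moreover have "0 \<le> D / sqrt (c * real m)" using D cm by simp
      ultimately show ?thesis using True by (simp add: add_increasing2)
    next
      case False
      define J where "J = {j. j < m \<and> lin_sol m f Y j \<noteq> 0}"
      have J: "c * real m < real (card J)" using False by (simp add: B_def J_def)
      then have "J \<noteq> {}" using cm by auto
      have "Pr (rvec (Suc m)) (ext_hyperplane m (lin_sol m f Y)) \<le> D / sqrt (card J)"
        unfolding ext_hyperplane_def D_def by (rule littlewood_offord) (use \<open>J \<noteq> {}\<close> in \<open>auto simp: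
            J_def\<close>)
      also have "\<dots> \<le> D / sqrt (c * real m)" using J cm D by (intro divide_left_mono) auto
      finally show ?thesis using False by simp
    qed
    then have "Mean (rvec m) (\<lambda>Y. Pr (rvec (Suc m)) (ext_hyperplane m (lin_sol m f Y))) \<le>
       Mean (rvec m) (\<lambda>Y. indicat_real B Y + D / sqrt (c * real m))"
      by (intro integral_mono integrable_measure_pmf_finite finite_rvec)
    also have "\<dots> = Pr (rvec m) B + D / sqrt (c * real m)"
      by (subst Bochner_Integration.integral_add) (auto intro!: integrable_measure_pmf_finite)
    also have "Pr (rvec m) B \<le> exp (- c' * real m)" unfolding B_def
      by (rule sparse[rule_format, OF nonsing])
    finally show "Mean (rvec m) (\<lambda>Y. Pr (rvec (Suc m)) (ext_hyperplane m (lin_sol m f Y))) \<le> \<rho> m"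
      by (simp add: \<rho>_def)
  qed
  have "\<forall>\<^sub>F m in sequentially. exp (- c' * real m) \<le> 1 / sqrt (real m)" using c by real_asymp
  moreover have "\<forall>\<^sub>F m in sequentially. E / sqrt (real m) \<le> 1/2" using E by real_asymp
  ultimately have "\<forall>\<^sub>F m in sequentially. \<rho> m \<le> E / sqrt (real m) \<and> E / sqrt (real m) \<le> 1/2 \<and> 1 \<le> m"
    using eventually_ge_at_top[of 1]
  proof eventually_elim
    case (elim m)
    have "D / sqrt (c * real m) = D / sqrt c / sqrt (real m)" by (simp add: real_sqrt_mult)
    moreover have "E / sqrt (real m) = 1 / sqrt (real m) + D / sqrt c / sqrt (real m)"
      by (simp add: E_def add_divide_distrib)
    ultimately show ?case using elim unfolding \<rho>_def by linarith
  qed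
  then obtain m0 where m0: "\<And>m. m \<ge> m0 \<Longrightarrow> \<rho> m \<le> E / sqrt (real m) \<and> E / sqrt (real m) \<le> 1/2 \<and> 1 \<le> m"
    unfolding eventually_sequentially by blast
  \<comment> \<open>A factor 2 comes from 1 - e \<ge> exp(-2 e) for 0 \<le> e \<le> 1/2, a factor 3
    from sqrt (m + 1) - sqrt m \<ge> 1 / (3 sqrt m).\<close>
  define C where "C = 6 * E"
  have lower: "prob_lead_nonsing m0 * exp (- C * sqrt (real m))
      \<le> prob_lead_nonsing m" if "m \<ge> m0" for m
    using that
  proof (induction m rule: dec_induct)
    case base
    have "exp (- C * sqrt (real m0)) \<le> 1" using E by (simp add: C_def)
    then show ?case using prob_lead_nonsing_pos[OF assms, of m0] by simp
  next
    case (step m)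
    define e where "e = E / sqrt (real m)"
    have e: "\<rho> m \<le> e" "0 \<le> e" "e \<le> 1/2" "m \<ge> 1" using m0[OF step(1)] E by (auto simp: e_def)
    have sm: "sqrt (real m) > 0" using e by simp
    have d: "2 * e \<le> C * (sqrt (real (Suc m)) - sqrt (real m))"
    proof -
      have "sqrt (real (Suc m)) \<le> sqrt (4 * real m)" using e by (intro real_sqrt_le_mono) auto
      also have "\<dots> = 2 * sqrt (real m)" by (simp add: real_sqrt_mult)
      finally have b: "sqrt (real (Suc m)) + sqrt (real m) \<le> 3 * sqrt (real m)" by simp
      have "(sqrt (real (Suc m)) - sqrt (real m)) * (sqrt (real (Suc m)) + sqrt (real m)) = 1"
        by (simp add: algebra_simps)
      moreover have "(sqrt (real (Suc m)) - sqrt (real m)) * (sqrt (real (Suc m)) + sqrt (real m)) \<le>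
         (sqrt (real (Suc m)) - sqrt (real m)) * (3 * sqrt (real m))" using b
           by (intro mult_left_mono) auto
      ultimately have "1 / (3 * sqrt (real m)) \<le> sqrt (real (Suc m)) - sqrt (real m)" using sm
        by (simp add: field_simps)
      then have "C * (1 / (3 * sqrt (real m))) \<le> C * (sqrt (real (Suc m)) - sqrt (real m))"
        using E by (intro mult_left_mono) (auto simp: C_def)
      then show ?thesis by (simp add: C_def e_def)
    qed
    have "exp (- (2 * e)) \<le> 1 - e"
    proof -
      have "0 \<le> e * (1 - 2 * e)" using e by (intro mult_nonneg_nonneg) auto
      then have "1 \<le> (1 - e) * (1 + 2 * e)" by (simp add: algebra_simps)
      also have "\<dots> \<le> (1 - e) * exp (2 * e)" using e exp_ge_add_one_self[of "2 * e"]
        by (intro mult_left_mono) auto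
      finally show ?thesis by (simp add: exp_minus field_simps)
    qed
    then have fac: "exp (- (2 * e)) \<le> 1 - \<rho> m" using e by linarith
    have "exp (- C * sqrt (real (Suc m))) \<le> exp (- C * sqrt (real m)) * exp (- (2 * e))"
      using d by (simp add: exp_add[symmetric] algebra_simps)
    then have "prob_lead_nonsing m0 * exp (- C * sqrt (real (Suc m)))
        \<le> prob_lead_nonsing m0 * (exp (- C * sqrt (real m)) * exp (- (2 * e)))"
      using prob_lead_nonsing_pos[OF assms, of m0] by (intro mult_left_mono) auto
    also have "\<dots> = exp (- (2 * e)) * (prob_lead_nonsing m0 * exp (- C * sqrt (real m)))" by simp
    also have "\<dots> \<le> (1 - \<rho> m) * prob_lead_nonsing m"
    proof (intro mult_mono fac step.IH)
      show "0 \<le> 1 - \<rho> m" using e by linarith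
      show "0 \<le> prob_lead_nonsing m0 * exp (- C * sqrt (real m))"
        using prob_lead_nonsing_pos[OF assms, of m0] by simp
    qed
    also have "\<dots> \<le> prob_lead_nonsing (Suc m)" by (rule qstep[OF e(4)])
    finally show ?case .
  qed
  show thesis
  proof (rule that[of "prob_lead_nonsing m0" C])
    show "\<forall>\<^sub>F m in sequentially. prob_lead_nonsing m0 * exp (- C * sqrt (real m))
        \<le> prob_lead_nonsing m"
      unfolding eventually_sequentially using lower by blast
  qed (use E prob_lead_nonsing_pos[OF assms] in \<open>auto simp: C_def\<close>)
qed

end

section \<open>The growth factor of a well-conditioned matrix\<close>

text \<open>The least singular value of the leading k x k block is at least s; the homogeneous form
  also makes sense for k = 0.\<close>

definition well_cond :: "real \<Rightarrow> nat \<Rightarrow> (nat \<times> nat \<Rightarrow> real) \<Rightarrow> bool" where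
  "well_cond s k f \<longleftrightarrow> (\<forall>x. s * vnorm k x \<le> L2_set (mv k f x) {..<k})"

lemma well_cond_imp_nonsing:
  assumes "well_cond s k f" "s > 0"
  shows "nonsing k f"
  unfolding nonsing_def
proof (intro allI impI)
  fix x j assume x: "\<forall>i<k. mv k f x i = 0" and j: "j < k"
  have "s * vnorm k x \<le> L2_set (mv k f x) {..<k}" using assms(1) by (simp add: well_cond_def)
  also have "\<dots> = 0" using x by (intro L2_set_0') auto
  finally have "vnorm k x = 0" using assms(2) L2_set_nonneg[of x "{..<k}"]
    by (simp add: mult_le_0_iff) 
  then show "x j = 0" using j by (simp add: L2_set_eq_0_iff)
qed

lemma well_condI:
  assumes "\<And>x. vnorm k x = 1 \<Longrightarrow> s \<le> L2_set (mv k f x) {..<k}"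
  shows "well_cond s k f"
  unfolding well_cond_def
proof
  fix x
  show "s * vnorm k x \<le> L2_set (mv k f x) {..<k}"
  proof (cases "vnorm k x = 0")
    case False
    define N where "N = vnorm k x"
    have N: "N > 0" using False L2_set_nonneg[of x "{..<k}"] unfolding N_def by linarith
    have "L2_set (\<lambda>j. (1 / N) * x j) {..<k} = 1" using N
      by (simp only: L2_set_scale) (simp add: N_def)
    then have "s \<le> L2_set (mv k f (\<lambda>j. (1 / N) * x j)) {..<k}" by (rule assms)
    also have "\<dots> = (1 / N) * L2_set (mv k f x) {..<k}" using N
      by (simp only: mv_scale[abs_def] L2_set_scale) simp
    finally show ?thesis using N by (simp add: N_def[symmetric] field_simps)
  qed simp
qed

text \<open>A left inverse B gives |x| \<le> b |f x| with b the sum of its absolute entries; 1 + b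
  avoids division by 0 for k = 0.\<close>

lemma nonsing_imp_well_cond:
  assumes "nonsing k f"
  shows "\<exists>s>0. well_cond s k f"
proof -
  have c: "Matrix.mat k k f \<in> carrier_mat k k" by simp
  have "Determinant.det (Matrix.mat k k f) \<noteq> 0" using assms nonsing_iff_det by blast
  then obtain B where B: "B \<in> carrier_mat k k" "B * Matrix.mat k k f = 1\<^sub>m k"
    by (rule nonsing_inverse[OF c])
  define b where "b = (\<Sum>i<k. \<Sum>l<k. \<bar>B $$ (i, l)\<bar>)"
  have b0: "b \<ge> 0" by (simp add: b_def sum_nonneg)
  have "well_cond (1 / (1 + b)) k f"
    unfolding well_cond_def
  proof
    fix x :: "nat \<Rightarrow> real"
    define v where "v = Matrix.vec k x"
    have v: "v \<in> carrier_vec k" by (simp add: v_def)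
    have xi: "x i = (\<Sum>l<k. B $$ (i, l) * mv k f x l)" if i: "i < k" for i
    proof -
      have "B *\<^sub>v (Matrix.mat k k f *\<^sub>v v) = v"
        using assoc_mult_mat_vec[OF B(1) c v] B(2) v by simp
      then have "x i = (B *\<^sub>v (Matrix.mat k k f *\<^sub>v v)) $ i" using i by (simp add: v_def)
      also have "\<dots> = (\<Sum>l<k. B $$ (i, l) * (Matrix.mat k k f *\<^sub>v v) $ l)"
        using B(1) i by (auto simp: scalar_prod_def lessThan_atLeast0 intro!: sum.cong)
      also have "\<dots> = (\<Sum>l<k. B $$ (i, l) * mv k f x l)"
      proof (intro sum.cong refl)
        fix l assume l: "l \<in> {..<k}"
        then have "(Matrix.mat k k f *\<^sub>v v) $ l = mv k f (\<lambda>j. v $ j) l"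
          by (intro mult_mat_vec_mv[OF v]) simp
        also have "\<dots> = mv k f x l" unfolding mv_def by (intro sum.cong) (auto simp: v_def)
        finally show "B $$ (i, l) * (Matrix.mat k k f *\<^sub>v v) $ l = B $$ (i, l) * mv k f x l" by simp
      qed
      finally show ?thesis .
    qed
    define R where "R = L2_set (mv k f x) {..<k}"
    have R: "\<bar>mv k f x l\<bar> \<le> R" if "l < k" for l
      using member_le_L2_set[of "{..<k}" l "\<lambda>l. \<bar>mv k f x l\<bar>"] that by (simp add: R_def L2_set_def)
    have "vnorm k x \<le> (\<Sum>i<k. \<bar>x i\<bar>)" by (rule L2_set_le_sum_abs)
    also have "\<dots> \<le> (\<Sum>i<k. \<Sum>l<k. \<bar>B $$ (i, l)\<bar> * R)"
    proof (rule sum_mono)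
      fix i assume i: "i \<in> {..<k}"
      have "\<bar>x i\<bar> \<le> (\<Sum>l<k. \<bar>B $$ (i, l) * mv k f x l\<bar>)" using xi[of i] i by (simp add: sum_abs)
      also have "\<dots> \<le> (\<Sum>l<k. \<bar>B $$ (i, l)\<bar> * R)"
        unfolding abs_mult using R by (intro sum_mono mult_left_mono) auto
      finally show "\<bar>x i\<bar> \<le> (\<Sum>l<k. \<bar>B $$ (i, l)\<bar> * R)" .
    qed
    also have "\<dots> = b * R" by (simp add: b_def sum_distrib_right)
    also have "\<dots> \<le> (1 + b) * R" by (simp add: R_def mult_right_mono)
    finally show "1 / (1 + b) * vnorm k x \<le> L2_set (mv k f x) {..<k}"
      using b0 by (simp add: R_def[symmetric] field_simps)
  qed
  then show ?thesis using b0 by (intro exI[of _ "1 / (1 + b)"]) auto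
qed

lemma well_cond_mono: "well_cond s k f \<Longrightarrow> t \<le> s \<Longrightarrow> well_cond t k f"
  unfolding well_cond_def by (meson L2_set_nonneg mult_right_mono order_trans)

lemma well_cond_cong:
  assumes "\<And>i j. i < k \<Longrightarrow> j < k \<Longrightarrow> f (i, j) = g (i, j)"
  shows "well_cond s k f \<longleftrightarrow> well_cond s k g"
proof -
  have "L2_set (mv k f x) {..<k} = L2_set (mv k g x) {..<k}" for x
    by (intro L2_set_cong mv_cong) (use assms in auto)
  then show ?thesis by (simp add: well_cond_def)
qed

lemma well_cond_solve:
  assumes "well_cond s k f" "s > 0"
  obtains x where "\<And>i. i < k \<Longrightarrow> mv k f x i = y i" "vnorm k x \<le> vnorm k y / s"
proof -
  obtain x where x: "\<forall>i<k. mv k f x i = y i" using nonsing_solve[OF well_cond_imp_nonsing[OF assms],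
      of y] by blast
  have "s * vnorm k x \<le> L2_set (mv k f x) {..<k}" using assms by (simp add: well_cond_def)
  also have "\<dots> = vnorm k y" using x by (intro L2_set_cong) auto
  finally show thesis using that[of x] x assms(2) by (simp add: field_simps)
qed

section \<open>Entrywise bounds on the factors L and U\<close>

lemma abs_mv_le:
  assumes "\<And>j. j < k \<Longrightarrow> \<bar>f (i, j)\<bar> \<le> M" "M \<ge> 0"
  shows "\<bar>mv k f x i\<bar> \<le> sqrt k * M * vnorm k x"
proof -
  have "\<bar>mv k f x i\<bar> \<le> (\<Sum>j<k. \<bar>f (i, j)\<bar> * \<bar>x j\<bar>)" unfolding mv_def
    by (rule order_trans[OF sum_abs]) (simp add: abs_mult)
  also have "\<dots> \<le> (\<Sum>j<k. M * \<bar>x j\<bar>)" using assms by (intro sum_mono mult_right_mono) auto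
  also have "\<dots> = M * (\<Sum>j<k. \<bar>x j\<bar>)" by (simp add: sum_distrib_left)
  also have "\<dots> \<le> M * (sqrt k * vnorm k x)" using assms by (intro mult_left_mono sum_abs_le_sqrt_L2)
  finally show ?thesis by (simp add: mult_ac)
qed

text \<open>Forward substitution, as an induction over the rows.\<close>

lemma unitriangular_injective:
  fixes l :: "nat \<Rightarrow> nat \<Rightarrow> real"
  assumes diag: "\<And>i. i < k \<Longrightarrow> l i i = 1" and low: "\<And>i j. i < j \<Longrightarrow> j < k \<Longrightarrow> l i j = 0"
    and eq: "\<And>i. i < k \<Longrightarrow> (\<Sum>j<k. l i j * d j) = 0" and i: "i < k"
  shows "d i = 0"
  using i
proof (induction i rule: less_induct)
  case (less i)
  have "(\<Sum>j<k. l i j * d j) = (\<Sum>j\<in>{i}. l i j * d j)"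
  proof (rule sum.mono_neutral_right)
    show "\<forall>j\<in>{..<k} - {i}. l i j * d j = 0"
    proof
      fix j assume j: "j \<in> {..<k} - {i}"
      then consider "j < i" | "i < j" by force
      then show "l i j * d j = 0" using j less low[of i j] by cases auto
    qed
  qed (use less in auto)
  then show ?case using eq[OF less.prems] diag[OF less.prems] by simp
qed

text \<open>The two formulas are obtained without writing inverses. If the block of order j + 1 maps
  x to the unit vector y at j, then L (U x) = y = L y on that block, since column j of L vanishes
  above the diagonal; hence U x = y, and row i > j of A applied to x gives
  \<open>L $$ (i, j)\<close>. Likewise, solving the block of order i against column j yields the
  part of that column of U above row i, and \<open>U $$ (i, j)\<close> is the remaining defect in
  row i.\<close>

lemma growth_le:
  assumes A: "A \<in> carrier_mat n n" and n: "n \<ge> 1" and s: "s > 0"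
    and K: "\<And>i j. i < n \<Longrightarrow> j < n \<Longrightarrow> \<bar>A $$ (i, j)\<bar> \<le> K"
    and wc: "\<And>k. k < n \<Longrightarrow> well_cond s k (\<lambda>ij. A $$ ij)"
  shows "growth A \<le> ereal (1 + real n * K / s)"
proof -
  define f where "f = (\<lambda>ij. A $$ ij)"
  have K0: "K \<ge> 0" using K[of 0 0] n by simp
  have sn: "strongly_nonsingular (leading_principal_submatrix (n - 1) A)"
    unfolding strongly_nonsingular_def
  proof (intro conjI ballI)
    fix k assume "k \<in> {1..dim_row (leading_principal_submatrix (n - 1) A)}"
    then have k: "k \<le> n - 1" "k < n" using n by auto
    have "leading_principal_submatrix k A = Matrix.mat k k f"
      by (simp add: leading_principal_submatrix_def f_def)
    moreover have "Determinant.det (Matrix.mat k k f) \<noteq> 0"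
      using well_cond_imp_nonsing[OF wc[OF k(2)] s] by (simp add: nonsing_iff_det f_def)
    ultimately show "Determinant.det (leading_principal_submatrix k (leading_principal_submatrix (n
        - 1) A)) \<noteq> 0"
      using lps_lps[OF k(1), of A] by simp
  qed simp
  have ex1: "\<exists>!LU. case LU of (L, U) \<Rightarrow> is_LU A L U" by (rule ex1_LU[OF A sn])
  then obtain LU where LU: "case LU of (L, U) \<Rightarrow> is_LU A L U" by blast
  obtain L U where LU_eq: "LU = (L, U)" by (cases LU)
  have isLU: "is_LU A L U" using LU LU_eq by simp
  have the: "(THE (L, U). is_LU A L U) = (L, U)"
    using the1_equality[OF ex1 LU] unfolding LU_eq by simp
  have Lc: "L \<in> carrier_mat n n" and Uc: "U \<in> carrier_mat n n" and lu: "lower_unitriangular L" and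
      ut: "upper_triangular U"
    and prod: "A = L * U" using isLU A by (auto simp: is_LU_def)
  have Ld: "L $$ (i, i) = 1" if "i < n" for i using lu Lc that
    by (auto simp: lower_unitriangular_def)
  have L0: "L $$ (i, j) = 0" if "i < j" "j < n" for i j using lu Lc that
    by (auto simp: lower_unitriangular_def)
  have U0: "U $$ (i, j) = 0" if "j < i" "i < n" for i j using ut Uc that
    by (auto simp: upper_triangular_def)
  have Aij: "A $$ (i, j) = (\<Sum>l<n. L $$ (i, l) * U $$ (l, j))" if "i < n" "j < n" for i j
    unfolding prod using that Lc Uc by (auto simp: scalar_prod_def lessThan_atLeast0 intro!:
        sum.cong)
  define Ux where "Ux k x l = (\<Sum>r<k. U $$ (l, r)
      * x r)" for k :: nat and x :: "nat \<Rightarrow> real" and l :: nat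
  have mvA: "mv k f x i = (\<Sum>l<k. L $$ (i, l) * Ux k x l)" if "i < n" "k \<le> n" for k x i
  proof -
    have "mv k f x i = (\<Sum>r<k. (\<Sum>l<k. L $$ (i, l) * U $$ (l, r)) * x r)"
      unfolding mv_def
    proof (intro sum.cong refl)
      fix r assume r: "r \<in> {..<k}"
      have "A $$ (i, r) = (\<Sum>l<n. L $$ (i, l) * U $$ (l, r))" using that r by (intro Aij) auto
      also have "\<dots> = (\<Sum>l<k. L $$ (i, l) * U $$ (l, r))"
        using that r by (intro sum.mono_neutral_right) (auto simp: U0)
      finally show "f (i, r) * x r = (\<Sum>l<k. L $$ (i, l) * U $$ (l, r)) * x r" by (simp add: f_def)
    qed
    also have "\<dots> = (\<Sum>l<k. L $$ (i, l) * Ux k x l)"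
      unfolding Ux_def sum_distrib_left sum_distrib_right by (subst sum.swap) (simp add: mult_ac)
    finally show ?thesis .
  qed
  have sqn: "sqrt k \<le> real n" if "k \<le> n" for k
  proof -
    have "k \<le> n * n" using that le_square[of n] by (rule order_trans)
    then have "real k \<le> real n * real n" by (simp flip: of_nat_mult)
    then have "sqrt k \<le> sqrt (real n * real n)" by (rule real_sqrt_le_mono)
    then show ?thesis by simp
  qed
  have Lbound: "\<bar>L $$ (i, j)\<bar> \<le> 1 + real n * K / s" if ij: "i < n" "j < n" for i j
  proof -
    have nn: "0 \<le> real n * K / s" using K0 s by simp
    consider "i < j" | "i = j" | "j < i" by linarith
    then show ?thesis
    proof cases
      case 1 then show ?thesis using L0[of i j] ij nn by simp
    next
      case 2 then show ?thesis using Ld[of i] ij nn by simp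
    next
      case 3
      \<comment> \<open>The block has to contain the index j, and j < i < n keeps its order below
        n.\<close>
      define k where "k = Suc j"
      have k: "k < n" "k \<le> n" "j < k" using 3 ij by (auto simp: k_def)
      define y where "y r = (if r = j then 1 else 0 :: real)" for r
      obtain x where x: "\<And>r. r < k \<Longrightarrow> mv k f x r = y r" "vnorm k x \<le> vnorm k y / s"
        using well_cond_solve[OF wc[OF k(1)] s, of y] unfolding f_def by blast
      have y1: "vnorm k y = 1" using k by (simp add: L2_set_def y_def if_distrib[of "\<lambda>x. x\<^sup>2"] cong:
          if_cong)
      have Ly: "(\<Sum>l<k. L $$ (r, l) * y l) = L $$ (r, j)" for r using k(3)
        by (simp add: y_def if_distrib cong: if_cong)
      have Uxy: "Ux k x l - y l = 0" if "l < k" for l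
      proof (rule unitriangular_injective[where l = "\<lambda>i j. L $$ (i, j)" and k = k, OF _ _ _ that])
        fix r assume r: "r < k"
        have "(\<Sum>l<k. L $$ (r, l) * Ux k x l) = y r" using mvA[of r k x] x(1)[OF r] r k by simp
        moreover have "L $$ (r, j) = y r" using r L0[of r j] Ld[of j] ij k_def by (auto simp: y_def)
        ultimately show "(\<Sum>j<k. L $$ (r, j) * (Ux k x j - y j)) = 0"
          using Ly[of r] by (simp add: right_diff_distrib sum_subtractf)
      qed (use Ld L0 k in auto)
      have "mv k f x i = (\<Sum>l<k. L $$ (i, l) * Ux k x l)" using mvA ij k by simp
      also have "\<dots> = (\<Sum>l<k. L $$ (i, l) * y l)" using Uxy by (intro sum.cong) auto
      also have "\<dots> = L $$ (i, j)" by (rule Ly)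
      finally have "\<bar>L $$ (i, j)\<bar> \<le> sqrt k * K * vnorm k x"
        using abs_mv_le[of k f i K x] K ij k K0 unfolding f_def by simp
      also have "\<dots> \<le> real n * K * (1 / s)"
        using x(2) y1 sqn[OF k(2)] K0 by (intro mult_mono) auto
      finally show ?thesis by simp
    qed
  qed
  define M where "M = max_norm A"
  have setA: "{\<bar>X $$ (i, j)\<bar> | i j. i < dim_row X \<and> j < dim_col X}
      = (\<lambda>(i, j). \<bar>X $$ (i, j)\<bar>) ` ({..<n} \<times> {..<n})"
    if "X \<in> carrier_mat n n" for X :: "real mat" using that by (auto simp: image_def)
  have maxle: "max_norm X \<le> c" if "X \<in> carrier_mat n n" "\<And>i j. i < n \<Longrightarrow> j < n \<Longrightarrow> \<bar>X $$ (i, j)\<bar>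
      \<le> c" for X :: "real mat" and c
    unfolding max_norm_def setA[OF that(1)] using n that(2)
      by (intro Max.boundedI) (auto simp: lessThan_empty_iff)
  have Mge: "\<bar>A $$ (i, j)\<bar> \<le> M" if "i < n" "j < n" for i j
    unfolding M_def max_norm_def setA[OF A] using that
      by (intro Max_ge) (auto intro!: image_eqI[of _ _ "(i, j)"])
  have M0: "M \<ge> 0" using Mge[of 0 0] n by simp
  have MK: "M \<le> K" unfolding M_def using A K by (rule maxle)
  \<comment> \<open>One factor is the actual maximum M instead of K, so that it cancels in the
    quotient by \<open>max_norm A\<close>.\<close>
  have Ubound: "\<bar>U $$ (i, j)\<bar> \<le> M * (1 + real n * K / s)" if ij: "i < n" "j < n" for i j
  proof (cases "j < i")
    case True
    have "0 \<le> M * (1 + real n * K / s)" using M0 K0 s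
      by (intro mult_nonneg_nonneg add_nonneg_nonneg) auto
    then show ?thesis using U0[of j i] True ij by simp
  next
    case False
    define y where "y r = A $$ (r, j)" for r
    have ile: "i \<le> n" using ij by simp
    obtain x where x: "\<And>r. r < i \<Longrightarrow> mv i f x r = y r" "vnorm i x \<le> vnorm i y / s"
      using well_cond_solve[OF wc[OF ij(1)] s, of y] unfolding f_def by blast
    have Ay: "A $$ (r, j) = (\<Sum>l<i. L $$ (r, l) * U $$ (l, j)) + (if r
        = i then U $$ (i, j) else 0)" if r: "r \<le> i" for r
    proof -
      have "A $$ (r, j) = (\<Sum>l<n. L $$ (r, l) * U $$ (l, j))" using Aij r ij by simp
      also have "\<dots> = (\<Sum>l<Suc i. L $$ (r, l) * U $$ (l, j))"
        using r ij by (intro sum.mono_neutral_right) (auto simp: L0)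
      also have "\<dots> = (\<Sum>l<i. L $$ (r, l) * U $$ (l, j)) + L $$ (r, i) * U $$ (i, j)" by simp
      also have "L $$ (r, i) * U $$ (i, j) = (if r = i then U $$ (i, j) else 0)"
        using r ij L0[of r i] Ld[of i] by auto
      finally show ?thesis .
    qed
    have Uxy: "Ux i x l - U $$ (l, j) = 0" if "l < i" for l
    proof (rule unitriangular_injective[where l = "\<lambda>i j. L $$ (i, j)" and k = i, OF _ _ _ that])
      fix r assume r: "r < i"
      have "(\<Sum>l<i. L $$ (r, l) * Ux i x l) = A $$ (r, j)" using mvA[of r i x] x(1)[OF r] r ij
        by (simp add: y_def)
      then show "(\<Sum>l<i. L $$ (r, l) * (Ux i x l - U $$ (l, j))) = 0"
        using Ay[of r] r by (simp add: right_diff_distrib sum_subtractf)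
    qed (use Ld L0 ij in auto)
    have "mv i f x i = (\<Sum>l<i. L $$ (i, l) * Ux i x l)" by (rule mvA[OF ij(1) ile])
    also have "\<dots> = (\<Sum>l<i. L $$ (i, l) * U $$ (l, j))" using Uxy by (intro sum.cong) auto
    finally have "U $$ (i, j) = A $$ (i, j) - mv i f x i" using Ay[of i] by simp
    then have "\<bar>U $$ (i, j)\<bar> \<le> \<bar>A $$ (i, j)\<bar> + \<bar>mv i f x i\<bar>" by linarith
    also have "\<dots> \<le> M + sqrt i * M * vnorm i x"
      using Mge ij M0 by (intro add_mono abs_mv_le) (auto simp: f_def)
    also have "\<dots> \<le> M + sqrt i * M * (sqrt i * M / s)"
    proof (intro add_left_mono mult_left_mono)
      have "vnorm i y \<le> L2_set (\<lambda>_. M) {..<i}"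
        unfolding L2_set_def
      proof (intro real_sqrt_le_mono sum_mono)
        fix r assume "r \<in> {..<i}"
        then have "\<bar>y r\<bar> \<le> \<bar>M\<bar>" using Mge[of r j] ij M0 by (simp add: y_def)
        then show "(y r)\<^sup>2 \<le> M\<^sup>2" by (simp only: abs_le_square_iff)
      qed
      also have "\<dots> = sqrt i * M" using M0 by (simp add: L2_set_constant)
      finally have "vnorm i y / s \<le> sqrt i * M / s" using s by (intro divide_right_mono) auto
      with x(2) show "vnorm i x \<le> sqrt i * M / s" by linarith
    qed (use M0 in auto)
    also have "\<dots> = M * (1 + real i * M / s)" by (simp add: algebra_simps) 
    also have "\<dots> \<le> M * (1 + real n * K / s)"
      using M0 MK ij s K0 by (intro mult_left_mono add_left_mono divide_right_mono mult_mono) auto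
    finally show ?thesis .
  qed
  have "max_norm L \<le> 1 + real n * K / s" by (rule maxle[OF Lc Lbound])
  moreover have "max_norm U / M \<le> 1 + real n * K / s"
  \<comment> \<open>In this case the quotient is 0 by the convention for division.\<close>
  proof (cases "M = 0")
    case True then show ?thesis using K0 s by (simp add: add_nonneg_nonneg)
  next
    case False
    have "max_norm U \<le> M * (1 + real n * K / s)" by (rule maxle[OF Uc Ubound])
    then show ?thesis using False M0 by (simp add: field_simps)
  qed
  moreover have "growth A = ereal (max (max_norm L) (max_norm U / M))"
    using sn A unfolding growth_def the M_def by simp
  ultimately show ?thesis by simp
qed

section \<open>Conclusion\<close>

context discrete_law
begin

lemma uniform_well_cond:
  obtains s where "s > 0" "\<And>f k. f \<in> set_pmf (sqmat m) \<Longrightarrow> lead_nonsing m f \<Longrightarrow> k \<le> m \<Longrightarrow> well_cond s k f"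
proof -
  define S where "S = set_pmf (sqmat m) \<inter> {f. lead_nonsing m f}"
  have finS: "finite S" using fin by (simp add: S_def)
  have "\<exists>s>0. \<forall>f\<in>S. \<forall>k\<in>{..m}. well_cond s k f"
  proof -
    have "\<exists>s>0. well_cond s (snd fk) (fst fk)" if "fk \<in> S \<times> {..m}" for fk
      using that by (intro nonsing_imp_well_cond) (auto simp: S_def lead_nonsing_def)
    then obtain s where s: "\<And>fk. fk \<in> S \<times> {..m} \<Longrightarrow> s fk > 0 \<and> well_cond (s fk) (snd fk) (fst fk)"
      by metis
    \<comment> \<open>The extra 1 keeps the minimum defined when no matrix of the support has all
      its leading blocks non-singular.\<close>
    define s0 where "s0 = Min (insert 1 (s ` (S \<times> {..m})))"
    have finI: "finite (insert 1 (s ` (S \<times> {..m})))" using finS by simp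
    have "s0 > 0" unfolding s0_def using finI s by (subst Min_gr_iff) auto
    moreover have "well_cond s0 k f" if "f \<in> S" "k \<in> {..m}" for f k
    proof -
      have "s0 \<le> s (f, k)" unfolding s0_def using finI that by (intro Min_le) auto
      then show ?thesis using s[of "(f, k)"] that well_cond_mono by auto
    qed
    ultimately show ?thesis by blast
  qed
  then obtain s where s: "s > 0" "\<forall>f\<in>S. \<forall>k\<in>{..m}. well_cond s k f" by blast
  show thesis
  proof (rule that[OF s(1)])
    fix f k assume "f \<in> set_pmf (sqmat m)" "lead_nonsing m f" "k \<le> m"
    then show "well_cond s k f" using s(2) by (simp add: S_def)
  qed
qed

text \<open>Half of the exponent is kept as decay in m, and the other half pays for
  summability.\<close>

lemma stretched_tail:
  "\<forall>\<^sub>F m in sequentially. \<forall>n. (\<Sum>k\<in>{m<..<n}. exp (- (real k powr (7/10)))) \<le>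
     exp (- (real m powr (7/10)) / 2) * (\<Sum>k. 1 / real k ^ 2)"
proof -
  have "\<forall>\<^sub>F k in sequentially. exp (- (real k powr (7/10)) / 2) \<le> 1 / real k ^ 2" by real_asymp
  then obtain k0 where k0: "\<And>k. k \<ge> k0 \<Longrightarrow> exp (- (real k powr (7/10)) / 2) \<le> 1 / real k ^ 2"
    unfolding eventually_sequentially by blast
  have sm: "summable (\<lambda>k. 1 / real k ^ 2)" using inverse_power_summable[of 2, where 'a = real]
    by (simp add: inverse_eq_divide)
  show ?thesis unfolding eventually_sequentially
  proof (intro exI[of _ k0] allI impI)
    fix m n assume m: "m \<ge> k0"
    have "(\<Sum>k\<in>{m<..<n}. exp (- (real k powr (7/10))))
        \<le> (\<Sum>k\<in>{m<..<n}. exp (- (real m powr (7/10)) / 2) * (1 / real k ^ 2))"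
    proof (rule sum_mono)
      fix k assume k: "k \<in> {m<..<n}"
      have "real m powr (7/10) \<le> real k powr (7/10)" using k by (intro powr_mono2) auto
      then have "exp (- (real k powr (7/10))) \<le> exp (- (real m powr (7/10)) / 2)
          * exp (- (real k powr (7/10)) / 2)"
        by (simp add: exp_add[symmetric])
      also have "\<dots> \<le> exp (- (real m powr (7/10)) / 2) * (1 / real k ^ 2)"
        using k0[of k] k m by (intro mult_left_mono) auto
      finally show "exp (- (real k powr (7/10)))
          \<le> exp (- (real m powr (7/10)) / 2) * (1 / real k ^ 2)" .
    qed
    also have "\<dots> = exp (- (real m powr (7/10)) / 2) * (\<Sum>k\<in>{m<..<n}. 1 / real k ^ 2)"
      by (simp add: sum_distrib_left)
    also have "\<dots> \<le> exp (- (real m powr (7/10)) / 2) * (\<Sum>k. 1 / real k ^ 2)"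
      by (intro mult_left_mono sum_le_suminf sm) auto
    finally show "(\<Sum>k\<in>{m<..<n}. exp (- (real k powr (7/10))))
        \<le> exp (- (real m powr (7/10)) / 2) * (\<Sum>k. 1 / real k ^ 2)" .
  qed
qed

text \<open>m, and with it B, is fixed before \<delta>, which enters only through s and the decay of
  the error term.\<close>

lemma growth_probability:
  assumes "\<beta> < 1"
  obtains B where "B < 1" "\<And>\<delta>. \<delta> > 0 \<Longrightarrow> \<exists>D. \<forall>\<^sub>F n in sequentially.
    Pr (sqmat n) {f. growth (Matrix.mat n n f) > ereal (real n powr (5/2 + \<delta>))}
        \<le> B + D * real n powr (- \<delta> / 2)"
proof -
  obtain C where C: "C > 0" "\<forall>\<^sub>F n in sequentially. \<forall>s\<ge>0.
    Pr (sqmat n) (small_image n s) \<le> C * sqrt n * s + exp (- (real n powr (7/10)))"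
    by (rule smallest_singular_value)
  obtain a c where ac: "0 < a" "0 < c" "\<forall>\<^sub>F m in sequentially. a * exp (- c * sqrt (real m))
      \<le> prob_lead_nonsing m"
    by (rule prob_lead_nonsing_lower_bound[OF assms])
  define \<zeta> where "\<zeta> = (\<Sum>k. 1 / real k ^ 2)"
  have \<zeta>: "\<zeta> \<ge> 0" unfolding \<zeta>_def
    using inverse_power_summable[of 2, where 'a = real]
      by (intro suminf_nonneg) (auto simp: inverse_eq_divide)
  have 1: "\<forall>\<^sub>F m in sequentially. exp (- (real m powr (7/10)) / 2) * (\<zeta> + 1)
      \<le> a * exp (- c * sqrt (real m)) / 2"
  proof -
    have "\<zeta> + 1 > 0" using \<zeta> by simp
    then show ?thesis using ac by real_asymp
  qed
  have "\<forall>\<^sub>F m in sequentially. (\<forall>n. (\<Sum>k\<in>{m<..<n}. exp (- (real k powr (7/10))))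
      \<le> prob_lead_nonsing m / 2) \<and> (\<forall>n\<ge>m. \<forall>s\<ge>0.
    Pr (sqmat n) (small_image n s) \<le> C * sqrt n * s + exp (- (real n powr (7/10))))"
  proof -
    have 2: "\<forall>\<^sub>F m in sequentially. \<forall>n\<ge>m. \<forall>s\<ge>0.
      Pr (sqmat n) (small_image n s) \<le> C * sqrt n * s + exp (- (real n powr (7/10)))"
      using C(2) by (rule eventually_all_ge_at_top)
    from 1 2 ac(3) stretched_tail show ?thesis
    proof eventually_elim
      case (elim m)
      have "(\<Sum>k\<in>{m<..<n}. exp (- (real k powr (7/10)))) \<le> prob_lead_nonsing m / 2" for n
      proof -
        have "(\<Sum>k\<in>{m<..<n}. exp (- (real k powr (7/10)))) \<le> exp (- (real m powr (7/10)) / 2) * \<zeta>"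
          using elim(4) unfolding \<zeta>_def by blast
        also have "\<dots> \<le> exp (- (real m powr (7/10)) / 2) * (\<zeta> + 1)" by simp
        also have "\<dots> \<le> prob_lead_nonsing m / 2" using elim(1,3) by linarith
        finally show ?thesis .
      qed
      with elim(2) show ?case by blast
    qed
  qed
  then obtain m where m: "\<And>n. (\<Sum>k\<in>{m<..<n}. exp (- (real k powr (7/10)))) \<le> prob_lead_nonsing m / 2"
    and sing: "\<And>n s. n \<ge> m \<Longrightarrow> s \<ge> 0 \<Longrightarrow>
    Pr (sqmat n) (small_image n s) \<le> C * sqrt n * s + exp (- (real n powr (7/10)))"
    unfolding eventually_sequentially by blast
  obtain s0 where s0: "s0 > 0" "\<And>f k. f \<in> set_pmf (sqmat m) \<Longrightarrow> lead_nonsing m f \<Longrightarrow> k \<le> m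
      \<Longrightarrow> well_cond s0 k f"
    by (rule uniform_well_cond[of m]) blast
  \<comment> \<open>The failure probability \<open>1 - prob_lead_nonsing m\<close> of the first m
    blocks, plus half of \<open>prob_lead_nonsing m\<close> for the later ones.\<close>
  define B where "B = 1 - prob_lead_nonsing m / 2"
  show thesis
  proof (rule that[of B])
    show "B < 1" using prob_lead_nonsing_pos[OF assms, of m] by (simp add: B_def)
    fix \<delta> :: real assume \<delta>: "\<delta> > 0"
    \<comment> \<open>Makes n sqrt n s equal to n^(-\<delta> / 2), which tends to 0, while n K / s =
      K n^(5/2 + \<delta> / 2) is eventually below the target.\<close>
    define s where "s n = real n powr (- 3/2 - \<delta> / 2)" for n :: nat
    have ev1: "\<forall>\<^sub>F n in sequentially. s n \<le> s0" unfolding s_def using s0(1) \<delta> by real_asymp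
    have K0: "K > 0" using K by simp
    have ev2: "\<forall>\<^sub>F n in sequentially. 1 + real n * K / s n \<le> real n powr (5/2 + \<delta>)"
      unfolding s_def using K0 \<delta> by real_asymp
    have "\<forall>\<^sub>F n in sequentially.
      Pr (sqmat n) {f. growth (Matrix.mat n n f) > ereal (real n powr (5/2 + \<delta>))}
          \<le> B + C * real n powr (- \<delta> / 2)"
      using ev1 ev2 eventually_ge_at_top[of "Suc m"]
    proof eventually_elim
      case (elim n)
      have n1: "n \<ge> 1" using elim by simp
      have sn: "s n > 0" using n1 by (simp add: s_def)
      define T where "T k = (small_image k (s n))" for k
      have cover: "f \<in> {f. \<not> lead_nonsing m f} \<union> (\<Union>k\<in>{m<..<n}. T k)"
        if f: "f \<in> set_pmf (sqmat n)" "f \<in> {f. growth (Matrix.mat n n f) > ereal (real n powr (5/2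
            + \<delta>))}" for f
      proof (rule ccontr)
        assume nf: "\<not> ?thesis"
        then have ld: "lead_nonsing m f" and nT: "\<And>k. m < k \<Longrightarrow> k < n \<Longrightarrow> f \<notin> T k" by auto
        \<comment> \<open>The corner of f, set to 0 outside, lies in the support of
          \<open>sqmat m\<close>, where the uniform constant \<open>s0\<close> is available.\<close>
        define f' where "f' = (\<lambda>x. if x \<in> {..<m} \<times> {..<m} then f x else 0)"
        have "sqmat m = map_pmf (\<lambda>f x. if x \<in> {..<m} \<times> {..<m} then f x else 0) (sqmat n)"
          by (rule Pi_pmf_subset) (use elim in auto)
        then have f': "f' \<in> set_pmf (sqmat m)" using f(1) by (auto simp: f'_def)
        have eq: "f' (i, j) = f (i, j)" if "i < m" "j < m" for i j using that by (simp add: f'_def)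
        have ld': "lead_nonsing m f'" using ld lead_nonsing_cong[of m f' f] eq by simp
        have "growth (Matrix.mat n n f) \<le> ereal (1 + real n * K / s n)"
        proof (rule growth_le[OF _ n1 sn])
          fix i j assume ij: "i < n" "j < n"
          have "f (i, j) \<in> set_pmf \<xi>" by (rule Pi_pmf_inside[OF _ f(1)]) (use ij in auto)
          then show "\<bar>Matrix.mat n n f $$ (i, j)\<bar> \<le> K" using bound ij by simp
        next
          fix k assume k: "k < n"
          have "well_cond (s n) k f"
          proof (cases "k \<le> m")
            case True
            have "well_cond s0 k f'" by (rule s0(2)[OF f' ld' True])
            then have "well_cond s0 k f" using well_cond_cong[of k f' f] eq True by simp
            then show ?thesis using elim(1) by (rule well_cond_mono)
          next
            case False
            then have "f \<notin> T k" using nT k by simp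
            then show ?thesis by (intro well_condI) (force simp: T_def)
          qed
          then show "well_cond (s n) k (\<lambda>ij. Matrix.mat n n f $$ ij)"
            using well_cond_cong[of k f "\<lambda>ij. Matrix.mat n n f $$ ij"] k by simp
        qed simp
        also have "\<dots> \<le> ereal (real n powr (5/2 + \<delta>))" using elim(2) by simp
        finally show False using f(2) by simp
      qed
      have "Pr (sqmat n) {f. growth (Matrix.mat n n f) > ereal (real n powr (5/2 + \<delta>))} \<le>
        Pr (sqmat n) ({f. \<not> lead_nonsing m f} \<union> (\<Union>k\<in>{m<..<n}. T k))"
        by (rule prob_mono_pmf) (rule cover)
      also have "\<dots> \<le> Pr (sqmat n) {f. \<not> lead_nonsing m f} + Pr (sqmat n) (\<Union>k\<in>{m<..<n}. T k)"
        by (rule measure_Un_le) auto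
      also have "Pr (sqmat n) {f. \<not> lead_nonsing m f} = 1 - prob_lead_nonsing m"
      proof -
        have "Pr (sqmat n) {f. lead_nonsing m f} = prob_lead_nonsing m"
          unfolding prob_lead_nonsing_def by (rule prob_corner) (use elim in \<open>auto intro!:
              lead_nonsing_cong\<close>)
        moreover have "{f. \<not> lead_nonsing m f} = UNIV - {f. lead_nonsing m f}" by auto
        ultimately show ?thesis using measure_pmf.prob_compl[of "{f. lead_nonsing m f}" "sqmat n"]
          by simp
      qed
      also have "Pr (sqmat n) (\<Union>k\<in>{m<..<n}. T k) \<le> (\<Sum>k\<in>{m<..<n}. Pr (sqmat n) (T k))"
        by (intro measure_pmf.finite_measure_subadditive_finite) auto
      also have "\<dots> \<le> (\<Sum>k\<in>{m<..<n}. C * sqrt n * s n + exp (- (real k powr (7/10))))"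
      proof (rule sum_mono)
        fix k assume k: "k \<in> {m<..<n}"
        have "Pr (sqmat n) (T k) = Pr (sqmat k) (T k)"
          unfolding T_def
        proof (rule prob_corner)
          fix f g :: "nat \<times> nat \<Rightarrow> real" assume eq: "\<And>i j. i < k \<Longrightarrow> j < k \<Longrightarrow> f (i, j) = g (i, j)"
          have "L2_set (mv k f x) {..<k} = L2_set (mv k g x) {..<k}" for x
            by (intro L2_set_cong mv_cong) (use eq in auto)
          then show "(\<exists>x. vnorm k x = 1 \<and> L2_set (mv k f x) {..<k} \<le> s n) \<longleftrightarrow> (\<exists>x. vnorm k x = 1
              \<and> L2_set (mv k g x) {..<k} \<le> s n)" by simp
        qed (use k in auto)
        also have "\<dots> \<le> C * sqrt k * s n + exp (- (real k powr (7/10)))"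
          unfolding T_def using k sn by (intro sing) auto
        also have "\<dots> \<le> C * sqrt n * s n + exp (- (real k powr (7/10)))"
          using k C sn by (intro add_right_mono mult_right_mono mult_left_mono) auto
        finally show "Pr (sqmat n) (T k) \<le> C * sqrt n * s n + exp (- (real k powr (7/10)))" .
      qed
      also have "\<dots> = card {m<..<n} * (C * sqrt n * s n)
          + (\<Sum>k\<in>{m<..<n}. exp (- (real k powr (7/10))))"
        by (simp add: sum.distrib)
      also have "\<dots> \<le> real n * (C * sqrt n * s n) + prob_lead_nonsing m / 2"
        using C sn by (intro add_mono mult_right_mono m) auto
      also have "real n * (C * sqrt n * s n) = C * real n powr (- \<delta> / 2)"
      proof -
        have "real n * (C * sqrt n * s n) = C * (real n powr 1 * real n powr (1/2)
            * real n powr (- 3/2 - \<delta> / 2))"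
          using n1 by (simp add: s_def powr_half_sqrt)
        also have "real n powr 1 * real n powr (1/2) * real n powr (- 3/2 - \<delta> / 2)
            = real n powr (- \<delta> / 2)"
          by (simp only: powr_add[symmetric]) simp
        finally show ?thesis .
      qed
      finally show ?case by (simp add: B_def)
    qed
    then show "\<exists>D. \<forall>\<^sub>F n in sequentially.
      Pr (sqmat n) {f. growth (Matrix.mat n n f) > ereal (real n powr (5/2 + \<delta>))}
          \<le> B + D * real n powr (- \<delta> / 2)" by blast
  qed
qed

end

theorem theorem1p1:
  fixes \<xi> :: "real pmf"
  assumes "finite (set_pmf \<xi>)"
    and "max_atom \<xi> < 1"
  shows "\<exists>C<1. \<forall>\<delta>>0. \<exists>\<epsilon> :: nat \<Rightarrow> real. \<epsilon> \<longlonglongrightarrow> 0 \<and>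
    (\<forall>n\<ge>1. measure_pmf.prob (random_matrix n \<xi>)
        {A. growth A > ereal (real n powr (5 / 2 + \<delta>))} \<le> C + \<epsilon> n)"
proof -
  obtain a b where ab: "a \<in> set_pmf \<xi>" "b \<in> set_pmf \<xi>" "a \<noteq> b" by (rule two_atoms[OF assms(2)])
  define K where "K = 1 + (\<Sum>x\<in>set_pmf \<xi>. \<bar>x\<bar>)"
  interpret discrete_law \<xi> K "2 * min (pmf \<xi> a) (pmf \<xi> b)" "\<bar>a - b\<bar> / (2 * pi)"
  proof
    show "\<bar>x\<bar> \<le> K" if "x \<in> set_pmf \<xi>" for x
      using member_le_sum[of x "set_pmf \<xi>" "\<lambda>x. \<bar>x\<bar>"] that assms(1) by (simp add: K_def)
    show "1 \<le> K" by (simp add: K_def sum_nonneg)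
    show "0 < 2 * min (pmf \<xi> a) (pmf \<xi> b)" using ab by (simp add: pmf_positive)
    show "cmod (Mean \<xi> (\<lambda>x. cis (t * x))) \<le>
       exp (- (2 * min (pmf \<xi> a) (pmf \<xi> b)) * (rdist (\<bar>a - b\<bar> / (2 * pi) * t))\<^sup>2)" for t
      by (rule char_bound_atoms[OF assms(1) ab])
  qed (use assms ab in auto)
  have "\<beta> < 1" using assms(2) by (simp add: \<beta>_def)
  then obtain B where B: "B < 1" "\<And>\<delta>. \<delta> > 0 \<Longrightarrow> \<exists>D. \<forall>\<^sub>F n in sequentially.
    Pr (sqmat n) {f. growth (Matrix.mat n n f) > ereal (real n powr (5/2 + \<delta>))} \<le> B + D * real n powr (- \<delta> / 2)"
    by (rule growth_probability) blast
  show ?thesis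
  proof (intro exI[of _ B] conjI allI impI B(1))
    fix \<delta> :: real assume \<delta>: "\<delta> > 0"
    define p where "p n = Pr (random_matrix n \<xi>) {A. growth A > ereal (real n powr (5 / 2 + \<delta>))}" for n
    obtain D where D: "\<forall>\<^sub>F n in sequentially. p n \<le> B + D * real n powr (- \<delta> / 2)"
      using B(2)[OF \<delta>] by (auto simp: p_def random_matrix_def vimage_def)
    show "\<exists>\<epsilon> :: nat \<Rightarrow> real. \<epsilon> \<longlonglongrightarrow> 0 \<and> (\<forall>n\<ge>1. Pr (random_matrix n \<xi>)
        {A. growth A > ereal (real n powr (5 / 2 + \<delta>))} \<le> B + \<epsilon> n)"
    \<comment> \<open>The inequality is required for all n \<ge> 1 and not only eventually, so the
      error is the excess itself; the eventual bound shows that it tends to 0.\<close>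
    proof (intro exI[of _ "\<lambda>n. max 0 (p n - B)"] conjI allI impI)
      have lim: "(\<lambda>n. \<bar>D\<bar> * real n powr (- \<delta> / 2)) \<longlonglongrightarrow> 0"
      proof -
        have "(\<lambda>n. real n powr (- \<delta> / 2)) \<longlonglongrightarrow> 0" using \<delta> by real_asymp
        then show ?thesis by (rule tendsto_mult_right_zero)
      qed
      show "(\<lambda>n. max 0 (p n - B)) \<longlonglongrightarrow> 0"
      proof (rule tendsto_sandwich[OF _ _ tendsto_const lim])
        show "\<forall>\<^sub>F n in sequentially. max 0 (p n - B) \<le> \<bar>D\<bar> * real n powr (- \<delta> / 2)"
          using D
        proof eventually_elim
          case (elim n)
          have "D * real n powr (- \<delta> / 2) \<le> \<bar>D\<bar> * real n powr (- \<delta> / 2)" by (intro mult_right_mono) auto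
          moreover have "0 \<le> \<bar>D\<bar> * real n powr (- \<delta> / 2)" by simp
          ultimately show ?case using elim by simp
        qed
      qed simp
      fix n :: nat
      show "Pr (random_matrix n \<xi>) {A. growth A > ereal (real n powr (5 / 2 + \<delta>))} \<le> B + max 0 (p n - B)"
        unfolding p_def[symmetric] by simp
    qed
  qed
qed

end
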